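(* Let $F\subseteq\mathbb{R}^2$ be a self-similar set, not contained in any affine line, with $0<\dim_H F<2$, generated by an IFS $\Phi=\{\phi_i\}_{i=1}^l$ of contracting similarities satisfying the strong separation condition. Let $g(z)=Az+t$ with $A\in GL(\mathbb{R}^2)$, $t\in\mathbb{R}^2$, satisfy $g(F)\subseteq F$. \begin{enumerate} \item If $|G_\Phi|=\infty$, then $g$ is a similarity, and there exist $k\in\mathbb{N}$ and finite words $I,J\in\{1,\dots,l\}^*$ such that $g^k\circ\phi_I=\phi_J$. \item If $|G_\Phi|<\infty$ and all maps in $\Phi$ have the same contraction ratio $\lambda\in(0,1)$, then $A$ is diagonalizable over $\mathbb{C}$, and its eigenvalues $\gamma_1,\gamma_2\in\mathbb{C}$ satisfy $|\gamma_1|=\lambda^p$, $|\gamma_2|=\lambda^q$ for some $p,q\in\mathbb{Q}$. \end{enumerate}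
   Context: A similarity of $\mathbb{R}^2$ is a map $z\mapsto \alpha Oz+t$ with $\alpha\neq 0$, $O\in O(\mathbb{R}^2)$ (its orthogonal part), $t\in\mathbb{R}^2$; it is contracting with contraction ratio $|\alpha|$ if $|\alpha|<1$. An IFS $\Phi=\{\phi_i\}_{i=1}^l$ ($l\ge2$) of contracting similarities has a unique nonempty compact attractor $F=\bigcup_i\phi_i(F)$; such $F$ is called self-similar. $\Phi$ satisfies the strong separation condition (SSC) if $\phi_i(F)\cap\phi_j(F)=\emptyset$ for $i\neq j$. $G_\Phi\le O(\mathbb{R}^2)$ denotes the group generated by the orthogonal parts of the maps in $\Phi$. For a word $I=(i_1,\dots,i_k)$, $\phi_I=\phi_{i_1}\circ\cdots\circ\phi_{i_k}$. *)

theory Defs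
  imports "HOL-Analysis.Analysis"
begin

type_synonym pt = "real^2"

definition similarity :: "(pt \<Rightarrow> pt) \<Rightarrow> bool" where
  "similarity f \<longleftrightarrow> (\<exists>a (Q::real^2^2) t. a \<noteq> 0 \<and> orthogonal_matrix Q \<and>
       f = (\<lambda>z. a *\<^sub>R (Q *v z) + t))"

text \<open>The IFS is given by data (r i, O i, \<tau> i), i = 1..l:
  phi_i z = r i * (O i z) + \<tau> i (orthogonal part O i, contraction ratio |r i|).\<close>
definition ifs_map :: "(nat \<Rightarrow> real) \<Rightarrow> (nat \<Rightarrow> real^2^2) \<Rightarrow> (nat \<Rightarrow> pt) \<Rightarrow> nat \<Rightarrow> pt \<Rightarrow> pt" where
  "ifs_map r Q \<tau> i = (\<lambda>z. r i *\<^sub>R (Q i *v z) + \<tau> i)"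

definition word_map :: "(nat \<Rightarrow> pt \<Rightarrow> pt) \<Rightarrow> nat list \<Rightarrow> pt \<Rightarrow> pt" where
  "word_map \<phi> I = foldr (\<lambda>i f. \<phi> i \<circ> f) I id"

inductive_set gen_group :: "(real^2^2) set \<Rightarrow> (real^2^2) set" for S where
  one: "mat 1 \<in> gen_group S"
| mult: "M \<in> gen_group S \<Longrightarrow> X \<in> S \<Longrightarrow> X ** M \<in> gen_group S"
| mult_inv: "M \<in> gen_group S \<Longrightarrow> X \<in> S \<Longrightarrow> matrix_inv X ** M \<in> gen_group S"

definition hausdorff_pre :: "real \<Rightarrow> real \<Rightarrow> pt set \<Rightarrow> ennreal" where
  "hausdorff_pre s \<delta> E = (INF U \<in> {U :: nat \<Rightarrow> pt set. E \<subseteq> (\<Union>i. U i) \<and>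
       (\<forall>i. bounded (U i) \<and> diameter (U i) \<le> \<delta>)}. (\<Sum>i. ennreal (diameter (U i) powr s)))"

definition hausdorff_measure :: "real \<Rightarrow> pt set \<Rightarrow> ennreal" where
  "hausdorff_measure s E = (SUP \<delta> \<in> {0<..}. hausdorff_pre s \<delta> E)"

definition hausdorff_dim :: "pt set \<Rightarrow> real" where
  "hausdorff_dim E = Inf {s. s > 0 \<and> hausdorff_measure s E = 0}"

definition cmat :: "real^2^2 \<Rightarrow> complex^2^2" where
  "cmat A = (\<chi> i j. complex_of_real (A $ i $ j))"

definition diagonalizable_C :: "real^2^2 \<Rightarrow> bool" where
  "diagonalizable_C A \<longleftrightarrow> (\<exists>P Q D :: complex^2^2. P ** Q = mat 1 \<and> Q ** P = mat 1 \<and>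
      (\<forall>i j. i \<noteq> j \<longrightarrow> D $ i $ j = 0) \<and> cmat A = P ** D ** Q)"

definition eigenvalue_C :: "real^2^2 \<Rightarrow> complex \<Rightarrow> bool" where
  "eigenvalue_C A \<gamma> \<longleftrightarrow> (\<exists>v :: complex^2. v \<noteq> 0 \<and> cmat A *v v = \<gamma> *s v)"

end

theory Submission
  imports Defs "HOL-Real_Asymp.Real_Asymp"
begin

text \<open>
  Let \<open>S\<close> be the set of injective affine maps that send \<open>F\<close> into itself, and write \<open>\<phi> J\<close> for the composition
  along the word \<open>J\<close> and \<open>phinv J\<close> for its inverse. The heart of the matter is that \<open>S\<close> is discrete. Near the identity this is a zooming
  argument: if \<open>f\<close> in \<open>S\<close> is close to the identity then it preserves all cylinders, since a point of an ever
  smaller cylinder that moved by a fraction of the cylinder would force the extreme point of that cylinder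
  to leave it. The same holds near any \<open>h\<close> in \<open>S\<close> whose image contains a cylinder, and every \<open>h\<close>
  in \<open>S\<close> has this property: as the weights \<open>\<bar>r i\<bar> powr s\<close> sum to one for some \<open>s\<close>, the image \<open>h ` F\<close> cannot miss a
  subcylinder at every place and scale, so suitable blow-ups of \<open>h\<close> converge to a map onto a
  relatively open subset of \<open>F\<close>, and this limit is isolated.

  Consequently the maps \<open>phinv J \<circ> g \<circ> \<phi> I\<close>, with \<open>J\<close> chosen so that they have size comparable to one, are
  finitely many. If the orthogonal parts generate an infinite group, then \<open>transpose A ** A\<close> has a finite orbit
  under conjugation by that group, hence is scalar, and \<open>phinv (J n) \<circ> g ^^ n = phinv (J m) \<circ> g ^^ m\<close> for some
  \<open>n < m\<close>. If the group is finite and all ratios are \<open>\<lambda>\<close>, then after composing with some \<open>\<phi> I\<close> the map \<open>g\<close> is strongly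
  contracting and acts on addresses as a finite automaton, so its fixed point has an eventually periodic
  address. Near it \<open>F\<close> is invariant under a homothety \<open>\<Lambda> = \<lambda> ^ M\<close> as well as under \<open>A\<close>. If the modulus of the
  dominant real eigenvalue were not commensurable with \<open>\<Lambda>\<close>, or if \<open>A\<close> were a Jordan block, then \<open>F\<close> would
  contain a segment. The other eigenvalue is dominant for the inverse of \<open>A\<close>, which again
  comes from a map in \<open>S\<close>.
\<close>

section \<open>Affine maps of the plane\<close>

text \<open>Maps are coded by their coefficient pairs, so that they form a finite-dimensional normed
  space in which bounded sequences have convergent subsequences; \<open>aff_eq_iff\<close> makes the
  coding faithful.\<close>

definition aff :: "(real^2^2) \<times> pt \<Rightarrow> pt \<Rightarrow> pt" where
  "aff p z = fst p *v z + snd p"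

text \<open>For positive \<open>c\<close> this is quantitative injectivity. Unlike injectivity
  itself, the condition with a fixed \<open>c\<close> passes to pointwise limits of maps.\<close>

definition expands :: "real \<Rightarrow> (pt \<Rightarrow> pt) \<Rightarrow> bool" where
  "expands c f \<longleftrightarrow> (\<forall>x y. c * dist x y \<le> dist (f x) (f y))"

lemma expandsD: "expands c f \<Longrightarrow> c * dist x y \<le> dist (f x) (f y)"
  by (simp add: expands_def)

text \<open>The norm of a matrix is here the Euclidean norm of all its entries; Cauchy-Schwarz in
  each row gives the bound.\<close>

lemma norm_matrix_vector_mult_le: "norm (M *v v) \<le> norm M * norm v"
  for M :: "real^'n^'m"
proof -
  have "norm (M *v v) = L2_set (\<lambda>i. norm ((M *v v) $ i)) UNIV"
    by (simp add: norm_vec_def)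
  also have "\<dots> \<le> L2_set (\<lambda>i. norm (M $ i) * norm v) UNIV"
  proof (rule L2_set_mono)
    show "norm ((M *v v) $ i) \<le> norm (M $ i) * norm v" for i
      by (simp add: matrix_vector_mul_component Cauchy_Schwarz_ineq2)
  qed simp
  also have "\<dots> = norm M * norm v"
    by (simp add: norm_vec_def L2_set_left_distrib)
  finally show ?thesis .
qed

lemma aff_diff: "aff p x - aff p y = fst p *v (x - y)"
  by (simp add: aff_def algebra_simps)

lemma aff_comp: "\<exists>u. aff p \<circ> aff q = aff u \<and> fst u = fst p ** fst q"
  by (rule exI[of _ "(fst p ** fst q, fst p *v snd q + snd p)"])
    (auto simp: aff_def fun_eq_iff matrix_vector_mul_assoc algebra_simps)

lemma aff_inverse:
  assumes "M ** fst p = mat 1"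
  shows "\<exists>u. fst u = M \<and> aff u \<circ> aff p = id \<and> aff p \<circ> aff u = id"
proof (intro exI[of _ "(M, - (M *v snd p))"] conjI)
  have *: "fst p ** M = mat 1"
    using assms matrix_left_right_inverse by blast
  show "aff (M, - (M *v snd p)) \<circ> aff p = id"
    using assms by (auto simp: aff_def fun_eq_iff matrix_vector_mul_assoc algebra_simps)
  show "aff p \<circ> aff (M, - (M *v snd p)) = id"
    using * by (auto simp: aff_def fun_eq_iff matrix_vector_mul_assoc algebra_simps
        matrix_vector_mult_diff_distrib)
qed simp

lemma aff_eq_iff: "aff p = aff q \<longleftrightarrow> p = q"
proof
  assume *: "aff p = aff q"
  have "snd p = aff p 0" "snd q = aff q 0"
    by (auto simp: aff_def)
  with * have 1: "snd p = snd q" by simp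
  have "fst p *v z = fst q *v z" for z
    using fun_cong[OF *, of z] 1 by (simp add: aff_def)
  then have "fst p = fst q"
    by (simp add: matrix_eq)
  with 1 show "p = q" by (simp add: prod_eq_iff)
qed simp

lemma norm_orthogonal_matrix_vector [simp]:
  "orthogonal_matrix M \<Longrightarrow> norm (M *v x) = norm x" for M :: "real^'n^'n"
  by (metis matrix_of_matrix_vector_mul matrix_vector_mul_linear orthogonal_transformation
      orthogonal_transformation_matrix)

lemma norm_fst_snd_le: "norm (fst x) \<le> norm x" "norm (snd x) \<le> norm x"
  by (metis norm_fst_le norm_snd_le prod.collapse)+

lemma aff_minus: "aff (p - q) z = aff p z - aff q z"
  by (simp add: aff_def algebra_simps)

lemma aff_lipschitz: "dist (aff p x) (aff p y) \<le> norm (fst p) * dist x y"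
  using norm_matrix_vector_mult_le[of "fst p" "x - y"] by (simp add: dist_norm aff_diff)

lemma aff_lipschitz_pos: "dist (aff p x) (aff p y) \<le> (norm (fst p) + 1) * dist x y"
  using aff_lipschitz[of p x y] mult_right_mono[of "norm (fst p)" "norm (fst p) + 1" "dist x y"] by simp

lemma aff_left_inverse:
  assumes "expands c (aff p)" "c > 0"
  obtains u where "aff u \<circ> aff p = id" "aff p \<circ> aff u = id"
    "\<And>v. norm (fst u *v v) \<le> norm v / c"
proof -
  have e: "c * norm x \<le> norm (fst p *v x)" for x
    using expandsD[OF assms(1), of x 0] aff_diff[of p x 0] by (simp add: dist_norm)
  have "inj ((*v) (fst p))"
  proof (rule injI)
    fix x y assume "fst p *v x = fst p *v y"
    then show "x = y" using e[of "x - y"] assms(2) by (simp add: algebra_simps mult_le_0_iff)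
  qed
  then obtain M where M: "M ** fst p = mat 1"
    using matrix_left_invertible_injective by blast
  obtain u where u: "fst u = M" "aff u \<circ> aff p = id" "aff p \<circ> aff u = id" using aff_inverse[OF M] by blast
  have "norm (fst u *v v) \<le> norm v / c" for v
  proof -
    have "fst p *v (M *v v) = v"
      using M matrix_left_right_inverse by (metis matrix_vector_mul_assoc matrix_vector_mul_lid)
    then show ?thesis using e[of "M *v v"] u assms(2) by (simp add: field_simps)
  qed
  then show ?thesis using that u by blast
qed

text \<open>A nonzero row \<open>(a, b)\<close> of the linear part would force all differences of
  points of \<open>T\<close> to be multiples of \<open>(- b, a)\<close>, making \<open>T\<close>
  collinear. So the linear part vanishes, and then a single point of \<open>T\<close> kills the
  translation.\<close>

lemma aff_zero_on_noncollinear: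
  assumes "\<not> collinear T" "\<And>z. z \<in> T \<Longrightarrow> aff p z = 0"
  shows "p = 0"
proof -
  have z: "fst p *v (x - y) = 0" if "x \<in> T" "y \<in> T" for x y
    using aff_diff[of p x y] assms(2) that by simp
  have "fst p $ i = 0" for i
  proof (rule ccontr)
    assume w: "fst p $ i \<noteq> 0"
    define a b where "a = fst p $ i $ 1" "b = fst p $ i $ 2"
    have ab: "a\<^sup>2 + b\<^sup>2 > 0"
      using w by (auto simp: a_b_def vec_eq_iff forall_2 sum_power2_gt_zero_iff)
    define u :: pt where "u = vector [- b, a]"
    have "\<exists>c. x - y = c *\<^sub>R u" if "x \<in> T" "y \<in> T" for x y
    proof -
      define v where "v = x - y"
      have *: "a * v $ 1 + b * v $ 2 = 0"
        using arg_cong[OF z[OF that], of "\<lambda>z. z $ i"]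
        by (simp add: matrix_vector_mult_def sum_2 a_b_def v_def)
      have "v = ((a * v $ 2 - b * v $ 1) / (a\<^sup>2 + b\<^sup>2)) *\<^sub>R u"
      proof -
        have 1: "v $ 1 * (a\<^sup>2 + b\<^sup>2) = (a * v $ 2 - b * v $ 1) * (- b)"
          using * by algebra
        have 2: "v $ 2 * (a\<^sup>2 + b\<^sup>2) = (a * v $ 2 - b * v $ 1) * a"
          using * by algebra
        show ?thesis
          using ab 1 2 by (auto simp: vec_eq_iff forall_2 u_def divide_simps)
      qed
      then show ?thesis unfolding v_def by blast
    qed
    then show False using assms(1) unfolding collinear_def by blast
  qed
  then have f: "fst p = 0" by (simp add: vec_eq_iff)
  obtain x where "x \<in> T" using assms(1) by (metis collinear_empty ex_in_conv)
  then have "snd p = 0" using assms(2)[of x] f by (simp add: aff_def)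
  with f show ?thesis by (simp add: prod_eq_iff)
qed

lemma linear_aff: "linear (\<lambda>p. aff p z)"
  by (rule linearI) (auto simp: aff_def algebra_simps scaleR_matrix_vector_assoc)

lemma mat_mult_vector: "mat a *v v = a *\<^sub>R v" for v :: pt
  by (simp add: vec_eq_iff matrix_vector_mult_def mat_def sum_2 forall_2)

section \<open>Inverses and orthogonal stabilizers of symmetric matrices\<close>

lemma matrix_inv_eq:
  fixes X B :: "real^'n^'n"
  assumes "X ** B = mat 1" "B ** X = mat 1"
  shows "matrix_inv X = B"
proof -
  have "X ** matrix_inv X = mat 1 \<and> matrix_inv X ** X = mat 1"
    unfolding matrix_inv_def by (rule someI) (use assms in blast)
  then have "matrix_inv X = (B ** X) ** matrix_inv X" "B ** (X ** matrix_inv X) = B" using assms by auto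
  then show ?thesis by (simp add: matrix_mul_assoc)
qed

text \<open>For orthogonal \<open>N\<close>, the equation \<open>transpose N ** P ** N = P\<close>
  says that \<open>N\<close> commutes with \<open>P\<close>. A symmetric non-scalar \<open>P\<close>
  has two orthogonal eigenlines with distinct eigenvalues, and \<open>N\<close> must preserve both,
  which leaves finitely many \<open>N\<close>. For general \<open>Y\<close> the solutions are
  obtained from one solution \<open>M0\<close> as a coset of this stabilizer.\<close>

lemma finite_orthogonal_stabilizer:
  fixes P Y :: "real^2^2"
  assumes sym: "transpose P = P" and ns: "\<nexists>c. P = mat c"
  shows "finite {M. orthogonal_matrix M \<and> transpose M ** P ** M = Y}"
proof (cases "\<exists>M0. orthogonal_matrix M0 \<and> transpose M0 ** P ** M0 = Y")
  case True
  then obtain M0 where M0: "orthogonal_matrix M0" "transpose M0 ** P ** M0 = Y" by blast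
  define p q m where "p = P $ 1 $ 1" "q = P $ 2 $ 2" "m = P $ 1 $ 2"
  have m': "P $ 2 $ 1 = m"
    using arg_cong[OF sym, of "\<lambda>M. M $ 2 $ 1"] by (simp add: transpose_def p_q_m_def)
  have nz: "m \<noteq> 0 \<or> p \<noteq> q"
  proof (rule ccontr)
    assume "\<not> ?thesis"
    then have "P = mat p" using m' by (auto simp: vec_eq_iff forall_2 mat_def p_q_m_def)
    then show False using ns by blast
  qed
  \<comment> \<open>The discriminant of the characteristic polynomial of \<open>P\<close>. After
    division by its root, \<alpha> and \<beta> are the cosine and sine of twice the angle of an
    eigenline, hence up to sign the entries of the reflections that commute with
    \<open>P\<close>.\<close>
  define w where "w = (p - q)\<^sup>2 + 4 * m\<^sup>2"
  have w: "w > 0"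
  proof -
    have "(p - q)\<^sup>2 + (2 * m)\<^sup>2 > 0" unfolding sum_power2_gt_zero_iff using nz by auto
    then show ?thesis by (simp add: w_def power_mult_distrib)
  qed
  define \<alpha> \<beta> where "\<alpha> = (p - q) / sqrt w" "\<beta> = 2 * m / sqrt w"
  have \<alpha>\<beta>: "\<alpha>\<^sup>2 * w = (p - q)\<^sup>2" "\<beta>\<^sup>2 * w = 4 * m\<^sup>2"
    using w by (simp_all add: \<alpha>_\<beta>_def power_divide power_mult_distrib)
  define V where "V = {0, 1, - 1, \<alpha>, - \<alpha>, \<beta>, - \<beta>}"
  define mk :: "real \<times> real \<times> real \<times> real \<Rightarrow> real^2^2" where
    "mk = (\<lambda>(a, b, c, d). vector [vector [a, b], vector [c, d]])"
  have stab: "N \<in> mk ` (V \<times> V \<times> V \<times> V)" if N: "orthogonal_matrix N" "transpose N ** P ** N = P" for N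
  proof -
    define a b c d where "a = N $ 1 $ 1" "b = N $ 1 $ 2" "c = N $ 2 $ 1" "d = N $ 2 $ 2"
    have NN: "transpose N ** N = mat 1" "N ** transpose N = mat 1"
      using N(1) by (simp_all add: orthogonal_matrix_def)
    have "P ** N = (N ** transpose N) ** P ** N" using NN by simp
    also have "\<dots> = N ** P" using N(2) by (simp add: matrix_mul_assoc[symmetric])
    finally have comm: "P ** N = N ** P" .
    have e: "p * a + m * c = a * p + b * m" "p * b + m * d = a * m + b * q" "m * a + q * c = c * p + d * m"
      using arg_cong[OF comm, of "\<lambda>M. M $ 1 $ 1"] arg_cong[OF comm, of "\<lambda>M. M $ 1 $ 2"]
        arg_cong[OF comm, of "\<lambda>M. M $ 2 $ 1"] m'
      by (simp_all add: matrix_matrix_mult_def sum_2 p_q_m_def a_b_c_d_def)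
    have o: "a\<^sup>2 + c\<^sup>2 = 1" "b\<^sup>2 + d\<^sup>2 = 1" "a * b + c * d = 0"
      using arg_cong[OF NN(1), of "\<lambda>M. M $ 1 $ 1"] arg_cong[OF NN(1), of "\<lambda>M. M $ 1 $ 2"]
        arg_cong[OF NN(1), of "\<lambda>M. M $ 2 $ 2"]
      by (simp_all add: matrix_matrix_mult_def sum_2 transpose_def mat_def a_b_c_d_def power2_eq_square)
    have bc: "b = c"
      using e nz by (cases "m = 0") (auto simp: algebra_simps)
    have "a \<in> V \<and> b \<in> V \<and> c \<in> V \<and> d \<in> V"
    proof (cases "b = 0")
      case True
      then have "a\<^sup>2 = 1" "d\<^sup>2 = 1" using o bc by auto
      then show ?thesis using True bc by (auto simp: V_def power2_eq_1_iff)
    next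
      case False
      have "b * (a + d) = 0" using o(3) bc by (simp add: algebra_simps)
      then have d: "d = - a" using False by simp
      have k: "2 * a * m = b * (p - q)" using e(2) d by (simp add: algebra_simps)
      have ab: "a\<^sup>2 + b\<^sup>2 = 1" using o bc by simp
      have "a\<^sup>2 * w = (p - q)\<^sup>2" using k ab unfolding w_def by algebra
      then have "a\<^sup>2 = \<alpha>\<^sup>2" using \<alpha>\<beta>(1) w by (metis less_irrefl mult_right_cancel)
      moreover have "b\<^sup>2 * w = 4 * m\<^sup>2" using k ab unfolding w_def by algebra
      then have "b\<^sup>2 = \<beta>\<^sup>2" using \<alpha>\<beta>(2) w by (metis less_irrefl mult_right_cancel)
      ultimately show ?thesis using d bc by (auto simp: V_def power2_eq_iff)
    qed
    moreover have "N = mk (a, b, c, d)"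
      by (simp add: mk_def vec_eq_iff forall_2 a_b_c_d_def)
    ultimately show ?thesis by blast
  qed
  have "finite V" by (simp add: V_def)
  then have fin: "finite (mk ` (V \<times> V \<times> V \<times> V))" by simp
  have "{M. orthogonal_matrix M \<and> transpose M ** P ** M = Y} \<subseteq> (\<lambda>N. N ** M0) ` mk ` (V \<times> V \<times> V \<times> V)"
  proof
    fix M assume "M \<in> {M. orthogonal_matrix M \<and> transpose M ** P ** M = Y}"
    then have M: "orthogonal_matrix M" "transpose M ** P ** M = Y" by auto
    have M0': "transpose M0 ** M0 = mat 1" "M0 ** transpose M0 = mat 1"
      using M0(1) by (simp_all add: orthogonal_matrix_def)
    define N where "N = M ** transpose M0"
    have "orthogonal_matrix N" unfolding N_def using M M0 by (simp add: orthogonal_matrix_mul)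
    moreover have "transpose N ** P ** N = P"
    proof -
      have "transpose N ** P ** N = M0 ** (transpose M ** P ** M) ** transpose M0"
        by (simp add: N_def matrix_transpose_mul matrix_mul_assoc)
      also have "\<dots> = (M0 ** transpose M0) ** P ** (M0 ** transpose M0)"
        unfolding M(2) M0(2)[symmetric] by (simp add: matrix_mul_assoc)
      finally show ?thesis using M0' by simp
    qed
    ultimately have "N \<in> mk ` (V \<times> V \<times> V \<times> V)" by (rule stab)
    moreover have "M = N ** M0" using M0' by (simp add: N_def matrix_mul_assoc[symmetric])
    ultimately show "M \<in> (\<lambda>N. N ** M0) ` mk ` (V \<times> V \<times> V \<times> V)" by blast
  qed
  then show ?thesis using fin finite_subset by blast
next
  case False
  then have "{M. orthogonal_matrix M \<and> transpose M ** P ** M = Y} = {}" by blast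
  then show ?thesis by (simp only: finite.emptyI)
qed

section \<open>Eigenvalues, diagonalization and invariant quadratic forms of two by two
  matrices\<close>

lemma cayley_hamilton_2: "A *v (A *v v) = trace A *\<^sub>R (A *v v) - det A *\<^sub>R v" for A :: "real^2^2"
  by (simp add: vec_eq_iff forall_2 matrix_vector_mult_def sum_2 trace_def sum_2 det_2 algebra_simps)

lemma eigenvalue_C_char:
  assumes "eigenvalue_C A c"
  shows "c\<^sup>2 - of_real (trace A) * c + of_real (det A) = 0"
proof -
  obtain v :: "complex^2" where v: "v \<noteq> 0" "cmat A *v v = c *s v"
    using assms by (auto simp: eigenvalue_C_def)
  define a b a' b' where "a = complex_of_real (A $ 1 $ 1)" "b = complex_of_real (A $ 1 $ 2)"
    "a' = complex_of_real (A $ 2 $ 1)" "b' = complex_of_real (A $ 2 $ 2)"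
  note d = this
  have e: "a * v $ 1 + b * v $ 2 = c * v $ 1" "a' * v $ 1 + b' * v $ 2 = c * v $ 2"
    using arg_cong[OF v(2), of "\<lambda>w. w $ 1"] arg_cong[OF v(2), of "\<lambda>w. w $ 2"]
    by (simp_all add: matrix_vector_mult_def sum_2 cmat_def d)
  define f where "f = c\<^sup>2 - (a + b') * c + (a * b' - b * a')"
  have "f * v $ 1 = 0" using e unfolding f_def by algebra
  moreover have "f * v $ 2 = 0" using e unfolding f_def by algebra
  moreover have "v $ 1 \<noteq> 0 \<or> v $ 2 \<noteq> 0" using v(1) by (auto simp: vec_eq_iff forall_2)
  ultimately have "f = 0" by auto
  then show ?thesis by (simp add: f_def d trace_def sum_2 det_2)
qed

text \<open>A nonzero off-diagonal entry gives explicit eigenvectors, namely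
  \<open>(b, c - a)\<close> or \<open>(c - b', a')\<close> for each root \<open>c\<close>; they are
  independent because the roots differ. If both off-diagonal entries vanish, the matrix is already
  diagonal.\<close>

lemma diagonalizable_C_if_distinct:
  fixes c1 c2 :: complex
  assumes sum: "c1 + c2 = of_real (trace A)" and prod: "c1 * c2 = of_real (det A)" and ne: "c1 \<noteq> c2"
  shows "diagonalizable_C A"
proof -
  define a b a' b' where "a = complex_of_real (A $ 1 $ 1)" "b = complex_of_real (A $ 1 $ 2)"
    "a' = complex_of_real (A $ 2 $ 1)" "b' = complex_of_real (A $ 2 $ 2)"
  note d = this
  have s: "b' = c1 + c2 - a" using sum by (simp add: d trace_def sum_2)
  have p: "b * a' = a * b' - c1 * c2" using prod by (simp add: d det_2)
  have cA: "cmat A = vector [vector [a, b], vector [a', b']]"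
    by (simp add: vec_eq_iff forall_2 cmat_def d)
  have diag: "diagonalizable_C A" if PQ: "P ** R = mat 1" and D: "\<And>i j. i \<noteq> j \<Longrightarrow> D $ i $ j = 0"
    and eq: "cmat A ** P = P ** D" for P R D :: "complex^2^2"
  proof -
    have RP: "R ** P = mat 1" using PQ matrix_left_right_inverse by blast
    have "cmat A = (cmat A ** P) ** R" using PQ by (simp add: matrix_mul_assoc[symmetric])
    then have "cmat A = P ** D ** R" using eq by simp
    then show ?thesis unfolding diagonalizable_C_def using PQ RP D by blast
  qed
  define D :: "complex^2^2" where "D = vector [vector [c1, 0], vector [0, c2]]"
  have D: "D $ i $ j = 0" if "i \<noteq> j" for i j :: 2
    using that exhaust_2[of i] exhaust_2[of j] by (auto simp: D_def)
  consider "b \<noteq> 0" | "a' \<noteq> 0" | "b = 0" "a' = 0" by blast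
  then show ?thesis
  proof cases
    case 1
    \<comment> \<open>The inverted number is the determinant of the eigenvector matrix
      \<open>P\<close> defined next; \<open>R\<close> is the adjugate of \<open>P\<close> times
      \<open>k\<close>.\<close>
    define k where "k = inverse (b * (c2 - c1))"
    have k: "k * (b * (c2 - c1)) = 1" using 1 ne unfolding k_def by (intro left_inverse) simp
    define P :: "complex^2^2" where "P = vector [vector [b, b], vector [c1 - a, c2 - a]]"
    define R :: "complex^2^2" where "R = vector [vector [k * (c2 - a), - (k * b)], vector [- (k * (c1 - a)), k * b]]"
    have "P ** R = mat 1"
      using k by (simp add: P_def R_def vec_eq_iff forall_2 matrix_matrix_mult_def sum_2 mat_def algebra_simps)
    moreover have "cmat A ** P = P ** D"
      using p unfolding cA s by (simp add: P_def D_def vec_eq_iff forall_2 matrix_matrix_mult_def sum_2 algebra_simps)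
    ultimately show ?thesis using diag D by blast
  next
    case 2
    define k where "k = inverse (a' * (c1 - c2))"
    have k: "k * (a' * (c1 - c2)) = 1" using 2 ne unfolding k_def by (intro left_inverse) simp
    define P :: "complex^2^2" where "P = vector [vector [c1 - b', c2 - b'], vector [a', a']]"
    define R :: "complex^2^2" where "R = vector [vector [k * a', - (k * (c2 - b'))], vector [- (k * a'), k * (c1 - b')]]"
    have "P ** R = mat 1"
      using k by (simp add: P_def R_def vec_eq_iff forall_2 matrix_matrix_mult_def sum_2 mat_def algebra_simps)
    moreover have "cmat A ** P = P ** D"
      using p unfolding cA s by (simp add: P_def D_def s vec_eq_iff forall_2 matrix_matrix_mult_def sum_2 algebra_simps)
    ultimately show ?thesis using diag D by blast
  next
    case 3
    have "cmat A $ i $ j = 0" if "i \<noteq> j" for i j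
      using that exhaust_2[of i] exhaust_2[of j] 3 by (auto simp: cA)
    then show ?thesis by (intro diag[of "mat 1" "mat 1" "cmat A"]) auto
  qed
qed

lemma diagonalizable_C_scalar: "diagonalizable_C (mat c)"
  unfolding diagonalizable_C_def
  by (rule exI[of _ "mat 1"], rule exI[of _ "mat 1"], rule exI[of _ "cmat (mat c)"])
    (simp add: cmat_def mat_def[of c])

text \<open>The three cases are those in which all eigenvalues have the same modulus and there is no Jordan block.\<close>

lemma conformal_form:
  fixes A :: "real^2^2"
  assumes "(trace A)\<^sup>2 < 4 * det A \<or> (trace A = 0 \<and> det A < 0) \<or> (\<exists>c. c \<noteq> 0 \<and> A = mat c)"
  obtains q :: "pt \<Rightarrow> real" and \<alpha> \<beta> where "\<alpha> > 0" "\<beta> > 0" "\<forall>v. q (A *v v) = \<bar>det A\<bar> * q v"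
    "\<forall>v. \<alpha> * (norm v)\<^sup>2 \<le> q v" "\<forall>v. q v \<le> \<beta> * (norm v)\<^sup>2"
proof -
  have up: "(A *v v) \<bullet> (A *v v) \<le> (norm A)\<^sup>2 * (v \<bullet> v)" for v
    using norm_matrix_vector_mult_le[of A v] power_mono[of "norm (A *v v)" "norm A * norm v" 2]
    by (simp add: power_mult_distrib power2_norm_eq_inner)
  consider "(trace A)\<^sup>2 < 4 * det A" | "trace A = 0" "det A < 0" | c where "c \<noteq> 0" "A = mat c" using assms by blast
  then show ?thesis
  proof cases
    case 1
    have d0: "det A > 0" using 1 zero_le_power2[of "trace A"] by linarith
    \<comment> \<open>For a non-real eigenvalue \<open>c\<close> of \<open>A\<close>, this is the
      squared norm of \<open>A v - c v\<close> in the complexified plane. Applying \<open>A\<close>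
      multiplies that vector by the conjugate of \<open>c\<close>, whose squared modulus is
      \<open>det A\<close>. Completing the square around \<open>trace A / 2\<close> leaves the
      positive coefficient \<delta>.\<close>
    define q where "q v = (A *v v) \<bullet> (A *v v) - trace A * ((A *v v) \<bullet> v) + det A * (v \<bullet> v)" for v
    define \<delta> where "\<delta> = det A - (trace A)\<^sup>2 / 4"
    show ?thesis
    proof (rule that[of \<delta> "(norm A)\<^sup>2 + \<bar>trace A\<bar> * norm A + det A" q])
      show "\<delta> > 0" using 1 by (simp add: \<delta>_def)
      show "0 < (norm A)\<^sup>2 + \<bar>trace A\<bar> * norm A + det A" using d0 by (simp add: add_nonneg_pos)
      show "\<forall>v. q (A *v v) = \<bar>det A\<bar> * q v"
        using d0 unfolding q_def cayley_hamilton_2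
        by (simp add: inner_diff_left inner_diff_right inner_commute algebra_simps power2_eq_square)
      show "\<forall>v. \<delta> * (norm v)\<^sup>2 \<le> q v"
      proof
        fix v
        have "0 \<le> (A *v v - (trace A / 2) *\<^sub>R v) \<bullet> (A *v v - (trace A / 2) *\<^sub>R v)" by simp
        then show "\<delta> * (norm v)\<^sup>2 \<le> q v"
          unfolding q_def \<delta>_def power2_norm_eq_inner
          by (simp add: inner_diff_left inner_diff_right inner_commute algebra_simps power2_eq_square)
      qed
      show "\<forall>v. q v \<le> ((norm A)\<^sup>2 + \<bar>trace A\<bar> * norm A + det A) * (norm v)\<^sup>2"
      proof
        fix v
        have "- (trace A * ((A *v v) \<bullet> v)) \<le> \<bar>trace A\<bar> * \<bar>(A *v v) \<bullet> v\<bar>"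
          by (metis abs_ge_minus_self abs_mult)
        also have "\<dots> \<le> \<bar>trace A\<bar> * (norm (A *v v) * norm v)"
          by (intro mult_left_mono Cauchy_Schwarz_ineq2) auto
        also have "\<dots> \<le> \<bar>trace A\<bar> * (norm A * norm v * norm v)"
          by (intro mult_left_mono mult_right_mono norm_matrix_vector_mult_le) auto
        finally show "q v \<le> ((norm A)\<^sup>2 + \<bar>trace A\<bar> * norm A + det A) * (norm v)\<^sup>2" using up[of v]
          by (simp add: q_def power2_norm_eq_inner[symmetric] algebra_simps power2_eq_square)
      qed
    qed
  next
    case 2
    \<comment> \<open>As the trace vanishes, the square of \<open>A\<close> is
      \<open>- det A\<close> times the identity, so applying \<open>A\<close> exchanges the two
      summands up to the factor \<open>- det A\<close>.\<close>
    define q where "q v = (A *v v) \<bullet> (A *v v) - det A * (v \<bullet> v)" for v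
    show ?thesis
    proof (rule that[of "- det A" "(norm A)\<^sup>2 - det A" q])
      show "0 < - det A" using 2 by simp
      show "0 < (norm A)\<^sup>2 - det A" using 2 zero_le_power2[of "norm A"] by linarith
      show "\<forall>v. q (A *v v) = \<bar>det A\<bar> * q v"
        using 2 unfolding q_def cayley_hamilton_2 by (simp add: algebra_simps)
      show "\<forall>v. - det A * (norm v)\<^sup>2 \<le> q v" by (simp add: q_def power2_norm_eq_inner)
      show "\<forall>v. q v \<le> ((norm A)\<^sup>2 - det A) * (norm v)\<^sup>2"
        using up by (simp add: q_def power2_norm_eq_inner algebra_simps)
    qed
  next
    case 3
    have "det A = c\<^sup>2" using 3 by (simp add: det_2 mat_def power2_eq_square)
    then show ?thesis
      by (intro that[of 1 1 "\<lambda>v. (norm v)\<^sup>2"]) (use 3 in \<open>auto simp: mat_mult_vector power_mult_distrib\<close>)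
  qed
qed

section \<open>Sets invariant under a linear map and a homothety\<close>

text \<open>In the application, \<open>X\<close> is a cylinder of \<open>F\<close> around the fixed point of the embedding, which is moved to the origin.\<close>

locale scaled_germ =
  fixes X :: "pt set" and \<Lambda> \<rho> \<theta> :: real and A :: "real^2^2"
  assumes compact_X: "compact X" and \<Lambda>: "0 < \<Lambda>" "\<Lambda> < 1" and \<rho>: "0 < \<rho>"
    and scale: "z \<in> X \<Longrightarrow> \<Lambda> *\<^sub>R z \<in> X"
    and unscale: "z \<in> X \<Longrightarrow> norm z < \<rho> \<Longrightarrow> (1 / \<Lambda>) *\<^sub>R z \<in> X"
    and AX: "z \<in> X \<Longrightarrow> A *v z \<in> X"
    and contracting: "0 \<le> \<theta>" "\<theta> < 1" "norm (A *v v) \<le> \<theta> * norm v"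
    and no_segment: "(\<And>t. 0 \<le> t \<Longrightarrow> t \<le> 1 \<Longrightarrow> t *\<^sub>R x \<in> X) \<Longrightarrow> x = 0"
    and spanning: "(\<And>z. z \<in> X \<Longrightarrow> K *v z = 0) \<Longrightarrow> K = (0 :: real^2^2)"
begin

abbreviation iter :: "nat \<Rightarrow> pt \<Rightarrow> pt" where "iter n \<equiv> ((*v) A) ^^ n"

lemma iter_in_X: "z \<in> X \<Longrightarrow> iter n z \<in> X"
  by (induction n) (auto intro: AX)

lemma scale_pow: "z \<in> X \<Longrightarrow> (\<Lambda> ^ k) *\<^sub>R z \<in> X"
  using scale by (induction k) (auto simp: scaleR_scaleR[symmetric] simp del: scaleR_scaleR)

text \<open>Norms grow along successive dilations, so closeness of the final point to the origin
  bounds all intermediate points as well.\<close>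

lemma unscale_pow: "z \<in> X \<Longrightarrow> norm z / \<Lambda> ^ k < \<rho> \<Longrightarrow> (1 / \<Lambda> ^ k) *\<^sub>R z \<in> X"
proof (induction k)
  case (Suc k)
  have "norm z / \<Lambda> ^ k \<le> norm z / \<Lambda> ^ Suc k"
    using \<Lambda> by (intro divide_left_mono) (auto intro: mult_left_le_one_le)
  with Suc have n: "norm z / \<Lambda> ^ k < \<rho>" by simp
  with Suc have "(1 / \<Lambda> ^ k) *\<^sub>R z \<in> X" by simp
  moreover have "norm ((1 / \<Lambda> ^ k) *\<^sub>R z) < \<rho>" using n \<Lambda> by simp
  ultimately show ?case using unscale[of "(1 / \<Lambda> ^ k) *\<^sub>R z"] by simp
qed simp

lemma rescale:
  assumes "z \<in> X" "norm (\<Lambda> powi k *\<^sub>R z) < \<rho>"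
  shows "\<Lambda> powi k *\<^sub>R z \<in> X"
proof (cases "k \<ge> 0")
  case True
  then show ?thesis using scale_pow[OF assms(1), of "nat k"] by (simp add: power_int_def)
next
  case False
  then have *: "\<Lambda> powi k = 1 / \<Lambda> ^ nat (- k)" by (simp add: power_int_def field_simps)
  show ?thesis using assms \<Lambda> unscale_pow[OF assms(1), of "nat (- k)"] by (simp add: *)
qed

text \<open>The annulus between the radii \<open>\<Lambda> * \<rho>\<close> and \<rho> is a
  fundamental domain for the homothety. The least \<open>k\<close> for which one more dilation would
  leave the open ball of radius \<rho> moves \<open>z\<close> into it.\<close>

lemma normalize:
  assumes "z \<in> X" "z \<noteq> 0" "norm z < \<rho>"
  obtains s where "s > 0" "s *\<^sub>R z \<in> X" "\<Lambda> * \<rho> \<le> norm (s *\<^sub>R z)" "norm (s *\<^sub>R z) < \<rho>"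
proof -
  have "\<exists>k. \<rho> \<le> norm z / \<Lambda> ^ Suc k"
  proof -
    obtain k where "\<Lambda> ^ k < norm z / \<rho>"
      using real_arch_pow_inv[of "norm z / \<rho>" \<Lambda>] assms \<Lambda> \<rho> by auto
    moreover have "\<Lambda> ^ Suc k \<le> \<Lambda> ^ k" using \<Lambda> by (intro power_decreasing) auto
    ultimately have "\<Lambda> ^ Suc k \<le> norm z / \<rho>" by linarith
    then show ?thesis using \<Lambda> \<rho> by (intro exI[of _ k]) (simp add: field_simps)
  qed
  then obtain k where k: "\<rho> \<le> norm z / \<Lambda> ^ Suc k" "\<And>j. j < k \<Longrightarrow> \<not> \<rho> \<le> norm z / \<Lambda> ^ Suc j"
    using exists_least_iff[of "\<lambda>k. \<rho> \<le> norm z / \<Lambda> ^ Suc k"] by blast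
  have lt: "norm z / \<Lambda> ^ k < \<rho>"
    using k(2)[of "k - 1"] assms(3) by (cases k) auto
  show ?thesis
  proof (rule that[of "1 / \<Lambda> ^ k"])
    show "(1 / \<Lambda> ^ k) *\<^sub>R z \<in> X" by (rule unscale_pow[OF assms(1) lt])
    show "\<Lambda> * \<rho> \<le> norm ((1 / \<Lambda> ^ k) *\<^sub>R z)" using k(1) \<Lambda> by (simp add: field_simps)
  qed (use \<Lambda> lt in auto)
qed

text \<open>On the iterates, \<open>K\<close> only picks up powers of \<gamma>. If the iterates are
  of larger order than these powers, then rescaling them into the annulus produces points of
  \<open>X\<close> where \<open>K\<close> is arbitrarily small. Since the part of \<open>X\<close>
  outside the ball of radius \<open>\<Lambda> * \<rho>\<close> is compact, \<open>K\<close> vanishes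
  at one of its points, which is not the origin.\<close>

lemma kernel_vector:
  fixes K :: "real^2^2"
  assumes K: "\<And>v. K *v (A *v v) = \<gamma> *\<^sub>R (K *v v)" and z: "z \<in> X"
    and nz: "\<And>n. iter n z \<noteq> 0"
    and lim: "(\<lambda>n. \<bar>\<gamma>\<bar> ^ n / norm (iter n z)) \<longlonglongrightarrow> 0"
  shows "\<exists>x\<in>X. x \<noteq> 0 \<and> K *v x = 0"
proof -
  have Kn: "K *v iter n z = \<gamma> ^ n *\<^sub>R (K *v z)" for n
    by (induction n) (auto simp: K)
  have small: "norm (iter n z) \<le> \<theta> ^ n * norm z" for n
  proof (induction n)
    case (Suc n)
    have "norm (iter (Suc n) z) \<le> \<theta> * norm (iter n z)" using contracting(3) by simp
    also have "\<dots> \<le> \<theta> * (\<theta> ^ n * norm z)" using Suc contracting by (intro mult_left_mono) auto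
    finally show ?case by simp
  qed simp
  have "(\<lambda>n. \<theta> ^ n * norm z) \<longlonglongrightarrow> 0 * norm z"
    using contracting by (intro tendsto_intros LIMSEQ_power_zero) auto
  then have "eventually (\<lambda>n. \<theta> ^ n * norm z < \<rho>) sequentially"
    using \<rho> by (auto dest: order_tendstoD(2))
  then obtain n0 where "\<And>n. n \<ge> n0 \<Longrightarrow> \<theta> ^ n * norm z < \<rho>" by (auto simp: eventually_sequentially)
  then have n0: "norm (iter n z) < \<rho>" if "n \<ge> n0" for n
    using small[of n] that by (meson order_le_less_trans)
  define Y where "Y = X \<inter> {x. \<Lambda> * \<rho> \<le> norm x}"
  have "closed {x :: pt. \<Lambda> * \<rho> \<le> norm x}" by (intro closed_Collect_le continuous_intros)
  then have cY: "compact Y" unfolding Y_def using compact_X by (rule compact_Int_closed[rotated])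
  have ex: "\<exists>x\<in>Y. norm (K *v x) \<le> \<rho> * norm (K *v z) * (\<bar>\<gamma>\<bar> ^ n / norm (iter n z))" if n: "n \<ge> n0" for n
  proof -
    obtain s where s: "s > 0" "s *\<^sub>R iter n z \<in> X" "\<Lambda> * \<rho> \<le> norm (s *\<^sub>R iter n z)" "norm (s *\<^sub>R iter n z) < \<rho>"
      using normalize[OF iter_in_X[OF z] nz n0[OF n]] by blast
    have "s \<le> \<rho> / norm (iter n z)" using s nz[of n] by (simp add: field_simps)
    then have "s * (\<bar>\<gamma>\<bar> ^ n * norm (K *v z)) \<le> \<rho> / norm (iter n z) * (\<bar>\<gamma>\<bar> ^ n * norm (K *v z))"
      by (intro mult_right_mono) auto
    moreover have "norm (K *v (s *\<^sub>R iter n z)) = s * (\<bar>\<gamma>\<bar> ^ n * norm (K *v z))"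
      using s(1) by (simp add: matrix_vector_mult_scaleR Kn power_abs abs_mult)
    ultimately show ?thesis using s by (intro bexI[of _ "s *\<^sub>R iter n z"]) (auto simp: Y_def mult_ac)
  qed
  have "continuous_on Y (\<lambda>x. norm (K *v x))"
    by (intro continuous_intros matrix_vector_mult_linear_continuous_on)
  then obtain x where x: "x \<in> Y" "\<And>y. y \<in> Y \<Longrightarrow> norm (K *v x) \<le> norm (K *v y)"
    using continuous_attains_inf[OF cY] ex[of n0] by blast
  have "(\<lambda>n. \<rho> * norm (K *v z) * (\<bar>\<gamma>\<bar> ^ n / norm (iter n z))) \<longlonglongrightarrow> \<rho> * norm (K *v z) * 0"
    by (intro tendsto_intros lim)
  moreover have "norm (K *v x) \<le> \<rho> * norm (K *v z) * (\<bar>\<gamma>\<bar> ^ n / norm (iter n z))" if "n \<ge> n0" for n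
    using ex[OF that] x(2) order_trans by blast
  ultimately have "norm (K *v x) \<le> \<rho> * norm (K *v z) * 0" using LIMSEQ_le_const by blast
  moreover have "x \<noteq> 0" using x(1) \<Lambda> \<rho> by (auto simp: Y_def mult_le_0_iff)
  ultimately show ?thesis using x(1) by (auto simp: Y_def)
qed

text \<open>As \<open>X\<close> is closed, it contains the approximated points
  \<open>t *\<^sub>R x\<close>, and also the origin, which is the limit of contracted copies of one
  of them. Together they form a segment from the origin.\<close>

lemma ray_impossible:
  assumes x: "x \<noteq> 0" and t0: "t0 > 0"
    and approx: "\<And>t. 0 < t \<Longrightarrow> t \<le> t0 \<Longrightarrow> \<exists>f. (\<forall>n. f n \<in> X) \<and> f \<longlonglongrightarrow> t *\<^sub>R x"
  shows False
proof -
  have pos: "t *\<^sub>R x \<in> X" if "0 < t" "t \<le> t0" for t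
    using approx[OF that] compact_imp_closed[OF compact_X] closed_sequentially by blast
  have "(\<lambda>n. (\<Lambda> ^ n) *\<^sub>R (t0 *\<^sub>R x)) \<longlonglongrightarrow> 0 *\<^sub>R (t0 *\<^sub>R x)"
    using \<Lambda> by (intro tendsto_intros LIMSEQ_power_zero) auto
  then have "0 \<in> X"
    using closed_sequentially[OF compact_imp_closed[OF compact_X] scale_pow[OF pos[OF t0 order_refl]]] by simp
  have "t0 *\<^sub>R x = 0"
  proof (rule no_segment)
    fix t :: real assume t: "0 \<le> t" "t \<le> 1"
    show "t *\<^sub>R (t0 *\<^sub>R x) \<in> X"
    proof (cases "t = 0")
      case False
      then show ?thesis using pos[of "t * t0"] t t0 by (simp add: mult_le_cancel_right2)
    qed (use \<open>0 \<in> X\<close> in simp)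
  qed
  then show False using x t0 by simp
qed

text \<open>Otherwise the logarithms of the two factors have an irrational ratio. The multiples of
  \<open>x\<close> reached by applying \<open>A\<close> and rescaling by powers of \<Lambda> are
  then dense in a piece of the ray through \<open>x\<close>, which \<open>ray_impossible\<close>
  excludes.\<close>

lemma eigenvalue_commensurable:
  assumes x: "x \<in> X" "x \<noteq> 0" and \<gamma>: "A *v x = \<gamma> *\<^sub>R x" "\<gamma> \<noteq> 0"
  shows "\<exists>n\<ge>1. \<exists>k. \<bar>\<gamma>\<bar> ^ n = \<Lambda> ^ k"
proof (rule ccontr)
  assume no: "\<not> ?thesis"
  have "\<bar>\<gamma>\<bar> * norm x \<le> \<theta> * norm x" using contracting(3)[of x] \<gamma> by simp
  then have \<gamma>1: "\<bar>\<gamma>\<bar> < 1" using x contracting by simp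
  \<comment> \<open>The square makes the factor positive: only even iterates are used, and they keep
    \<open>x\<close> on its own ray.\<close>
  define g where "g = \<gamma>\<^sup>2"
  have g: "0 < g" "g < 1" using \<gamma>1 \<gamma>(2) by (auto simp: g_def abs_square_less_1)
  define a where "a = ln g / ln \<Lambda>"
  have lnneg: "ln g < 0" "ln \<Lambda> < 0" using g \<Lambda> by auto
  have gp: "g powr s = \<Lambda> powr (a * s)" for s
    using g \<Lambda> lnneg by (simp add: powr_def a_def)
  have "a \<notin> \<rat>"
  proof
    assume "a \<in> \<rat>"
    then obtain m n :: nat where mn: "n \<noteq> 0" "\<bar>a\<bar> = real m / real n" by (rule Rats_abs_nat_div_natE)
    have "a > 0" using lnneg by (simp add: a_def divide_neg_neg)
    with mn have "a * real n = real m" by simp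
    then have "g ^ n = \<Lambda> ^ m" using gp[of n] g \<Lambda> by (simp add: powr_realpow)
    then have "\<bar>\<gamma>\<bar> ^ (2 * n) = \<Lambda> ^ m" by (simp add: g_def power_mult)
    moreover have "2 * n \<ge> 1" using mn by simp
    ultimately show False using no by blast
  qed
  have iter_x: "iter n x = \<gamma> ^ n *\<^sub>R x" for n
    by (induction n) (auto simp: \<gamma> matrix_vector_mult_scaleR)
  show False
  \<comment> \<open>This bound on \<open>t\<close> keeps the target within half the radius \<rho>,
    so that late approximants satisfy the hypothesis of \<open>rescale\<close>.\<close>
  proof (rule ray_impossible[OF x(2), of "\<rho> / (2 * norm x)"])
    fix t assume t: "0 < t" "t \<le> \<rho> / (2 * norm x)"
    define \<alpha> where "\<alpha> = ln t / ln \<Lambda>"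
    have ta: "\<Lambda> powr \<alpha> = t" using t \<Lambda> lnneg by (simp add: powr_def \<alpha>_def)
    \<comment> \<open>Inhomogeneous approximation by an irrational rotation. The positivity of
      \<open>k\<close> is what allows it to serve as a number of iterations.\<close>
    have "\<exists>h k. k > 0 \<and> \<bar>of_int k * a - of_int h - \<alpha>\<bar> < 1 / real (Suc n)" for n
      using sequence_of_fractional_parts_is_dense[OF \<open>a \<notin> \<rat>\<close>, of "1 / real (Suc n)" \<alpha>] by fastforce
    then obtain h k where hk: "\<And>n. k n > 0" "\<And>n. \<bar>of_int (k n) * a - of_int (h n) - \<alpha>\<bar> < 1 / real (Suc n)"
      by metis
    define e where "e n = of_int (k n) * a - of_int (h n)" for n
    have "(\<lambda>n. e n - \<alpha>) \<longlonglongrightarrow> 0"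
      by (rule LIMSEQ_norm_0) (use hk(2) in \<open>auto simp: e_def\<close>)
    then have "e \<longlonglongrightarrow> \<alpha>" by (rule LIM_zero_cancel)
    then have "(\<lambda>n. \<Lambda> powr e n) \<longlonglongrightarrow> \<Lambda> powr \<alpha>" using \<Lambda> by (intro tendsto_intros) auto
    then have lim: "(\<lambda>n. \<Lambda> powr e n) \<longlonglongrightarrow> t" by (simp add: ta)
    have "t * norm x < \<rho>" using t x \<rho> by (simp add: field_simps)
    moreover have lim': "(\<lambda>n. \<Lambda> powr e n * norm x) \<longlonglongrightarrow> t * norm x" by (intro tendsto_intros lim)
    ultimately have "eventually (\<lambda>n. \<Lambda> powr e n * norm x < \<rho>) sequentially"
      using order_tendstoD(2) by blast
    then obtain n0 where n0: "\<And>n. n \<ge> n0 \<Longrightarrow> \<Lambda> powr e n * norm x < \<rho>" by (auto simp: eventually_sequentially)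
    have inX: "(\<Lambda> powr e n) *\<^sub>R x \<in> X" if n: "n \<ge> n0" for n
    proof -
      have "\<gamma> ^ (2 * nat (k n)) = g powr of_int (k n)"
        using hk(1)[of n] g by (simp add: power_mult g_def powr_realpow[symmetric])
      moreover have "\<Lambda> powi (- h n) = \<Lambda> powr (- of_int (h n))"
        using \<Lambda> powr_real_of_int'[of \<Lambda> "- h n"] by simp
      ultimately have eq: "\<Lambda> powi (- h n) *\<^sub>R iter (2 * nat (k n)) x = (\<Lambda> powr e n) *\<^sub>R x"
        by (simp add: iter_x gp e_def powr_add[symmetric] mult.commute)
      show ?thesis
        using rescale[OF iter_in_X[OF x(1), of "2 * nat (k n)"], of "- h n"] n0[OF n] unfolding eq by simp
    qed
    show "\<exists>f. (\<forall>n. f n \<in> X) \<and> f \<longlonglongrightarrow> t *\<^sub>R x"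
    proof (intro exI conjI allI)
      show "(\<Lambda> powr e (n + n0)) *\<^sub>R x \<in> X" for n by (rule inX) simp
      show "(\<lambda>n. (\<Lambda> powr e (n + n0)) *\<^sub>R x) \<longlonglongrightarrow> t *\<^sub>R x"
        by (intro tendsto_intros LIMSEQ_ignore_initial_segment lim)
    qed
  qed (use \<rho> x in auto)
qed

text \<open>This is the binomial expansion of a power of \<open>\<gamma> + K\<close>, which stops
  after the linear term because \<open>K\<close> squares to zero.\<close>

lemma iter_jordan:
  assumes K: "\<And>v. K *v v = A *v v - \<gamma> *\<^sub>R v" "\<And>v. K *v (K *v v) = 0" and \<gamma>: "\<gamma> \<noteq> 0"
  shows "iter n z = \<gamma> ^ n *\<^sub>R (z + (real n / \<gamma>) *\<^sub>R (K *v z))"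
proof (induction n)
  case (Suc n)
  have A: "A *v v = \<gamma> *\<^sub>R v + K *v v" for v by (simp add: K)
  have "iter (Suc n) z = \<gamma> ^ n *\<^sub>R (A *v (z + (real n / \<gamma>) *\<^sub>R (K *v z)))"
    using Suc by (simp add: matrix_vector_mult_scaleR)
  also have "A *v (z + (real n / \<gamma>) *\<^sub>R (K *v z)) = \<gamma> *\<^sub>R z + K *v z + real n *\<^sub>R (K *v z)"
    using \<gamma> by (simp add: matrix_vector_right_distrib matrix_vector_mult_scaleR A K(2))
  also have "\<dots> = \<gamma> *\<^sub>R (z + (real (Suc n) / \<gamma>) *\<^sub>R (K *v z))"
    using \<gamma> by (simp add: scaleR_add_right scaleR_add_left)
  finally show ?case by (simp add: mult.commute)
qed simp

text \<open>After \<open>n1 * j\<close> iterations the scalar factor is a power of \<Lambda> and can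
  be undone, leaving the linear drift \<open>z + j c\<close>. Contracting by
  \<open>\<Lambda> ^ i\<close>, with \<open>j\<close> close to \<open>t / \<Lambda> ^ i\<close>,
  makes the term in \<open>z\<close> disappear and leaves \<open>t c\<close> in the limit, so
  \<open>X\<close> would contain a segment.\<close>

lemma no_jordan_block:
  assumes K: "\<And>v. K *v v = A *v v - \<gamma> *\<^sub>R v" "\<And>v. K *v (K *v v) = 0" and \<gamma>: "\<gamma> \<noteq> 0"
    and z: "z \<in> X" "K *v z \<noteq> 0" and com: "n0 \<ge> 1" "\<bar>\<gamma>\<bar> ^ n0 = \<Lambda> ^ k0"
  shows False
proof -
  \<comment> \<open>Doubling the exponents replaces the modulus of \<gamma> by \<gamma>
    itself.\<close>
  define n1 k1 where "n1 = 2 * n0" "k1 = 2 * k0"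
  have n1: "n1 \<ge> 1" "\<gamma> ^ n1 = \<Lambda> ^ k1"
  proof -
    have "(\<bar>\<gamma>\<bar> ^ n0)\<^sup>2 = (\<Lambda> ^ k0)\<^sup>2" using com by simp
    then have "\<gamma> ^ n1 = \<Lambda> ^ k1" by (simp add: n1_k1_def power_mult[symmetric] mult.commute power_even_abs)
    then show "n1 \<ge> 1" "\<gamma> ^ n1 = \<Lambda> ^ k1" using com by (auto simp: n1_k1_def)
  qed
  define c where "c = (real n1 / \<gamma>) *\<^sub>R (K *v z)"
  have c0: "c \<noteq> 0" using n1 \<gamma> z by (simp add: c_def)
  show False
  proof (rule ray_impossible[OF c0, of "\<rho> / (2 * norm c)"])
    fix t assume t: "0 < t" "t \<le> \<rho> / (2 * norm c)"
    define j where "j i = nat \<lfloor>t / \<Lambda> ^ i\<rfloor>" for i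
    define f where "f i = (\<Lambda> ^ i) *\<^sub>R z + (real (j i) * \<Lambda> ^ i) *\<^sub>R c" for i
    have L0: "(\<lambda>i. \<Lambda> ^ i) \<longlonglongrightarrow> 0" using \<Lambda> by (intro LIMSEQ_power_zero) auto
    have jt: "(\<lambda>i. real (j i) * \<Lambda> ^ i) \<longlonglongrightarrow> t"
    proof (rule tendsto_sandwich)
      have b: "t / \<Lambda> ^ i - 1 \<le> real (j i)" "real (j i) \<le> t / \<Lambda> ^ i" for i
      proof -
        have "0 \<le> t / \<Lambda> ^ i" using t \<Lambda> by simp
        then show "t / \<Lambda> ^ i - 1 \<le> real (j i)" "real (j i) \<le> t / \<Lambda> ^ i"
          by (simp_all add: j_def of_nat_nat)
      qed
      have "t - \<Lambda> ^ i \<le> real (j i) * \<Lambda> ^ i \<and> real (j i) * \<Lambda> ^ i \<le> t" for i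
        using b[of i] \<Lambda> zero_less_power[of \<Lambda> i] by (simp add: field_simps)
      then show "eventually (\<lambda>i. t - \<Lambda> ^ i \<le> real (j i) * \<Lambda> ^ i) sequentially"
        "eventually (\<lambda>i. real (j i) * \<Lambda> ^ i \<le> t) sequentially" by auto
      show "(\<lambda>i. t - \<Lambda> ^ i) \<longlonglongrightarrow> t" using tendsto_diff[OF tendsto_const[of t] L0] by simp
    qed simp
    have lim: "f \<longlonglongrightarrow> t *\<^sub>R c"
      unfolding f_def using tendsto_add[OF tendsto_scaleR[OF L0 tendsto_const[of z]] tendsto_scaleR[OF jt tendsto_const[of c]]] by simp
    have "norm (t *\<^sub>R c) < \<rho>" using t c0 \<rho> by (simp add: field_simps)
    then have "eventually (\<lambda>i. norm (f i) < \<rho>) sequentially"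
      using order_tendstoD(2)[OF tendsto_norm[OF lim]] by blast
    then obtain i0 where i0: "\<And>i. i \<ge> i0 \<Longrightarrow> norm (f i) < \<rho>" by (auto simp: eventually_sequentially)
    have inX: "f i \<in> X" if "i \<ge> i0" for i
    proof -
      have g: "\<gamma> ^ (n1 * j i) = \<Lambda> powi (int (k1 * j i))"
        by (simp add: power_mult n1(2) power_int_def nat_mult_distrib)
      have "iter (n1 * j i) z = \<gamma> ^ (n1 * j i) *\<^sub>R (z + real (j i) *\<^sub>R c)"
        using iter_jordan[OF K \<gamma>, of "n1 * j i" z] by (simp add: c_def mult.commute)
      moreover have "\<Lambda> powi (int i - int (k1 * j i)) * \<Lambda> powi (int (k1 * j i)) = \<Lambda> ^ i"
        using \<Lambda> by (subst power_int_add[symmetric]) auto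
      ultimately have eq: "\<Lambda> powi (int i - int (k1 * j i)) *\<^sub>R iter (n1 * j i) z = f i"
        by (simp only: g scaleR_scaleR f_def) (simp add: scaleR_add_right mult.commute)
      show ?thesis
        using rescale[OF iter_in_X[OF z(1), of "n1 * j i"], of "int i - int (k1 * j i)"] i0[OF that] unfolding eq by simp
    qed
    show "\<exists>f. (\<forall>n. f n \<in> X) \<and> f \<longlonglongrightarrow> t *\<^sub>R c"
      using inX LIMSEQ_ignore_initial_segment[OF lim, of i0] by (intro exI[of _ "\<lambda>i. f (i + i0)"]) auto
  qed (use \<rho> c0 in auto)
qed

text \<open>The hypothesis \<open>roots\<close> gives an annihilating polynomial of \<open>A\<close>
  with roots \<gamma> and \<gamma>'. A point \<open>z\<close> of \<open>X\<close> not killed by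
  \<open>A - \<gamma>'\<close> has iterates of larger order than the powers of \<gamma>':
  exponentially so if \<gamma> dominates, and by a factor \<open>n\<close> for a double root. Hence
  \<open>kernel_vector\<close> finds an eigenvector for \<gamma> in \<open>X\<close>, and
  \<open>eigenvalue_commensurable\<close> applies. A double root is then excluded by
  \<open>no_jordan_block\<close>.\<close>

lemma dominant_eigenvalue:
  assumes roots: "\<And>v. A *v (A *v v) = (\<gamma> + \<gamma>') *\<^sub>R (A *v v) - (\<gamma> * \<gamma>') *\<^sub>R v"
    and nz: "\<gamma> \<noteq> 0" and ns: "A \<noteq> mat \<gamma>'" and dom: "\<bar>\<gamma>'\<bar> < \<bar>\<gamma>\<bar> \<or> \<gamma>' = \<gamma>"
  shows "\<gamma>' \<noteq> \<gamma> \<and> (\<exists>n\<ge>1. \<exists>k. \<bar>\<gamma>\<bar> ^ n = \<Lambda> ^ k)"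
proof -
  define K where "K = A - mat \<gamma>"
  define K' where "K' = A - mat \<gamma>'"
  have mat_v: "mat a *v v = a *\<^sub>R v" for a and v :: pt
    by (simp add: vec_eq_iff matrix_vector_mult_def mat_def sum_2 forall_2)
  have K: "K *v v = A *v v - \<gamma> *\<^sub>R v" and K': "K' *v v = A *v v - \<gamma>' *\<^sub>R v" for v
    by (simp_all add: K_def K'_def matrix_vector_mult_diff_rdistrib mat_v)
  have KA: "K *v (A *v v) = \<gamma>' *\<^sub>R (K *v v)" and K'A: "K' *v (A *v v) = \<gamma> *\<^sub>R (K' *v v)" for v
    by (simp_all add: K K' roots algebra_simps)
  obtain z where z: "z \<in> X" "K' *v z \<noteq> 0"
    using spanning[of K'] ns by (auto simp: K'_def)
  have K'n: "K' *v iter n z = \<gamma> ^ n *\<^sub>R (K' *v z)" for n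
    by (induction n) (auto simp: K'A)
  have inz: "iter n z \<noteq> 0" for n using K'n[of n] z nz by auto
  have "(\<lambda>n. \<bar>\<gamma>'\<bar> ^ n / norm (iter n z)) \<longlonglongrightarrow> 0"
  proof (cases "\<gamma>' = \<gamma>")
    case False
    with dom have lt: "\<bar>\<gamma>'\<bar> < \<bar>\<gamma>\<bar>" by simp
    have T: "(\<lambda>n. norm K' / norm (K' *v z) * (\<bar>\<gamma>'\<bar> / \<bar>\<gamma>\<bar>) ^ n) \<longlonglongrightarrow> norm K' / norm (K' *v z) * 0"
      using lt by (intro tendsto_intros LIMSEQ_power_zero) auto
    have "\<bar>\<gamma>'\<bar> ^ n / norm (iter n z) \<le> norm K' / norm (K' *v z) * (\<bar>\<gamma>'\<bar> / \<bar>\<gamma>\<bar>) ^ n" for n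
    proof -
      have "\<bar>\<gamma>\<bar> ^ n * norm (K' *v z) \<le> norm K' * norm (iter n z)"
        using norm_matrix_vector_mult_le[of K' "iter n z"] by (simp add: K'n power_abs)
      then have "\<bar>\<gamma>'\<bar> ^ n * (\<bar>\<gamma>\<bar> ^ n * norm (K' *v z)) \<le> \<bar>\<gamma>'\<bar> ^ n * (norm K' * norm (iter n z))"
        by (intro mult_left_mono) auto
      moreover have "0 < \<bar>\<gamma>\<bar> ^ n" "0 < norm (K' *v z)" "0 < norm (iter n z)" using nz z inz[of n] by auto
      ultimately show ?thesis by (simp add: field_simps power_divide)
    qed
    then show ?thesis
      by (intro tendsto_sandwich[OF _ _ tendsto_const T[unfolded mult_zero_right]] always_eventually allI) simp_all
  next
    case True
    then have KK: "K *v (K *v v) = 0" for v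
      by (simp add: K roots matrix_vector_mult_diff_distrib matrix_vector_mult_scaleR vec_eq_iff algebra_simps)
    have Kz: "K *v z \<noteq> 0" using z(2) True by (simp add: K K')
    \<comment> \<open>The slope of the linear factor in \<open>iter_jordan\<close>; it bounds the
      iterates from below by
      \<open>\<bar>\<gamma>\<bar> ^ n * (real n * b - norm z)\<close>.\<close>
    define b where "b = norm (K *v z) / \<bar>\<gamma>\<bar>"
    have b: "b > 0" using Kz nz by (simp add: b_def)
    have lower: "\<bar>\<gamma>\<bar> ^ n * (real n * b - norm z) \<le> norm (iter n z)" for n
    proof -
      have "real n * b - norm z \<le> norm (z + (real n / \<gamma>) *\<^sub>R (K *v z))"
        using norm_diff_ineq[of "(real n / \<gamma>) *\<^sub>R (K *v z)" z] by (simp add: b_def add.commute)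
      then show ?thesis unfolding iter_jordan[OF K KK nz]
        by (simp add: power_abs mult_left_mono)
    qed
    have "filterlim (\<lambda>n. real n * b - norm z) at_top sequentially"
      using b by real_asymp
    then have T: "(\<lambda>n. inverse (real n * b - norm z)) \<longlonglongrightarrow> 0"
      by (rule tendsto_inverse_0_at_top)
    have "eventually (\<lambda>n. \<bar>\<gamma>'\<bar> ^ n / norm (iter n z) \<le> inverse (real n * b - norm z)) sequentially"
    proof -
      have "eventually (\<lambda>n. real n * b - norm z > 0) sequentially" using b by real_asymp
      then show ?thesis
      proof eventually_elim
        case (elim n)
        have "0 < norm (iter n z)" using inz by simp
        then show ?case using lower[of n] elim True by (simp add: field_simps)
      qed
    qed
    then show ?thesis
      by (rule tendsto_sandwich[OF _ _ tendsto_const T, rotated]) simp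
  qed
  then obtain x where x: "x \<in> X" "x \<noteq> 0" "K *v x = 0"
    using kernel_vector[OF KA z(1) inz] by blast
  then have "A *v x = \<gamma> *\<^sub>R x" by (simp add: K)
  then obtain n k where nk: "n \<ge> 1" "\<bar>\<gamma>\<bar> ^ n = \<Lambda> ^ k"
    using eigenvalue_commensurable[OF x(1,2) _ nz] by blast
  have "\<gamma>' \<noteq> \<gamma>"
  proof
    assume eq: "\<gamma>' = \<gamma>"
    then have KK: "K *v (K *v v) = 0" for v
      by (simp add: K roots matrix_vector_mult_diff_distrib matrix_vector_mult_scaleR vec_eq_iff algebra_simps)
    show False using no_jordan_block[OF K KK nz z(1) _ nk] z(2) eq by (simp add: K K')
  qed
  then show ?thesis using nk by blast
qed

end

section \<open>Cylinders of a self-similar set\<close>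

lemma sum_list_split_hd:
  assumes "\<And>J. J \<in> set W \<Longrightarrow> hd J \<in> {1..l::nat}"
  shows "(\<Sum>J\<leftarrow>W. h J) = (\<Sum>i\<in>{1..l}. \<Sum>J\<leftarrow>filter (\<lambda>J. hd J = i) W. h J :: real)"
  using assms
proof (induction W)
  case (Cons J W)
  have "(\<Sum>i\<in>{1..l}. \<Sum>J\<leftarrow>filter (\<lambda>J. hd J = i) (J # W). h J)
      = (\<Sum>i\<in>{1..l}. (if hd J = i then h J else 0) + (\<Sum>J\<leftarrow>filter (\<lambda>J. hd J = i) W. h J))"
    by (intro sum.cong) auto
  also have "\<dots> = h J + (\<Sum>J\<leftarrow>W. h J)"
    using Cons by (simp add: sum.distrib)
  finally show ?case by simp
qed simp

lemma sum_list_concat_map: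
  "(\<Sum>x\<leftarrow>concat (map g xs). f x) = (\<Sum>y\<leftarrow>xs. \<Sum>x\<leftarrow>g y. f x)"
  by (induction xs) auto

lemma sum_list_filter_neq_le:
  assumes "x \<in> set xs" "\<And>y. y \<in> set xs \<Longrightarrow> 0 \<le> f y"
  shows "(\<Sum>y\<leftarrow>filter (\<lambda>y. y \<noteq> x) xs. f y) \<le> (\<Sum>y\<leftarrow>xs. f y) - (f x :: real)"
  using assms
proof (induction xs)
  case (Cons a xs)
  have "(\<Sum>y\<leftarrow>filter (\<lambda>y. y \<noteq> x) xs. f y) \<le> (\<Sum>y\<leftarrow>xs. f y)"
  proof -
    have "0 \<le> (if y = x then f y else 0)" if "y \<in> set xs" for y using Cons.prems that by auto
    then show ?thesis unfolding sum_list_map_filter' using Cons.prems by (intro sum_list_mono) auto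
  qed
  then show ?case using Cons by (cases "x \<in> set xs") auto
qed simp

section \<open>Words, composed maps and cylinders\<close>

locale ssc_ifs =
  fixes l :: nat and r :: "nat \<Rightarrow> real" and Q :: "nat \<Rightarrow> real^2^2" and \<tau> :: "nat \<Rightarrow> pt"
    and F :: "pt set"
  assumes l2: "l \<ge> 2"
    and contr: "\<forall>i\<in>{1..l}. r i \<noteq> 0 \<and> \<bar>r i\<bar> < 1 \<and> orthogonal_matrix (Q i)"
    and compact_F: "compact F" and F_nonempty: "F \<noteq> {}"
    and F_eq: "F = (\<Union>i\<in>{1..l}. ifs_map r Q \<tau> i ` F)"
    and SSC: "\<forall>i\<in>{1..l}. \<forall>j\<in>{1..l}. i \<noteq> j \<longrightarrow> ifs_map r Q \<tau> i ` F \<inter> ifs_map r Q \<tau> j ` F = {}"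
    and not_line: "\<not> collinear F"
begin

abbreviation \<phi> :: "nat list \<Rightarrow> pt \<Rightarrow> pt" where
  "\<phi> J \<equiv> word_map (ifs_map r Q \<tau>) J"

definition words :: "nat list set" where
  "words = lists {1..l}"

lemma words_simps [simp]: "[] \<in> words" "i # J \<in> words \<longleftrightarrow> i \<in> {1..l} \<and> J \<in> words"
  "I @ J \<in> words \<longleftrightarrow> I \<in> words \<and> J \<in> words"
  by (auto simp: words_def)

definition cyl :: "nat list \<Rightarrow> pt set" where
  "cyl J = \<phi> J ` F"

definition ratio :: "nat list \<Rightarrow> real" where
  "ratio J = (\<Prod>i\<leftarrow>J. \<bar>r i\<bar>)"

definition lin :: "nat list \<Rightarrow> real^2^2" where
  "lin J = foldr (\<lambda>i M. (r i *\<^sub>R Q i) ** M) J (mat 1)"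

lemma phi_Nil [simp]: "\<phi> [] = id"
  and phi_Cons: "\<phi> (i # J) = ifs_map r Q \<tau> i \<circ> \<phi> J"
  by (simp_all add: word_map_def)

lemma phi_append: "\<phi> (I @ J) = \<phi> I \<circ> \<phi> J"
  by (induction I) (auto simp: phi_Cons)

lemma lin_Nil [simp]: "lin [] = mat 1"
  and lin_Cons: "lin (i # J) = (r i *\<^sub>R Q i) ** lin J"
  by (simp_all add: lin_def)

lemma lin_append: "lin (I @ J) = lin I ** lin J"
  by (induction I) (auto simp: lin_Cons matrix_mul_assoc)

lemma ratio_Nil [simp]: "ratio [] = 1"
  and ratio_Cons: "ratio (i # J) = \<bar>r i\<bar> * ratio J"
  by (simp_all add: ratio_def)

lemma ratio_append: "ratio (I @ J) = ratio I * ratio J"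
  by (simp add: ratio_def)

lemma cyl_Nil [simp]: "cyl [] = F"
  by (simp add: cyl_def)

lemma cyl_append: "cyl (I @ J) = \<phi> I ` cyl J"
  by (simp add: cyl_def phi_append image_comp)

lemma phi_eq: "\<phi> J z = lin J *v z + \<phi> J 0"
proof (induction J arbitrary: z)
  case (Cons i J)
  have "ifs_map r Q \<tau> i (\<phi> J z) = ifs_map r Q \<tau> i (lin J *v z + \<phi> J 0)"
    by (simp only: Cons.IH[of z])
  then have "\<phi> (i # J) z = r i *\<^sub>R (Q i *v (lin J *v z + \<phi> J 0)) + \<tau> i"
    unfolding phi_Cons o_apply by (simp only: ifs_map_def[of r Q \<tau> i])
  also have "\<dots> = lin (i # J) *v z + \<phi> (i # J) 0"
    by (simp add: phi_Cons lin_Cons ifs_map_def matrix_vector_mul_assoc[symmetric]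
        scaleR_matrix_vector_assoc[symmetric] matrix_vector_right_distrib scaleR_add_right)
  finally show ?case .
qed simp

lemma phi_aff: "\<phi> J = aff (lin J, \<phi> J 0)"
  unfolding aff_def fst_conv snd_conv by (rule ext) (rule phi_eq)

lemma ratio_pos: "J \<in> words \<Longrightarrow> 0 < ratio J"
  by (induction J) (use contr in \<open>auto simp: ratio_Cons\<close>)

lemma norm_lin: "J \<in> words \<Longrightarrow> norm (lin J *v v) = ratio J * norm v"
proof (induction J arbitrary: v)
  case (Cons i J)
  then show ?case
    using contr by (simp add: ratio_Cons lin_Cons matrix_vector_mul_assoc[symmetric]
        scaleR_matrix_vector_assoc[symmetric])
qed simp

lemma dist_phi: "J \<in> words \<Longrightarrow> dist (\<phi> J x) (\<phi> J y) = ratio J * dist x y"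
  using norm_lin[of J "x - y"] aff_diff[of "(lin J, \<phi> J 0)" x y] phi_aff[of J]
  by (simp add: dist_norm)

lemma lin_inverse: "J \<in> words \<Longrightarrow> \<exists>M. M ** lin J = mat 1"
proof -
  assume J: "J \<in> words"
  have "inj ((*v) (lin J))"
  proof (rule injI)
    fix x y assume "lin J *v x = lin J *v y"
    then have "norm (lin J *v (x - y)) = 0" by (simp add: algebra_simps)
    then show "x = y" using norm_lin[OF J] ratio_pos[OF J] by simp
  qed
  then show ?thesis
    using matrix_left_invertible_injective by blast
qed

definition phinv :: "nat list \<Rightarrow> pt \<Rightarrow> pt" where
  "phinv J = inv (\<phi> J)"

lemma phinv_aff: "J \<in> words \<Longrightarrow> \<exists>u. phinv J = aff u \<and> fst u ** lin J = mat 1"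
  and phinv_phi [simp]: "J \<in> words \<Longrightarrow> phinv J (\<phi> J x) = x"
  and phi_phinv [simp]: "J \<in> words \<Longrightarrow> \<phi> J (phinv J x) = x"
proof -
  assume J: "J \<in> words"
  obtain M where M: "M ** lin J = mat 1" using lin_inverse[OF J] by blast
  then obtain u where u: "fst u = M" "aff u \<circ> \<phi> J = id" "\<phi> J \<circ> aff u = id"
    using aff_inverse[of M "(lin J, \<phi> J 0)"] unfolding phi_aff[symmetric] by auto
  have 1: "phinv J = aff u"
    unfolding phinv_def using inv_unique_comp[OF u(3,2)] .
  show "\<exists>u. phinv J = aff u \<and> fst u ** lin J = mat 1"
    using 1 u M by (intro exI[of _ u]) simp
  show "phinv J (\<phi> J x) = x" "\<phi> J (phinv J x) = x"
    using 1 u by (auto simp: fun_eq_iff)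
qed

lemma dist_phinv: "J \<in> words \<Longrightarrow> dist (phinv J x) (phinv J y) = dist x y / ratio J"
  using dist_phi[of J "phinv J x" "phinv J y"] ratio_pos[of J] by (simp add: field_simps)

lemma ifs_in_F: "i \<in> {1..l} \<Longrightarrow> x \<in> F \<Longrightarrow> ifs_map r Q \<tau> i x \<in> F"
  using F_eq by blast

lemma phi_in_F: "J \<in> words \<Longrightarrow> x \<in> F \<Longrightarrow> \<phi> J x \<in> F"
  by (induction J) (auto simp: phi_Cons intro!: ifs_in_F)

lemma cyl_subset_F: "J \<in> words \<Longrightarrow> cyl J \<subseteq> F"
  by (auto simp: cyl_def phi_in_F)

lemma cyl_append_subset: "I \<in> words \<Longrightarrow> J \<in> words \<Longrightarrow> cyl (I @ J) \<subseteq> cyl I"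
  using cyl_subset_F[of J] by (auto simp: cyl_append) (auto simp: cyl_def)

lemma cyl_split: "J \<in> words \<Longrightarrow> x \<in> cyl J \<Longrightarrow> \<exists>i\<in>{1..l}. x \<in> cyl (J @ [i])"
proof -
  assume "x \<in> cyl J"
  then obtain z where z: "z \<in> F" "x = \<phi> J z" by (auto simp: cyl_def)
  then obtain i y where "i \<in> {1..l}" "y \<in> F" "z = ifs_map r Q \<tau> i y" using F_eq by blast
  then show ?thesis using z by (intro bexI[of _ i]) (auto simp: cyl_def phi_append phi_Cons image_iff)
qed

lemma cyl_exists: "J \<in> words \<Longrightarrow> x \<in> cyl J \<Longrightarrow> \<exists>K\<in>words. length K = n \<and> x \<in> cyl (J @ K)"
proof (induction n)
  case (Suc n)
  then obtain K where K: "K \<in> words" "length K = n" "x \<in> cyl (J @ K)" by auto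
  then obtain i where "i \<in> {1..l}" "x \<in> cyl ((J @ K) @ [i])"
    using cyl_split[of "J @ K" x] Suc by auto
  then show ?case using K by (intro bexI[of _ "K @ [i]"]) auto
qed simp

lemma phi_in_cyl_iff: "J \<in> words \<Longrightarrow> \<phi> J x \<in> cyl J \<longleftrightarrow> x \<in> F"
proof -
  assume J: "J \<in> words"
  have "x \<in> F" if "\<phi> J x = \<phi> J y" "y \<in> F" for y
    using arg_cong[OF that(1), of "phinv J"] that(2) J by (simp only: phinv_phi)
  then show ?thesis unfolding cyl_def by blast
qed

lemma compact_cyl: "compact (cyl J)"
proof -
  have "continuous_on F (aff (lin J, \<phi> J 0))"
    unfolding aff_def
    by (intro continuous_intros matrix_vector_mult_linear_continuous_on)
  then show ?thesis
    unfolding cyl_def by (intro compact_continuous_image compact_F) (simp only: phi_aff[symmetric])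
qed

definition rmax :: real where "rmax = Max ((\<lambda>i. \<bar>r i\<bar>) ` {1..l})"

lemma rmax: "0 < rmax" "rmax < 1" "i \<in> {1..l} \<Longrightarrow> \<bar>r i\<bar> \<le> rmax"
proof -
  have ne: "(\<lambda>i. \<bar>r i\<bar>) ` {1..l} \<noteq> {}" using l2 by auto
  show "0 < rmax" unfolding rmax_def using contr ne by (subst Max_gr_iff) (use l2 in \<open>auto intro!: bexI[of _ 1]\<close>)
  show "rmax < 1" unfolding rmax_def using contr ne by (subst Max_less_iff) auto
  show "i \<in> {1..l} \<Longrightarrow> \<bar>r i\<bar> \<le> rmax" unfolding rmax_def by (intro Max_ge) auto
qed

lemma ratio_le: "J \<in> words \<Longrightarrow> ratio J \<le> rmax ^ length J"
  by (induction J) (use rmax ratio_pos in \<open>auto simp: ratio_Cons intro!: mult_mono less_imp_le[OF ratio_pos]\<close>)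

lemma ratio_le_1: "J \<in> words \<Longrightarrow> ratio J \<le> 1"
  using ratio_le[of J] power_le_one[of rmax "length J"] rmax by linarith

text \<open>The added one makes the constant positive and the distance bounds strict.\<close>

definition diam :: real where "diam = 1 + diameter F"

lemma diam: "0 < diam" "x \<in> F \<Longrightarrow> y \<in> F \<Longrightarrow> dist x y < diam"
  using diameter_bounded_bound[OF compact_imp_bounded[OF compact_F], of x y]
    diameter_ge_0[OF compact_imp_bounded[OF compact_F]] by (auto simp: diam_def)

lemma dist_cyl_less: "J \<in> words \<Longrightarrow> x \<in> cyl J \<Longrightarrow> y \<in> cyl J \<Longrightarrow> dist x y < ratio J * diam"
  unfolding cyl_def using diam ratio_pos[of J] by (auto simp: dist_phi intro!: mult_strict_left_mono)

lemma small_ratio: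
  assumes "e > 0" shows "\<exists>N. \<forall>n\<ge>N. \<forall>J\<in>words. length J = n \<longrightarrow> ratio J * diam < e"
proof -
  have "(\<lambda>n. rmax ^ n * diam) \<longlonglongrightarrow> 0 * diam"
    by (intro tendsto_intros LIMSEQ_power_zero) (use rmax in auto)
  then have "eventually (\<lambda>n. rmax ^ n * diam < e) sequentially"
    using assms by (auto dest: order_tendstoD(2))
  then obtain N where N: "\<And>n. n \<ge> N \<Longrightarrow> rmax ^ n * diam < e" by (auto simp: eventually_sequentially)
  have "ratio J * diam < e" if "n \<ge> N" "J \<in> words" "length J = n" for n J
    using N[OF that(1)] mult_right_mono[OF ratio_le[OF that(2)] less_imp_le[OF diam(1)]] that(3) by simp
  then show ?thesis by blast
qed

lemma small_cyl:
  assumes "x \<in> F" "e > 0"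
  obtains J where "J \<in> words" "x \<in> cyl J" "ratio J * diam < e"
proof -
  obtain N where N: "\<forall>n\<ge>N. \<forall>J\<in>words. length J = n \<longrightarrow> ratio J * diam < e"
    using small_ratio[OF assms(2)] by blast
  then show ?thesis using cyl_exists[of "[]" x N] assms that by auto
qed

section \<open>Separation of cylinders at all scales\<close>

text \<open>Disjoint compact sets have positive distance, and only finitely many pairs of
  first-level cylinders occur.\<close>

lemma gap_exists: "\<exists>d>0. \<forall>i\<in>{1..l}. \<forall>j\<in>{1..l}. i \<noteq> j \<longrightarrow> (\<forall>x\<in>cyl [i]. \<forall>y\<in>cyl [j]. d \<le> dist x y)"
proof -
  have "\<exists>d>0. i \<noteq> j \<longrightarrow> (\<forall>x\<in>cyl [i]. \<forall>y\<in>cyl [j]. d \<le> dist x y)" if "i \<in> {1..l}" "j \<in> {1..l}" for i j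
  proof (cases "i = j")
    case False
    have "cyl [i] \<inter> cyl [j] = {}"
      using SSC False that unfolding cyl_def phi_Cons phi_Nil by auto
    then show ?thesis
      using separate_compact_closed[OF compact_cyl compact_imp_closed[OF compact_cyl], of "[i]" "[j]"] by auto
  qed (auto intro: exI[of _ 1])
  then obtain d where d: "\<And>i j. i \<in> {1..l} \<Longrightarrow> j \<in> {1..l} \<Longrightarrow> d i j > 0 \<and>
      (i \<noteq> j \<longrightarrow> (\<forall>x\<in>cyl [i]. \<forall>y\<in>cyl [j]. d i j \<le> dist x y))" by metis
  define S where "S = (\<lambda>(i,j). d i j) ` ({1..l} \<times> {1..l})"
  have S: "finite S" "S \<noteq> {}" using l2 by (auto simp: S_def)
  have "0 < Min S" using S d by (subst Min_gr_iff) (auto simp: S_def)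
  moreover have "Min S \<le> d i j" if "i \<in> {1..l}" "j \<in> {1..l}" for i j
    using S that by (intro Min_le) (auto simp: S_def)
  ultimately show ?thesis using d by (intro exI[of _ "Min S"]) force
qed

definition gap :: real where
  "gap = (SOME d. d > 0 \<and> (\<forall>i\<in>{1..l}. \<forall>j\<in>{1..l}. i \<noteq> j \<longrightarrow> (\<forall>x\<in>cyl [i]. \<forall>y\<in>cyl [j]. d \<le> dist x y)))"

lemma gap: "gap > 0"
  "\<lbrakk>i \<in> {1..l}; j \<in> {1..l}; i \<noteq> j; x \<in> cyl [i]; y \<in> cyl [j]\<rbrakk> \<Longrightarrow> gap \<le> dist x y"
  using someI_ex[OF gap_exists] unfolding gap_def[symmetric] by blast+

text \<open>If \<open>y\<close> were outside, the addresses of \<open>x\<close> and \<open>y\<close>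
  would part after some prefix of \<open>J\<close>. There the points lie in the images of two
  distinct first-level cylinders, at distance at least \<open>gap\<close> times the ratio of the
  prefix, and this ratio is at least \<open>ratio J\<close>.\<close>

lemma near_cyl:
  assumes "J \<in> words" "i \<in> {1..l}" "x \<in> cyl (J @ [i])" "y \<in> F" "dist x y < gap * ratio J"
  shows "y \<in> cyl (J @ [i])"
  using assms
proof (induction J arbitrary: x y)
  case Nil
  obtain j where j: "j \<in> {1..l}" "y \<in> cyl [j]" using cyl_split[of "[]" y] Nil by auto
  then show ?case using gap(2)[of i j x y] Nil by (cases "i = j") auto
next
  case (Cons k J)
  have cc: "cyl (k # J @ [i]) = \<phi> [k] ` cyl (J @ [i])"
    using cyl_append[of "[k]" "J @ [i]"] by simp
  obtain x' where x': "x' \<in> cyl (J @ [i])" "x = \<phi> [k] x'" using Cons.prems cc by auto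
  have k: "[k] \<in> words" and J: "J @ [i] \<in> words" "J \<in> words" using Cons.prems by auto
  have x'F: "x' \<in> F" using x' cyl_subset_F[OF J(1)] by blast
  obtain j where j: "j \<in> {1..l}" "y \<in> cyl [j]" using cyl_split[of "[]" y] Cons by auto
  show ?case
  proof (cases "j = k")
    case True
    then obtain y' where y': "y' \<in> F" "y = \<phi> [k] y'" using j by (auto simp: cyl_def)
    have "dist x y = ratio [k] * dist x' y'" using x' y' dist_phi[OF k] by simp
    then have "dist x' y' < gap * ratio J"
      using Cons.prems(5) ratio_pos[OF k] by (simp add: ratio_Cons)
    then have "y' \<in> cyl (J @ [i])" using Cons.IH[of x' y'] J y' x' Cons.prems by auto
    then show ?thesis using y' cc by auto
  next
    case False
    have "gap \<le> dist x y"
      using gap(2)[of k j x y] False j k x' x'F by (auto simp: cyl_def)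
    moreover have "gap * ratio (k # J) \<le> gap * 1"
      using gap(1) ratio_le_1[of "k # J"] Cons.prems by (intro mult_left_mono) auto
    ultimately show ?thesis using Cons.prems by auto
  qed
qed

lemma near_cyl':
  assumes "J \<in> words" "x \<in> cyl J" "y \<in> F" "dist x y < gap * ratio J"
  shows "y \<in> cyl J"
proof (cases J rule: rev_cases)
  case (snoc K i)
  have "ratio J \<le> ratio K"
    using assms snoc contr mult_left_le[of "\<bar>r i\<bar>" "ratio K"] ratio_pos[of K]
    by (auto simp: ratio_append ratio_Cons less_imp_le)
  then have "gap * ratio J \<le> gap * ratio K" using gap(1) by simp
  then show ?thesis using near_cyl[of K i x y] assms snoc by auto
qed (use assms in auto)

text \<open>A set of diameter \<open>d\<close> fits into a cylinder of comparable size. As long as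
  \<open>d\<close> is below the gap of the current cylinder, \<open>near_cyl\<close> puts the whole
  set into one child; the descent ends because ratios tend to zero with the length.\<close>

lemma cyl_cover:
  assumes "E \<subseteq> F" "d > 0" "\<And>x y. x \<in> E \<Longrightarrow> y \<in> E \<Longrightarrow> dist x y \<le> d"
  obtains J where "J \<in> words" "E \<subseteq> cyl J" "gap * ratio J \<le> d"
proof -
  have *: "(\<exists>J\<in>words. length J = n \<and> E \<subseteq> cyl J) \<or> (\<exists>J\<in>words. E \<subseteq> cyl J \<and> gap * ratio J \<le> d)" for n
  proof (induction n)
    case (Suc n)
    show ?case
    proof (cases "\<exists>J\<in>words. E \<subseteq> cyl J \<and> gap * ratio J \<le> d")
      case False
      with Suc obtain J where J: "J \<in> words" "length J = n" "E \<subseteq> cyl J" by auto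
      with False have d: "d < gap * ratio J" by auto
      have "\<exists>i\<in>{1..l}. E \<subseteq> cyl (J @ [i])"
      proof (cases "E = {}")
        case True
        then show ?thesis using l2 by auto
      next
        case False
        then obtain x where x: "x \<in> E" by auto
        then obtain i where i: "i \<in> {1..l}" "x \<in> cyl (J @ [i])" using cyl_split[of J x] J by blast
        have "y \<in> cyl (J @ [i])" if "y \<in> E" for y
          using near_cyl[OF J(1) i, of y] assms(1) assms(3)[OF x that] that d by auto
        then show ?thesis using i by blast
      qed
      then obtain i where "i \<in> {1..l}" "E \<subseteq> cyl (J @ [i])" by auto
      then show ?thesis using J by (intro disjI1 bexI[of _ "J @ [i]"]) auto
    qed auto
  qed (use assms in auto)
  obtain N where N: "\<forall>n\<ge>N. \<forall>J\<in>words. length J = n \<longrightarrow> ratio J * diam < d * diam / gap"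
    using small_ratio[of "d * diam / gap"] assms diam(1) gap(1) by auto
  from * [of N] show ?thesis
  proof
    assume "\<exists>J\<in>words. length J = N \<and> E \<subseteq> cyl J"
    then obtain J where J: "J \<in> words" "length J = N" "E \<subseteq> cyl J" by auto
    then have "ratio J * diam < d * diam / gap" using N by auto
    then have "gap * ratio J \<le> d" using diam(1) gap(1) by (auto simp: field_simps)
    then show ?thesis using that J by auto
  qed (use that in auto)
qed

section \<open>Discreteness of the affine self-embeddings\<close>

text \<open>Three noncollinear points of \<open>F\<close> determine an affine map. Evaluation at
  them is an injective linear map on the coefficient space, hence bounded below, which turns bounds
  on \<open>F\<close> into bounds on coefficients.\<close>

lemma aff_norm_bound: "\<exists>K>0. \<forall>p c. (\<forall>z\<in>F. norm (aff p z) \<le> c) \<longrightarrow> norm p \<le> K * c"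
proof -
  obtain a where a: "a \<in> F" using F_nonempty by blast
  obtain b where b: "b \<in> F" "b \<noteq> a"
  proof -
    have "F \<noteq> {a}" using not_line collinear_sing by metis
    then show ?thesis using a that by blast
  qed
  have F: "insert a (insert b F) = F" using a b by blast
  have "a \<noteq> b" using b by simp
  from collinear_triples[OF this, of F] obtain x where x: "x \<in> F" "\<not> collinear {a, b, x}"
    unfolding F using not_line by blast
  define L where "L p = (aff p a, aff p b, aff p x)" for p
  have lin: "linear L"
    using linear_aff[of a] linear_aff[of b] linear_aff[of x]
    unfolding L_def linear_iff by simp
  have "inj L"
  proof (subst linear_injective_0[OF lin], intro allI impI)
    fix p assume "L p = 0"
    then have "aff p z = 0" if "z \<in> {a, b, x}" for z
      using that by (auto simp: L_def zero_prod_def)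
    then show "p = 0" using aff_zero_on_noncollinear[OF x(2)] by blast
  qed
  then obtain B where B: "B > 0" "\<And>p. B * norm p \<le> norm (L p)"
    using linear_inj_bounded_below_pos[OF lin] by metis
  show ?thesis
  proof (intro exI[of _ "3 / B"] conjI allI impI)
    fix p c assume *: "\<forall>z\<in>F. norm (aff p z) \<le> c"
    have "norm (L p) \<le> norm (aff p a) + (norm (aff p b) + norm (aff p x))"
      unfolding L_def using norm_Pair_le order_trans add_left_mono by meson
    also have "\<dots> \<le> c + (c + c)" using * a b x by (intro add_mono) auto
    finally have "B * norm p \<le> 3 * c" using B(2)[of p] by simp
    then show "norm p \<le> 3 / B * c" using B(1) by (simp add: field_simps)
  qed (use B in auto)
qed

lemma aff_eq_on_F:
  assumes "\<And>z. z \<in> F \<Longrightarrow> aff p z = aff q z" shows "p = q"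
  using aff_zero_on_noncollinear[OF not_line, of "p - q"] assms by (simp add: aff_minus)

text \<open>The estimate opposite to \<open>aff_norm_bound\<close>, from the boundedness of
  \<open>F\<close>: close coefficients give uniformly close maps on \<open>F\<close>.\<close>

lemma aff_close: "\<exists>B>0. \<forall>z\<in>F. \<forall>p q. dist (aff p z) (aff q z) \<le> B * dist p q"
proof -
  obtain R where R: "\<And>z. z \<in> F \<Longrightarrow> norm z \<le> R"
    using compact_imp_bounded[OF compact_F] unfolding bounded_iff by blast
  have Rn: "0 \<le> R" using F_nonempty R norm_ge_zero order_trans by blast
  have "dist (aff p z) (aff q z) \<le> (R + 1) * dist p q" if "z \<in> F" for z p q
  proof -
    have "dist (aff p z) (aff q z) = norm (aff (p - q) z)" by (simp add: aff_minus dist_norm)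
    also have "\<dots> \<le> norm (fst (p - q)) * norm z + norm (snd (p - q))"
      unfolding aff_def
      using norm_triangle_ineq norm_matrix_vector_mult_le add_right_mono order_trans by meson
    also have "\<dots> \<le> norm (p - q) * R + norm (p - q)"
      using R[OF that] Rn norm_fst_snd_le[of "p - q"] norm_ge_zero
      by (intro add_mono mult_mono) (assumption | rule norm_ge_zero)+
    finally show ?thesis by (simp add: dist_norm algebra_simps)
  qed
  then show ?thesis using Rn by (intro exI[of _ "R + 1"]) auto
qed

text \<open>If \<open>f\<close> moved a point \<open>z\<close> of a small cylinder by more than the gap of that cylinder, then all points
  would move in nearly the same direction, including the extreme one.\<close>

lemma near_identity_eq:
  assumes I: "I \<in> words" and fF: "\<And>x. x \<in> cyl I \<Longrightarrow> f x \<in> F"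
    and close: "\<And>x. x \<in> cyl I \<Longrightarrow> dist (f x) x < gap * ratio I"
    and e: "e * diam < gap" "0 \<le> e"
    and lip: "\<And>x y. x \<in> cyl I \<Longrightarrow> y \<in> cyl I \<Longrightarrow> norm ((f x - x) - (f y - y)) \<le> e * dist x y"
    and x: "x \<in> cyl I"
  shows "f x = x"
proof -
  \<comment> \<open>The invariant at depth \<open>n\<close> is that displacements on the cylinder
    around \<open>x\<close> stay below its own gap. By \<open>near_cyl\<close>, \<open>f\<close>
    then maps the next smaller cylinder into itself.\<close>
  have *: "\<exists>J\<in>words. length J = n \<and> x \<in> cyl (I @ J) \<and>
      (\<forall>z\<in>cyl (I @ J). dist (f z) z < gap * ratio (I @ J))" for n
  proof (induction n)
    case 0
    then show ?case using x close by (intro bexI[of _ "[]"]) auto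
  next
    case (Suc n)
    then obtain J where J: "J \<in> words" "length J = n" "x \<in> cyl (I @ J)"
      "\<And>z. z \<in> cyl (I @ J) \<Longrightarrow> dist (f z) z < gap * ratio (I @ J)" by blast
    have IJ: "I @ J \<in> words" using I J by simp
    obtain i where i: "i \<in> {1..l}" "x \<in> cyl ((I @ J) @ [i])"
      using cyl_split[OF IJ J(3)] by blast
    define K where "K = (I @ J) @ [i]"
    have K: "K \<in> words" using I J i by (simp add: K_def)
    have sub: "cyl K \<subseteq> cyl (I @ J)" "cyl (I @ J) \<subseteq> cyl I"
      using cyl_append_subset[of "I @ J" "[i]"] cyl_append_subset[of I J] I J i by (auto simp: K_def)
    have fK: "f z \<in> cyl K" if "z \<in> cyl K" for z
    proof -
      have z: "z \<in> cyl (I @ J)" using sub(1) that by blast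
      then have "f z \<in> F" using sub(2) fF by blast
      then show ?thesis
        using near_cyl[OF IJ i(1), of z "f z"] that J(4)[OF z] unfolding K_def by (simp only: dist_commute)
    qed
    have "dist (f z) z < gap * ratio K" if z: "z \<in> cyl K" for z
    proof (rule ccontr)
      assume "\<not> ?thesis"
      then have big: "gap * ratio K \<le> norm (f z - z)" by (simp add: dist_norm)
      define w where "w = f z - z"
      \<comment> \<open>The point \<open>m\<close> is extreme in the direction of the displacement
        \<open>w\<close> of \<open>z\<close>. Its own displacement differs from \<open>w\<close> by
        less than the length of \<open>w\<close>, so \<open>f m\<close> lies strictly further in
        that direction while still in the cylinder.\<close>
      have "\<exists>m\<in>cyl K. \<forall>y\<in>cyl K. w \<bullet> y \<le> w \<bullet> m"
        using z by (intro continuous_attains_sup compact_cyl continuous_intros) auto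
      then obtain m where m: "m \<in> cyl K" "\<And>y. y \<in> cyl K \<Longrightarrow> w \<bullet> y \<le> w \<bullet> m" by blast
      have w0: "0 < norm w" using big mult_pos_pos[OF gap(1) ratio_pos[OF K]] by (simp add: w_def del: zero_less_norm_iff)
      have "norm ((f m - m) - (f z - z)) \<le> e * dist m z"
        using lip m z sub by blast
      also have "\<dots> \<le> e * (ratio K * diam)"
        using dist_cyl_less[OF K m(1) z] e by (intro mult_left_mono) auto
      also have "\<dots> < gap * ratio K"
        using mult_strict_right_mono[OF e(1) ratio_pos[OF K]] by (simp add: algebra_simps)
      also have "\<dots> \<le> norm w" using big w_def by simp
      finally have d: "norm ((f m - m) - w) < norm w" by (simp add: w_def)
      have "\<bar>w \<bullet> ((f m - m) - w)\<bar> \<le> norm w * norm ((f m - m) - w)" by (rule Cauchy_Schwarz_ineq2)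
      also have "\<dots> < norm w * norm w" using d w0 by simp
      finally have "w \<bullet> w + w \<bullet> ((f m - m) - w) > 0"
        by (simp add: power2_norm_eq_inner[symmetric] power2_eq_square)
      then have "w \<bullet> f m > w \<bullet> m" by (simp add: inner_diff_right)
      then show False using m(2)[OF fK[OF m(1)]] by simp
    qed
    then show ?case using J i K by (intro bexI[of _ "J @ [i]"]) (auto simp: K_def)
  qed
  have "dist (f x) x \<le> 0"
  proof (rule field_le_epsilon)
    fix e :: real assume "0 < e"
    then obtain N where N: "\<forall>n\<ge>N. \<forall>J\<in>words. length J = n \<longrightarrow> ratio J * diam < e * diam / gap"
      using small_ratio[of "e * diam / gap"] diam(1) gap(1) by auto
    obtain J where J: "J \<in> words" "length J = N" "x \<in> cyl (I @ J)"
      "\<And>z. z \<in> cyl (I @ J) \<Longrightarrow> dist (f z) z < gap * ratio (I @ J)" using *[of N] by blast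
    then have "ratio (I @ J) * diam < e * diam / gap"
      using N[rule_format, of "length (I @ J)" "I @ J"] I by simp
    then have "gap * ratio (I @ J) < e" using diam(1) gap(1) by (simp add: field_simps)
    then show "dist (f x) x \<le> 0 + e" using J(4)[OF J(3)] by simp
  qed
  then show ?thesis by simp
qed

text \<open>A cylinder is an affine copy of \<open>F\<close> and thus determines an affine map just
  as \<open>F\<close> does.\<close>

lemma aff_eq_on_cyl:
  assumes I: "I \<in> words" and eq: "\<And>x. x \<in> cyl I \<Longrightarrow> aff q x = aff p x"
  shows "q = p"
proof -
  obtain a where a: "aff q \<circ> \<phi> I = aff a" using aff_comp[of q "(lin I, \<phi> I 0)"] phi_aff[of I] by metis
  obtain b where b: "aff p \<circ> \<phi> I = aff b" using aff_comp[of p "(lin I, \<phi> I 0)"] phi_aff[of I] by metis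
  have "a = b"
  proof (rule aff_eq_on_F)
    show "aff a z = aff b z" if "z \<in> F" for z
      using eq[of "\<phi> I z"] that by (simp add: a[symmetric] b[symmetric] cyl_def)
  qed
  then have *: "aff q (\<phi> I z) = aff p (\<phi> I z)" for z
    using a b by (metis o_apply)
  have "aff q z = aff p z" for z
    using *[of "phinv I z"] I by simp
  then show ?thesis using aff_eq_iff[of q p] by blast
qed

text \<open>For \<open>q\<close> near \<open>p\<close>, the inverse of \<open>p\<close> composed
  with \<open>q\<close> is near the identity. On a small cylinder \<open>cyl I\<close> it maps into
  \<open>F\<close>, because \<open>q\<close> sends \<open>cyl I\<close> into \<open>cyl J\<close>
  and the image of \<open>p\<close> covers \<open>cyl J\<close>. So \<open>near_identity_eq\<close>
  makes it the identity there.\<close>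

lemma isolated_of_open_image:
  assumes pF: "aff p ` F \<subseteq> F" and ex: "expands c (aff p)" and c: "c > 0"
    and J: "J \<in> words" "cyl J \<subseteq> aff p ` F"
  shows "\<exists>e>0. \<forall>q. aff q ` F \<subseteq> F \<and> dist q p < e \<longrightarrow> q = p"
proof -
  obtain B where B: "B > 0" "\<And>z p q. z \<in> F \<Longrightarrow> dist (aff p z) (aff q z) \<le> B * dist p q"
    using aff_close by blast
  obtain x where x: "x \<in> F" "aff p x \<in> cyl J"
  proof -
    obtain y where "y \<in> F" using F_nonempty by blast
    then have y: "\<phi> J y \<in> cyl J" by (simp add: cyl_def)
    from subsetD[OF J(2) y] show ?thesis
    proof
      fix x assume "\<phi> J y = aff p x" "x \<in> F"
      then show ?thesis using that[of x] y by (simp only:)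
    qed
  qed
  define N where "N = norm (fst p) + 1"
  have N: "N > 0" by (simp add: N_def add_nonneg_pos)
  have NL: "dist (aff p x) (aff p y) \<le> N * dist x y" for x y
    unfolding N_def by (rule aff_lipschitz_pos)
  obtain I where I: "I \<in> words" "x \<in> cyl I" "ratio I * diam < gap * ratio J / N"
    using small_cyl[OF x(1), of "gap * ratio J / N"] gap(1) ratio_pos[OF J(1)] N by auto
  have IF: "cyl I \<subseteq> F" using cyl_subset_F[OF I(1)] .
  have IJ: "aff p y \<in> cyl J" if y: "y \<in> cyl I" for y
  proof (rule near_cyl'[OF J(1) x(2)])
    show "aff p y \<in> F" using IF y pF by blast
    have "dist (aff p x) (aff p y) \<le> N * dist x y" by (rule NL)
    also have "\<dots> < N * (gap * ratio J / N)"
      using dist_cyl_less[OF I(1) I(2) y] I(3) N by (intro mult_strict_left_mono) auto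
    finally show "dist (aff p x) (aff p y) < gap * ratio J" using N by simp
  qed
  obtain u where u: "aff u \<circ> aff p = id" "aff p \<circ> aff u = id" "\<And>v. norm (fst u *v v) \<le> norm v / c"
    using aff_left_inverse[OF ex c] by metis
  have up: "aff u (aff p x) = x" for x using u(1) by (metis id_apply o_apply)
  \<comment> \<open>The three bounds keep the \<open>q\<close>-image of \<open>cyl I\<close> inside
    \<open>cyl J\<close>, the displacement of \<open>f\<close> below the gap of
    \<open>cyl I\<close>, and the Lipschitz constant of that displacement below
    \<open>gap / diam\<close>.\<close>
  define e where "e = Min {gap * ratio J / B, gap * ratio I * c / B, c * gap / (2 * diam)}"
  have e0: "e > 0"
    unfolding e_def using gap(1) ratio_pos J(1) I(1) B(1) c diam(1) by auto
  have e1: "B * e \<le> gap * ratio J" "B * e \<le> gap * ratio I * c" "2 * diam * e \<le> c * gap"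
  proof -
    have "e \<le> gap * ratio J / B" "e \<le> gap * ratio I * c / B" "e \<le> c * gap / (2 * diam)"
      unfolding e_def by (intro Min_le; simp)+
    then show "B * e \<le> gap * ratio J" "B * e \<le> gap * ratio I * c" "2 * diam * e \<le> c * gap"
      using B(1) diam(1) by (simp_all add: field_simps)
  qed
  have "q = p" if q: "aff q ` F \<subseteq> F" "dist q p < e" for q
  proof (rule aff_eq_on_cyl[OF I(1)])
    define f where "f = aff u \<circ> aff q"
    have Bq: "B * dist q p < B * e" using q B(1) by simp
    have close: "dist (aff q y) (aff p y) < B * e" if "y \<in> cyl I" for y
      using B(2)[of y q p] Bq that IF by (meson order_le_less_trans subset_iff)
    have fid: "f y = y" if "y \<in> cyl I" for y
    proof (rule near_identity_eq[OF I(1), of f "dist q p / c"])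
      fix z assume z: "z \<in> cyl I"
      have "aff q z \<in> cyl J"
        by (rule near_cyl'[OF J(1) IJ[OF z]])
          (use close[OF z] e1(1) q z IF in \<open>auto simp: dist_commute\<close>)
      then obtain y where "y \<in> F" "aff q z = aff p y" using J(2) by blast
      then show "f z \<in> F" using up by (simp add: f_def)
      have "dist (f z) z = norm (fst u *v (aff q z - aff p z))"
        by (simp add: f_def dist_norm aff_diff[symmetric] up)
      also have "\<dots> \<le> dist (aff q z) (aff p z) / c" using u(3) by (simp add: dist_norm)
      also have "\<dots> < B * e / c" using close[OF z] c by (simp add: divide_strict_right_mono)
      also have "\<dots> \<le> gap * ratio I" using e1(2) c by (simp add: field_simps)
      finally show "dist (f z) z < gap * ratio I" .
    next
      fix z y assume "z \<in> cyl I" "y \<in> cyl I"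
      have "f z - z - (f y - y) = fst u *v ((aff q z - aff p z) - (aff q y - aff p y))"
        using aff_diff[of u "aff q z" "aff p z"] aff_diff[of u "aff q y" "aff p y"]
        by (simp add: f_def up matrix_vector_mult_diff_distrib)
      also have "(aff q z - aff p z) - (aff q y - aff p y) = fst (q - p) *v (z - y)"
        by (simp only: aff_minus[symmetric] aff_diff)
      finally have "norm (f z - z - (f y - y)) \<le> norm (fst (q - p) *v (z - y)) / c"
        using u(3) by simp
      also have "\<dots> \<le> dist q p * dist z y / c"
      proof -
        have "norm (fst (q - p) *v (z - y)) \<le> norm (fst (q - p)) * norm (z - y)"
          by (rule norm_matrix_vector_mult_le)
        also have "\<dots> \<le> dist q p * dist z y"
          unfolding dist_norm using norm_fst_snd_le(1) by (intro mult_right_mono norm_ge_zero)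
        finally show ?thesis using c by (simp add: divide_right_mono)
      qed
      finally show "norm (f z - z - (f y - y)) \<le> dist q p / c * dist z y" by simp
    next
      have "dist q p / c * diam \<le> e / c * diam"
        using q c diam(1) by (intro mult_right_mono divide_right_mono) auto
      also have "\<dots> \<le> gap / 2" using e1(3) c by (simp add: field_simps)
      also have "\<dots> < gap" using gap(1) by simp
      finally show "dist q p / c * diam < gap" .
    qed (use that c in auto)
    fix y assume "y \<in> cyl I"
    from fid[OF this] have "aff p (f y) = aff p y" by simp
    then show "aff q y = aff p y" using u(2) unfolding f_def by (metis comp_assoc id_comp o_apply id_apply)
  qed
  then show ?thesis using e0 by blast
qed

section \<open>The Moran equation and weights of cylinders\<close>

text \<open>Intermediate value theorem: the sum equals \<open>l\<close> at exponent zero and is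
  below one at an exponent \<open>n\<close> with \<open>rmax ^ n < 1 / l\<close>.\<close>

lemma similarity_dimension_exists: "\<exists>s>0. (\<Sum>i\<in>{1..l}. \<bar>r i\<bar> powr s) = 1"
proof -
  define f where "f s = (\<Sum>i\<in>{1..l}. \<bar>r i\<bar> powr s)" for s
  have f0: "f 0 = l" unfolding f_def using contr by (simp add: sum.cong[of "{1..l}" "{1..l}" _ "\<lambda>_. 1"])
  obtain n where n: "rmax ^ n < 1 / l"
    using real_arch_pow_inv[of "1 / l" rmax] rmax l2 by auto
  have "f n \<le> (\<Sum>i\<in>{1..l}. rmax ^ n)"
    unfolding f_def
  proof (rule sum_mono)
    fix i assume "i \<in> {1..l}"
    then show "\<bar>r i\<bar> powr real n \<le> rmax ^ n"
      using contr rmax(3)[of i] by (simp add: powr_realpow power_mono)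
  qed
  also have "\<dots> < 1" using n l2 by (simp add: field_simps)
  finally have fn: "f n < 1" .
  have "\<exists>s\<ge>0. s \<le> real n \<and> f s = 1"
  proof (rule IVT2)
    show "\<forall>s. 0 \<le> s \<and> s \<le> real n \<longrightarrow> isCont f s"
      unfolding f_def using contr by (intro allI impI continuous_intros) auto
  qed (use f0 fn l2 in auto)
  then obtain s where s: "s \<ge> 0" "f s = 1" by auto
  then have "s \<noteq> 0" using f0 l2 by auto
  then show ?thesis using s by (intro exI[of _ s]) (auto simp: f_def)
qed

definition sdim :: real where "sdim = (SOME s. s > 0 \<and> (\<Sum>i\<in>{1..l}. \<bar>r i\<bar> powr s) = 1)"

lemma sdim: "sdim > 0" "(\<Sum>i\<in>{1..l}. \<bar>r i\<bar> powr sdim) = 1"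
  using someI_ex[OF similarity_dimension_exists] unfolding sdim_def[symmetric] by blast+

text \<open>The mass of the cylinder under the natural self-similar probability measure, which
  enters only through finite sums.\<close>

definition weight :: "nat list \<Rightarrow> real" where "weight J = ratio J powr sdim"

lemma weight_nonneg [simp]: "0 \<le> weight J"
  by (simp add: weight_def)

lemma weight_pos: "J \<in> words \<Longrightarrow> 0 < weight J"
  using ratio_pos[of J] by (simp add: weight_def)

lemma ratio_nonneg: "0 \<le> ratio J"
  unfolding ratio_def by (induction J) auto

lemma weight_append: "weight (I @ J) = weight I * weight J"
  using ratio_nonneg by (simp add: weight_def ratio_append powr_mult)

text \<open>A combinatorial form of the fact that \<open>F\<close> has mass one. A cover is split by
  first letters; as first-level cylinders are disjoint, the tails of the words that begin with
  \<open>i\<close> again cover \<open>F\<close>, and they are shorter. Lists instead of sets admit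
  covers with repeated words, such as \<open>map H W\<close> in
  \<open>image_meets_all\<close>.\<close>

lemma cover_weight:
  assumes "\<And>J. J \<in> set W \<Longrightarrow> J \<in> words \<and> length J \<le> n" "F \<subseteq> (\<Union>J\<in>set W. cyl J)"
  shows "1 \<le> (\<Sum>J\<leftarrow>W. weight J)"
  using assms
proof (induction n arbitrary: W)
  case 0
  then obtain J where "J \<in> set W" using F_nonempty by auto
  with 0 have "[] \<in> set W" by auto
  then obtain U V where "W = U @ [] # V" by (auto simp: in_set_conv_decomp)
  moreover have "0 \<le> (\<Sum>J\<leftarrow>U. weight J)" "0 \<le> (\<Sum>J\<leftarrow>V. weight J)"
    by (auto intro!: sum_list_nonneg)
  ultimately show ?case by (simp add: weight_def)
next
  case (Suc n)
  show ?case
  proof (cases "[] \<in> set W")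
    case True
    then obtain U V where "W = U @ [] # V" by (auto simp: in_set_conv_decomp)
    moreover have "0 \<le> (\<Sum>J\<leftarrow>U. weight J)" "0 \<le> (\<Sum>J\<leftarrow>V. weight J)"
      by (auto intro!: sum_list_nonneg)
    ultimately show ?thesis by (simp add: weight_def)
  next
    case False
    have ne: "J \<noteq> []" if "J \<in> set W" for J using that False by auto
    have hd: "hd J \<in> {1..l}" if "J \<in> set W" for J
      using Suc.prems(1)[OF that] ne[OF that] by (cases J) auto
    define V where "V i = map tl (filter (\<lambda>J. hd J = i) W)" for i
    have "1 \<le> (\<Sum>J\<leftarrow>V i. weight J)" if i: "i \<in> {1..l}" for i
    proof (rule Suc.IH)
      show "J \<in> words \<and> length J \<le> n" if "J \<in> set (V i)" for J
      proof -
        have "J \<in> tl ` set (filter (\<lambda>J. hd J = i) W)" using that by (simp add: V_def)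
        then obtain K where "K \<in> set W" "J = tl K" by auto
        moreover from this obtain j K' where "K = j # K'" using ne[of K] by (meson neq_Nil_conv)
        ultimately show ?thesis using Suc.prems(1)[of K] by auto
      qed
      show "F \<subseteq> (\<Union>J\<in>set (V i). cyl J)"
      proof
        fix x assume x: "x \<in> F"
        have ix: "\<phi> [i] x \<in> cyl [i]" using x by (auto simp: cyl_def)
        then have "\<phi> [i] x \<in> F" using cyl_subset_F[of "[i]"] i by auto
        then obtain J where J: "J \<in> set W" "\<phi> [i] x \<in> cyl J" using Suc.prems by blast
        then obtain j K where jK: "J = j # K" using ne[of J] by (meson neq_Nil_conv)
        have jK': "j \<in> {1..l}" "K \<in> words" using Suc.prems(1)[OF J(1)] jK by auto
        have xK: "\<phi> [i] x \<in> \<phi> [j] ` cyl K" using J(2) jK cyl_append[of "[j]" K] by simp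
        then have "\<phi> [i] x \<in> cyl [j]" using cyl_subset_F[OF jK'(2)] by (auto simp: cyl_def)
        then have "i = j" using gap(2)[of i j "\<phi> [i] x" "\<phi> [i] x"] gap(1) ix i jK' by fastforce
        moreover have "x = y" if "\<phi> [i] x = \<phi> [i] y" for y
          using arg_cong[OF that, of "phinv [i]"] i by (simp only: phinv_phi words_simps)
        ultimately have "x \<in> cyl K" using xK by blast
        then show "x \<in> (\<Union>J\<in>set (V i). cyl J)"
          using J(1) jK \<open>i = j\<close> by (force simp: V_def)
      qed
    qed
    then have "(\<Sum>i\<in>{1..l}. \<bar>r i\<bar> powr sdim * 1) \<le> (\<Sum>i\<in>{1..l}. \<bar>r i\<bar> powr sdim * (\<Sum>J\<leftarrow>V i. weight J))"
      by (intro sum_mono mult_left_mono) auto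
    also have "\<dots> = (\<Sum>i\<in>{1..l}. \<Sum>J\<leftarrow>filter (\<lambda>J. hd J = i) W. weight J)"
    proof (rule sum.cong)
      fix i
      have "\<bar>r i\<bar> powr sdim * weight (tl J) = weight J" if "J \<in> set W" "hd J = i" for J
      proof -
        obtain j K where "J = j # K" using ne[of J] \<open>J \<in> set W\<close> by (meson neq_Nil_conv)
        then show ?thesis using \<open>hd J = i\<close> ratio_nonneg by (auto simp: weight_def ratio_Cons powr_mult)
      qed
      then show "\<bar>r i\<bar> powr sdim * (\<Sum>J\<leftarrow>V i. weight J) = (\<Sum>J\<leftarrow>filter (\<lambda>J. hd J = i) W. weight J)"
        unfolding V_def sum_list_const_mult[symmetric] map_map by (intro arg_cong[of _ _ sum_list] map_cong) auto
    qed simp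
    also have "\<dots> = (\<Sum>J\<leftarrow>W. weight J)" using sum_list_split_hd[OF hd] by simp
    finally show ?thesis using sdim by simp
  qed
qed

definition level :: "nat \<Rightarrow> nat list list" where "level n = List.n_lists n [1..<Suc l]"

lemma set_level: "set (level n) = {K \<in> words. length K = n}"
  by (auto simp: level_def set_n_lists words_def)

lemma level_weight: "(\<Sum>K\<leftarrow>level n. weight K) = 1"
proof (induction n)
  case 0
  then show ?case by (simp add: level_def weight_def)
next
  case (Suc n)
  have "(\<Sum>y\<leftarrow>[1..<Suc l]. weight (y # ys)) = weight ys" for ys
  proof -
    have "(\<Sum>y\<leftarrow>[1..<Suc l]. weight (y # ys)) = (\<Sum>y\<in>{1..l}. \<bar>r y\<bar> powr sdim * weight ys)"
      by (subst sum_list_distinct_conv_sum_set)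
        (simp_all add: atLeastLessThanSuc_atLeastAtMost weight_def ratio_Cons powr_mult ratio_nonneg del: upt_Suc)
    then show ?thesis using sdim(2) by (simp add: sum_distrib_right[symmetric])
  qed
  then have "(\<Sum>K\<leftarrow>level (Suc n). weight K) = (\<Sum>K\<leftarrow>level n. weight K)"
    unfolding level_def List.n_lists.simps by (subst sum_list_concat_map) (simp add: comp_def del: upt_Suc)
  then show ?case using Suc by simp
qed

text \<open>Otherwise every cylinder has a subcylinder, \<open>n\<close> levels deeper, that the
  image misses. Deleting these repeatedly gives covers of the image whose total weight decays
  geometrically. Pulled back along the map they become covers of \<open>F\<close> with weights
  distorted by a bounded factor only, against \<open>cover_weight\<close>.\<close>

lemma image_meets_all:
  assumes pF: "aff p ` F \<subseteq> F" and ex: "expands c (aff p)" and c: "c > 0"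
  shows "\<exists>J\<in>words. \<forall>K\<in>words. length K = n \<longrightarrow> (\<exists>z\<in>F. aff p z \<in> cyl (J @ K))"
proof (rule ccontr)
  assume "\<not> ?thesis"
  then obtain miss where miss: "\<And>J. J \<in> words \<Longrightarrow> miss J \<in> words \<and> length (miss J) = n \<and>
      (\<forall>z\<in>F. aff p z \<notin> cyl (J @ miss J))" by metis
  \<comment> \<open>A lower bound for the fraction of the weight of a cylinder that is lost by
    deleting one subcylinder \<open>n\<close> levels deeper.\<close>
  define \<theta> where "\<theta> = Min (weight ` set (level n))"
  have fin: "finite (weight ` set (level n))" by simp
  have ne: "weight ` set (level n) \<noteq> {}" using miss[of "[]"] set_level by auto
  have \<theta>: "0 < \<theta>"
    unfolding \<theta>_def using fin ne weight_pos set_level by (subst Min_gr_iff) auto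
  have \<theta>_le: "\<theta> \<le> weight K" if "K \<in> words" "length K = n" for K
    unfolding \<theta>_def using fin that set_level by (intro Min_le) auto
  have \<theta>1: "\<theta> \<le> 1"
  proof -
    have "weight J \<le> 1" if "J \<in> words" for J
      using ratio_le_1[OF that] ratio_nonneg sdim(1) powr_mono2[of sdim "ratio J" 1] by (simp add: weight_def)
    then show ?thesis using \<theta>_le miss[of "[]"] by (meson words_simps(1) order_trans)
  qed
  have cov: "\<exists>W. set W \<subseteq> words \<and> aff p ` F \<subseteq> (\<Union>J\<in>set W. cyl J) \<and> (\<Sum>J\<leftarrow>W. weight J) \<le> (1 - \<theta>) ^ k" for k
  proof (induction k)
    case 0
    then show ?case using pF by (intro exI[of _ "[[]]"]) (auto simp: weight_def)
  next
    case (Suc k)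
    then obtain W where W: "set W \<subseteq> words" "aff p ` F \<subseteq> (\<Union>J\<in>set W. cyl J)"
      "(\<Sum>J\<leftarrow>W. weight J) \<le> (1 - \<theta>) ^ k" by blast
    define G where "G J = map ((@) J) (filter (\<lambda>K. K \<noteq> miss J) (level n))" for J
    define V where "V = concat (map G W)"
    have "set V \<subseteq> words" using W(1) set_level by (auto simp: V_def G_def)
    moreover have "aff p ` F \<subseteq> (\<Union>J\<in>set V. cyl J)"
    proof
      fix y assume y: "y \<in> aff p ` F"
      then obtain J where J: "J \<in> set W" "y \<in> cyl J" using W(2) by blast
      then have Jw: "J \<in> words" using W(1) by blast
      obtain K where K: "K \<in> words" "length K = n" "y \<in> cyl (J @ K)"
        using cyl_exists[OF Jw J(2), of n] by blast
      then have "K \<noteq> miss J" using miss[OF Jw] y by blast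
      then have "J @ K \<in> set V" using J K set_level by (auto simp: V_def G_def)
      then show "y \<in> (\<Union>J\<in>set V. cyl J)" using K by blast
    qed
    moreover have "(\<Sum>J\<leftarrow>V. weight J) \<le> (1 - \<theta>) ^ Suc k"
    proof -
      have "(\<Sum>J\<leftarrow>V. weight J) = (\<Sum>J\<leftarrow>W. \<Sum>K\<leftarrow>G J. weight K)"
        unfolding V_def by (rule sum_list_concat_map)
      also have "\<dots> \<le> (\<Sum>J\<leftarrow>W. (1 - \<theta>) * weight J)"
      proof (rule sum_list_mono)
        fix J assume "J \<in> set W"
        then have Jw: "J \<in> words" using W(1) by blast
        have "(\<Sum>K\<leftarrow>G J. weight K) = weight J * (\<Sum>K\<leftarrow>filter (\<lambda>K. K \<noteq> miss J) (level n). weight K)"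
          unfolding G_def by (simp add: comp_def weight_append sum_list_const_mult)
        also have "\<dots> \<le> weight J * (1 - weight (miss J))"
          using sum_list_filter_neq_le[of "miss J" "level n" weight] miss[OF Jw] set_level level_weight
          by (intro mult_left_mono) auto
        also have "\<dots> \<le> weight J * (1 - \<theta>)"
          using \<theta>_le miss[OF Jw] by (intro mult_left_mono) auto
        finally show "(\<Sum>K\<leftarrow>G J. weight K) \<le> (1 - \<theta>) * weight J" by (simp add: mult.commute)
      qed
      also have "\<dots> = (1 - \<theta>) * (\<Sum>J\<leftarrow>W. weight J)" by (simp add: sum_list_const_mult)
      also have "\<dots> \<le> (1 - \<theta>) * (1 - \<theta>) ^ k" using W(3) \<theta>1 by (intro mult_left_mono) auto
      finally show ?thesis by simp
    qed
    ultimately show ?case by blast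
  qed
  define C where "C = (diam / (c * gap)) powr sdim"
  \<comment> \<open>Expansion bounds the diameter of the preimage of \<open>cyl J\<close>, so
    \<open>cyl_cover\<close> encloses it in a cylinder of comparable ratio; the constant
    \<open>C\<close> expresses this in weights.\<close>
  have "\<exists>J'\<in>words. (\<forall>x\<in>F. aff p x \<in> cyl J \<longrightarrow> x \<in> cyl J') \<and> gap * ratio J' \<le> ratio J * diam / c"
    if J: "J \<in> words" for J
  proof -
    have d: "dist x y \<le> ratio J * diam / c" if "aff p x \<in> cyl J" "aff p y \<in> cyl J" for x y
      using expandsD[OF ex, of x y] dist_cyl_less[OF J that] c by (simp add: field_simps)
    have "0 < ratio J * diam / c" using ratio_pos[OF J] diam(1) c by simp
    then show ?thesis
      using cyl_cover[of "{x \<in> F. aff p x \<in> cyl J}" "ratio J * diam / c"] d by (smt (verit) mem_Collect_eq subset_iff)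
  qed
  then obtain H where H: "\<And>J. J \<in> words \<Longrightarrow> H J \<in> words \<and> (\<forall>x\<in>F. aff p x \<in> cyl J \<longrightarrow> x \<in> cyl (H J))
      \<and> gap * ratio (H J) \<le> ratio J * diam / c" by metis
  have HC: "weight (H J) \<le> C * weight J" if J: "J \<in> words" for J
  proof -
    have "ratio (H J) \<le> diam / (c * gap) * ratio J"
      using H[OF J] c gap(1) by (simp add: field_simps)
    then have "weight (H J) \<le> (diam / (c * gap) * ratio J) powr sdim"
      unfolding weight_def using sdim(1) ratio_nonneg by (intro powr_mono2) auto
    then show ?thesis unfolding C_def weight_def using diam(1) c gap(1)
      by (subst powr_mult[symmetric]) (auto simp: ratio_nonneg)
  qed
  have "1 \<le> C * (1 - \<theta>) ^ k" for k
  proof -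
    obtain W where W: "set W \<subseteq> words" "aff p ` F \<subseteq> (\<Union>J\<in>set W. cyl J)"
      "(\<Sum>J\<leftarrow>W. weight J) \<le> (1 - \<theta>) ^ k" using cov by blast
    have "1 \<le> (\<Sum>J\<leftarrow>map H W. weight J)"
    proof (rule cover_weight)
      show "J \<in> words \<and> length J \<le> Max (length ` set (map H W))" if "J \<in> set (map H W)" for J
        using that H W(1) by (auto intro!: Max_ge)
      show "F \<subseteq> (\<Union>J\<in>set (map H W). cyl J)"
      proof
        fix x assume x: "x \<in> F"
        then obtain J where "J \<in> set W" "aff p x \<in> cyl J" using W(2) by blast
        then show "x \<in> (\<Union>J\<in>set (map H W). cyl J)" using H[of J] W(1) x by auto
      qed
    qed
    also have "\<dots> \<le> (\<Sum>J\<leftarrow>W. C * weight J)"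
      using HC W(1) by (auto simp: comp_def intro!: sum_list_mono)
    also have "\<dots> = C * (\<Sum>J\<leftarrow>W. weight J)" by (simp add: sum_list_const_mult)
    also have "\<dots> \<le> C * (1 - \<theta>) ^ k" using W(3) by (intro mult_left_mono) (auto simp: C_def)
    finally show ?thesis .
  qed
  moreover have "(\<lambda>k. C * (1 - \<theta>) ^ k) \<longlonglongrightarrow> C * 0"
    using \<theta> \<theta>1 by (intro tendsto_intros LIMSEQ_power_zero) auto
  ultimately have "1 \<le> C * 0" by (intro LIMSEQ_le_const[of _ _ 1]) auto
  then show False by simp
qed

section \<open>Blow-ups of an embedding and finiteness\<close>

lemma conj_aff: "J \<in> words \<Longrightarrow> \<exists>u. phinv J \<circ> aff p \<circ> \<phi> I = aff u"
  by (metis aff_comp phi_aff phinv_aff)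

text \<open>By \<open>image_meets_all\<close> there are cylinders \<open>cyl (J n)\<close> such that
  the image meets all their subcylinders \<open>n + 1\<close> levels deeper. Zooming in by
  \<open>phinv (J n)\<close> after the map and by \<open>\<phi> (I n)\<close> before it gives maps
  \<open>u n\<close> with uniform two-sided bounds, and a limit \<open>U\<close> covers
  \<open>F\<close>. Restricted to a small cylinder, \<open>U\<close> is an isolated embedding and so
  coincides with the restriction of some \<open>u n\<close>, whose image therefore contains a
  cylinder.\<close>

lemma open_image:
  assumes pF: "aff p ` F \<subseteq> F" and ex: "expands c (aff p)" and c: "c > 0"
  obtains J where "J \<in> words" "cyl J \<subseteq> aff p ` F"
proof -
  define N where "N = norm (fst p) + 1"
  have N: "N > 0" by (simp add: N_def add_nonneg_pos)
  have NL: "dist (aff p x) (aff p y) \<le> N * dist x y" for x y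
    unfolding N_def by (rule aff_lipschitz_pos)
  \<comment> \<open>Depth \<open>Suc n\<close> instead of \<open>n\<close> guarantees that the
    tested words have a first letter, which the lower bound \<open>c0\<close> relies on.\<close>
  have "\<exists>J\<in>words. \<exists>I\<in>words. (\<forall>K\<in>words. length K = Suc n \<longrightarrow> (\<exists>z\<in>F. aff p z \<in> cyl (J @ K))) \<and>
      (\<forall>x\<in>F. aff p x \<in> cyl J \<longrightarrow> x \<in> cyl I) \<and> gap * ratio I \<le> ratio J * diam / c" for n
  proof -
    obtain J where J: "J \<in> words" "\<forall>K\<in>words. length K = Suc n \<longrightarrow> (\<exists>z\<in>F. aff p z \<in> cyl (J @ K))"
      using image_meets_all[OF pF ex c, of "Suc n"] by blast
    have d: "dist x y \<le> ratio J * diam / c" if "aff p x \<in> cyl J" "aff p y \<in> cyl J" for x y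
      using expandsD[OF ex, of x y] dist_cyl_less[OF J(1) that] c by (simp add: field_simps)
    have "0 < ratio J * diam / c" using ratio_pos[OF J(1)] diam(1) c by simp
    then obtain I where "I \<in> words" "{x \<in> F. aff p x \<in> cyl J} \<subseteq> cyl I" "gap * ratio I \<le> ratio J * diam / c"
      using cyl_cover[of "{x \<in> F. aff p x \<in> cyl J}" "ratio J * diam / c"] d
      by (smt (verit) mem_Collect_eq subset_iff)
    then show ?thesis using J by blast
  qed
  then obtain J I where JI: "\<And>n. J n \<in> words" "\<And>n. I n \<in> words"
      and hit: "\<And>n K. K \<in> words \<Longrightarrow> length K = Suc n \<Longrightarrow> \<exists>z\<in>F. aff p z \<in> cyl (J n @ K)"
      and sub: "\<And>n x. x \<in> F \<Longrightarrow> aff p x \<in> cyl (J n) \<Longrightarrow> x \<in> cyl (I n)"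
      and le: "\<And>n. gap * ratio (I n) \<le> ratio (J n) * diam / c" by metis
  have rp: "0 < ratio (J n)" "0 < ratio (I n)" for n using JI ratio_pos by auto
  have "\<forall>n. \<exists>u. phinv (J n) \<circ> aff p \<circ> \<phi> (I n) = aff u" using conj_aff[OF JI(1)] by blast
  then obtain u where u': "\<And>n. phinv (J n) \<circ> aff p \<circ> \<phi> (I n) = aff (u n)" by metis
  have u: "aff (u n) x = phinv (J n) (aff p (\<phi> (I n) x))" for n x
    using fun_cong[OF u'[of n], of x] by simp
  have du: "dist (aff (u n) x) (aff (u n) y) = dist (aff p (\<phi> (I n) x)) (aff p (\<phi> (I n) y)) / ratio (J n)" for n x y
    unfolding u using dist_phinv JI by blast
  define K0 where "K0 = diam / (c * gap)"
  have K0: "ratio (I n) \<le> K0 * ratio (J n)" for n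
    using le[of n] c gap(1) by (simp add: K0_def field_simps)
  have K0p: "K0 > 0" using diam(1) c gap(1) by (simp add: K0_def)
  have hit': "\<exists>z\<in>F. aff (u n) z \<in> cyl K" if K: "K \<in> words" "length K = Suc n" for n K
  proof -
    obtain x where x: "x \<in> F" "aff p x \<in> cyl (J n @ K)" using hit[OF K] by blast
    then have "aff p x \<in> cyl (J n)" using cyl_append_subset JI(1) K(1) by blast
    then obtain z where z: "z \<in> F" "x = \<phi> (I n) z" using sub x by (auto simp: cyl_def)
    obtain y where y: "y \<in> cyl K" "aff p x = \<phi> (J n) y" using x(2) by (auto simp: cyl_append)
    have "aff (u n) z = y" unfolding u z(2)[symmetric] y(2) using JI by simp
    then show ?thesis using z y by blast
  qed
  have upper: "dist (aff (u n) x) (aff (u n) y) \<le> N * K0 * dist x y" for n x y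
  proof -
    have "dist (aff (u n) x) (aff (u n) y) \<le> N * (ratio (I n) * dist x y) / ratio (J n)"
      unfolding du using NL[of "\<phi> (I n) x" "\<phi> (I n) y"] rp JI by (simp add: dist_phi divide_right_mono less_imp_le)
    also have "\<dots> \<le> N * (K0 * ratio (J n) * dist x y) / ratio (J n)"
      using K0 N rp by (intro divide_right_mono mult_left_mono mult_right_mono) (auto simp: less_imp_le)
    finally show ?thesis using rp[of n] by (simp add: less_imp_neq[symmetric])
  qed
  \<comment> \<open>The image of \<open>u n\<close> meets both \<open>cyl [1]\<close> and
    \<open>cyl [2]\<close>, which are \<open>gap\<close> apart. So \<open>ratio (I n)\<close> cannot
    be much smaller than \<open>ratio (J n)\<close>, and this bounds the expansion of
    \<open>u n\<close> from below.\<close>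
  define c0 where "c0 = c * gap / (N * diam)"
  have c0: "c0 > 0" using c gap(1) N diam(1) by (simp add: c0_def)
  have lower: "expands c0 (aff (u n))" for n
    unfolding expands_def
  proof (intro allI)
    fix x y :: pt
    define K L where "K = replicate (Suc n) (1::nat)" "L = replicate (Suc n) (2::nat)"
    have rw: "replicate m i \<in> words" if "i \<in> {1..l}" for m i using that by (induction m) auto
    have KL: "K \<in> words" "L \<in> words" using rw l2 by (auto simp: K_L_def simp del: replicate.simps)
    have len: "length K = Suc n" "length L = Suc n" by (simp_all add: K_L_def)
    obtain a where a: "a \<in> F" "aff (u n) a \<in> cyl K" using hit'[OF KL(1) len(1)] by blast
    obtain b where b: "b \<in> F" "aff (u n) b \<in> cyl L" using hit'[OF KL(2) len(2)] by blast
    have "cyl K \<subseteq> cyl [1]" "cyl L \<subseteq> cyl [2]"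
      using cyl_append_subset[of "[1]" "replicate n 1"] cyl_append_subset[of "[2]" "replicate n 2"] l2 rw
      by (auto simp: K_L_def)
    then have "gap \<le> dist (aff (u n) a) (aff (u n) b)"
      using gap(2)[of 1 2] l2 a b by (auto simp: subset_iff)
    also have "\<dots> \<le> N * (ratio (I n) * dist a b) / ratio (J n)"
      unfolding du using NL[of "\<phi> (I n) a" "\<phi> (I n) b"] rp JI by (simp add: dist_phi divide_right_mono less_imp_le)
    also have "\<dots> \<le> N * (ratio (I n) * diam) / ratio (J n)"
      using diam(2)[OF a(1) b(1)] N rp by (intro divide_right_mono mult_left_mono) (auto simp: less_imp_le)
    finally have "c0 * ratio (J n) \<le> c * ratio (I n)"
      using rp[of n] N diam(1) c by (simp add: c0_def field_simps)
    then have "c0 * ratio (J n) * dist x y \<le> c * ratio (I n) * dist x y" by (intro mult_right_mono) auto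
    also have "\<dots> \<le> dist (aff p (\<phi> (I n) x)) (aff p (\<phi> (I n) y))"
      using expandsD[OF ex, of "\<phi> (I n) x" "\<phi> (I n) y"] JI by (simp add: dist_phi mult.assoc)
    finally show "c0 * dist x y \<le> dist (aff (u n) x) (aff (u n) y)"
      unfolding du using rp[of n] by (simp add: field_simps)
  qed
  obtain B where B: "B > 0" "\<And>z p q. z \<in> F \<Longrightarrow> dist (aff p z) (aff q z) \<le> B * dist p q"
    using aff_close by blast
  obtain S where S: "S > 0" "\<And>p c. (\<And>z. z \<in> F \<Longrightarrow> norm (aff p z) \<le> c) \<Longrightarrow> norm p \<le> S * c"
    using aff_norm_bound by blast
  obtain R where R: "\<And>z. z \<in> F \<Longrightarrow> norm z \<le> R"
    using compact_imp_bounded[OF compact_F] unfolding bounded_iff by blast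
  have bnd: "norm (u n) \<le> S * (R + N * K0 * diam)" for n
  proof (rule S(2))
    fix z assume z: "z \<in> F"
    have "replicate (Suc n) 1 \<in> words" using l2 by (induction n) auto
    then obtain a where a: "a \<in> F" "aff (u n) a \<in> F"
      using hit'[of "replicate (Suc n) 1" n] cyl_subset_F by (auto simp del: replicate.simps)
    have "norm (aff (u n) z) \<le> norm (aff (u n) a) + dist (aff (u n) a) (aff (u n) z)"
      using norm_triangle_sub[of "aff (u n) z" "aff (u n) a"] by (simp add: dist_norm norm_minus_commute)
    also have "\<dots> \<le> R + N * K0 * dist a z" using R[OF a(2)] upper by (intro add_mono) auto
    also have "\<dots> \<le> R + N * K0 * diam"
      using diam(2)[OF a(1) z] N K0p by (intro add_left_mono mult_left_mono) auto
    finally show "norm (aff (u n) z) \<le> R + N * K0 * diam" .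
  qed
  have "compact (cball (0 :: (real^2^2) \<times> pt) (S * (R + N * K0 * diam)))" by (rule compact_cball)
  then obtain U \<sigma> where \<sigma>: "strict_mono \<sigma>" "(u \<circ> \<sigma>) \<longlonglongrightarrow> U"
    unfolding compact_def using bnd by (metis (no_types, lifting) dist_0_norm mem_cball)
  define v where "v k = u (\<sigma> k)" for k
  have vU: "v \<longlonglongrightarrow> U" using \<sigma>(2) unfolding v_def[abs_def] comp_def .
  have lim: "(\<lambda>k. aff (v k) z) \<longlonglongrightarrow> aff U z" for z
    using bounded_linear.tendsto[OF linear_conv_bounded_linear[THEN iffD1, OF linear_aff[of z]] vU] .
  have exU: "expands c0 (aff U)"
    unfolding expands_def
  proof (intro allI)
    fix x y
    have "(\<lambda>k. dist (aff (v k) x) (aff (v k) y)) \<longlonglongrightarrow> dist (aff U x) (aff U y)"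
      by (intro tendsto_dist lim)
    then show "c0 * dist x y \<le> dist (aff U x) (aff U y)"
      using lower expandsD by (intro LIMSEQ_le_const) (auto simp: v_def)
  qed
  have dvU: "(\<lambda>k. B * dist (v k) U) \<longlonglongrightarrow> 0"
    using tendsto_mult[OF tendsto_const[of B] tendsto_dist[OF vU tendsto_const[of U]]] by simp
  have contU: "continuous_on X (aff U)" for X
    unfolding aff_def by (intro continuous_intros matrix_vector_mult_linear_continuous_on)
  \<comment> \<open>Each point of \<open>F\<close> lies in a cylinder of depth
    \<open>Suc (\<sigma> k)\<close> that the image of \<open>v k\<close> meets. The depth tends to
    infinity and \<open>v k\<close> converges uniformly on \<open>F\<close>, so the point is in the
    closure of the compact image of \<open>U\<close>.\<close>
  have FU: "F \<subseteq> aff U ` F"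
  proof
    fix x assume x: "x \<in> F"
    have "x \<in> closure (aff U ` F)"
      unfolding closure_approachable
    proof (intro allI impI)
      fix e :: real assume e: "0 < e"
      obtain M where M: "\<forall>n\<ge>M. \<forall>J\<in>words. length J = n \<longrightarrow> ratio J * diam < e / 2"
        using small_ratio[of "e / 2"] e by auto
      have "eventually (\<lambda>k. B * dist (v k) U < e / 2) sequentially"
        using order_tendstoD(2)[OF dvU, of "e / 2"] e by simp
      then obtain k0 where k0: "\<And>k. k \<ge> k0 \<Longrightarrow> B * dist (v k) U < e / 2"
        by (auto simp: eventually_sequentially)
      define k where "k = max k0 M"
      have "\<sigma> k \<ge> k" using \<sigma>(1) by (rule strict_mono_imp_increasing)
      then have "Suc (\<sigma> k) \<ge> M" by (simp add: k_def)
      obtain K where K: "K \<in> words" "length K = Suc (\<sigma> k)" "x \<in> cyl K"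
        using cyl_exists[of "[]" x "Suc (\<sigma> k)"] x by auto
      obtain z where z: "z \<in> F" "aff (v k) z \<in> cyl K" using hit'[OF K(1,2)] by (auto simp: v_def)
      have "dist (aff (v k) z) x < e / 2"
        using dist_cyl_less[OF K(1) z(2) K(3)] M \<open>Suc (\<sigma> k) \<ge> M\<close> K by force
      moreover have "dist (aff (v k) z) (aff U z) < e / 2"
        using B(2)[OF z(1), of "v k" U] k0[of k] by (simp add: k_def)
      ultimately have "dist (aff U z) x < e"
        using dist_triangle2[of "aff U z" x "aff (v k) z"] by (simp add: dist_commute)
      then show "\<exists>y\<in>aff U ` F. dist y x < e" using z by blast
    qed
    then show "x \<in> aff U ` F"
      using compact_continuous_image[OF contU compact_F] by (simp add: compact_imp_closed closure_closed)
  qed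
  obtain x0 where x0: "x0 \<in> F" using F_nonempty by blast
  then obtain z0 where z0: "z0 \<in> F" "aff U z0 = x0" using FU by blast
  define NU where "NU = norm (fst U) + 1"
  have NU: "NU > 0" by (simp add: NU_def add_nonneg_pos)
  have NUL: "dist (aff U x) (aff U y) \<le> NU * dist x y" for x y
    unfolding NU_def by (rule aff_lipschitz_pos)
  \<comment> \<open>On all of \<open>F\<close> the blow-ups need not take values in
    \<open>F\<close>, as the image of \<open>p\<close> may leave \<open>cyl (J n)\<close>. On
    \<open>cyl I'\<close>, which \<open>U\<close> maps close to \<open>x0\<close>, the later ones do
    by \<open>near_cyl'\<close>; therefore \<open>\<phi> I'\<close> is precomposed below.\<close>
  obtain I' where I': "I' \<in> words" "z0 \<in> cyl I'" "ratio I' * diam < gap / (2 * NU)"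
    using small_cyl[OF z0(1), of "gap / (2 * NU)"] gap(1) NU by auto
  have near: "dist (aff U z) x0 < gap / 2" if z: "z \<in> cyl I'" for z
  proof -
    have "dist (aff U z) (aff U z0) \<le> NU * dist z z0" by (rule NUL)
    also have "\<dots> < NU * (gap / (2 * NU))"
      using dist_cyl_less[OF I'(1) z I'(2)] I'(3) NU by (intro mult_strict_left_mono) auto
    finally show ?thesis using NU z0 by simp
  qed
  have "eventually (\<lambda>k. B * dist (v k) U < gap / 2) sequentially"
    using order_tendstoD(2)[OF dvU, of "gap / 2"] gap(1) by simp
  then obtain k0 where k0: "\<And>k. k \<ge> k0 \<Longrightarrow> B * dist (v k) U < gap / 2"
    by (auto simp: eventually_sequentially)
  have vF: "aff (v k) z \<in> F" if "k \<ge> k0" "z \<in> cyl I'" for k z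
  proof -
    have zF: "z \<in> F" using that cyl_subset_F[OF I'(1)] by blast
    have "dist (aff (v k) z) x0 < gap"
      using B(2)[OF zF, of "v k" U] k0[OF that(1)] near[OF that(2)] dist_triangle[of "aff (v k) z" x0 "aff U z"] by simp
    then have "dist (\<phi> (J (\<sigma> k)) x0) (\<phi> (J (\<sigma> k)) (aff (v k) z)) < gap * ratio (J (\<sigma> k))"
      using JI rp[of "\<sigma> k"] by (simp add: dist_phi dist_commute)
    moreover have "\<phi> (J (\<sigma> k)) (aff (v k) z) \<in> F"
      unfolding v_def u using JI pF phi_in_F[of "I (\<sigma> k)" z] zF by auto
    ultimately have "\<phi> (J (\<sigma> k)) (aff (v k) z) \<in> cyl (J (\<sigma> k))"
      using near_cyl'[of "J (\<sigma> k)" "\<phi> (J (\<sigma> k)) x0"] JI phi_in_cyl_iff x0 by blast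
    then show ?thesis using phi_in_cyl_iff JI by blast
  qed
  have "\<exists>w. aff w = aff q \<circ> \<phi> I'" for q
    using conj_aff[of "[]" q I'] phinv_phi[of "[]"] by (metis aff_comp phi_aff)
  then obtain comp where cp: "\<And>q. aff (comp q) = aff q \<circ> \<phi> I'" by metis
  have conv: "(\<lambda>k. comp (v k)) \<longlonglongrightarrow> comp U"
  proof (rule LIM_zero_cancel, rule tendsto_norm_zero_cancel,
      rule tendsto_sandwich[of "\<lambda>_. 0"])
    have "norm (comp (v k) - comp U) \<le> S * (B * dist (v k) U)" for k
    proof (rule S(2))
      fix z assume "z \<in> F"
      then have "\<phi> I' z \<in> F" using I' phi_in_F by blast
      then show "norm (aff (comp (v k) - comp U) z) \<le> B * dist (v k) U"
        using B(2)[of "\<phi> I' z" "v k" U] by (simp add: aff_minus cp dist_norm)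
    qed
    then show "eventually (\<lambda>k. norm (comp (v k) - comp U) \<le> S * (B * dist (v k) U)) sequentially" by simp
    show "(\<lambda>k. S * (B * dist (v k) U)) \<longlonglongrightarrow> 0"
      using tendsto_mult[OF tendsto_const[of S] dvU] by simp
  qed auto
  have wF: "aff (comp (v k)) ` F \<subseteq> F" if "k \<ge> k0" for k
    using vF[OF that] by (auto simp: cp cyl_def)
  have HF: "aff (comp U) ` F \<subseteq> F"
  proof
    fix y assume "y \<in> aff (comp U) ` F"
    then obtain z where z: "z \<in> F" "y = aff U (\<phi> I' z)" by (auto simp: cp)
    show "y \<in> F" unfolding z(2)
    proof (rule Lim_in_closed_set[OF compact_imp_closed[OF compact_F] _ _ lim])
      show "eventually (\<lambda>k. aff (v k) (\<phi> I' z) \<in> F) sequentially"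
        using vF z by (auto simp: eventually_sequentially cyl_def)
    qed simp
  qed
  have exH: "expands (c0 * ratio I') (aff (comp U))"
    unfolding expands_def cp
    using expandsD[OF exU] by (simp add: mult.assoc dist_phi[OF I'(1), symmetric])
  have c0r: "c0 * ratio I' > 0" using c0 ratio_pos I' by simp
  obtain K where K: "K \<in> words" "x0 \<in> cyl K" "ratio K * diam < c0 * (gap * ratio I')"
    using small_cyl[OF x0, of "c0 * (gap * ratio I')"] c0 gap(1) ratio_pos[OF I'(1)] by auto
  \<comment> \<open>Points of \<open>F\<close> close to \<open>x0\<close> have their
    \<open>U\<close>-preimages close to \<open>z0\<close> by expansion, hence inside
    \<open>cyl I'\<close>.\<close>
  have KH: "cyl K \<subseteq> aff (comp U) ` F"
  proof
    fix y assume y: "y \<in> cyl K"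
    then have "y \<in> F" using cyl_subset_F K by blast
    then obtain z where z: "z \<in> F" "y = aff U z" using FU by blast
    have "c0 * dist z0 z \<le> dist x0 y" using expandsD[OF exU, of z0 z] z z0 by simp
    also have "\<dots> < c0 * (gap * ratio I')" using dist_cyl_less[OF K(1) K(2) y] K(3) by simp
    finally have "dist z0 z < gap * ratio I'" using c0 by simp
    then have "z \<in> cyl I'" using near_cyl'[OF I'(1,2) z(1)] by blast
    then obtain z' where "z' \<in> F" "z = \<phi> I' z'" by (auto simp: cyl_def)
    then show "y \<in> aff (comp U) ` F" using z by (auto simp: cp)
  qed
  obtain e where e: "e > 0" "\<And>q. aff q ` F \<subseteq> F \<Longrightarrow> dist q (comp U) < e \<Longrightarrow> q = comp U"
    using isolated_of_open_image[OF HF exH c0r K(1) KH] by blast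
  obtain k1 where k1: "\<And>k. k \<ge> k1 \<Longrightarrow> dist (comp (v k)) (comp U) < e"
    using conv e(1) by (metis lim_sequentially)
  define k where "k = max k0 k1"
  have eq: "comp (v k) = comp U" by (rule e(2)) (use wF k1 in \<open>auto simp: k_def\<close>)
  define Jk where "Jk = J (\<sigma> k)"
  have Jk: "Jk \<in> words" using JI by (simp add: Jk_def)
  have "cyl (Jk @ K) \<subseteq> aff p ` F"
  proof
    fix y assume "y \<in> cyl (Jk @ K)"
    then obtain x where x: "x \<in> cyl K" "y = \<phi> Jk x" by (auto simp: cyl_append)
    then obtain z where z: "z \<in> F" "x = aff (comp (v k)) z" using KH eq by auto
    then have "x = phinv Jk (aff p (\<phi> (I (\<sigma> k)) (\<phi> I' z)))"
      by (simp add: cp v_def u Jk_def)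
    then have "y = aff p (\<phi> (I (\<sigma> k)) (\<phi> I' z))" using x Jk by simp
    then show "y \<in> aff p ` F" using phi_in_F[OF I'(1) z(1)] phi_in_F JI(2) by blast
  qed
  then show ?thesis using that[of "Jk @ K"] Jk K by simp
qed

text \<open>By \<open>aff_norm_bound\<close> these maps have bounded coefficients, so infinitely
  many of them would accumulate. The limit is again an embedding with expansion constant
  \<open>c\<close>; by \<open>open_image\<close> and \<open>isolated_of_open_image\<close> it is
  isolated, a contradiction.\<close>

lemma finite_embeddings:
  assumes c: "c > 0"
  shows "finite {p. aff p ` F \<subseteq> F \<and> expands c (aff p)}" (is "finite ?S")
proof (rule ccontr)
  assume inf: "infinite ?S"
  obtain S where S: "S > 0" "\<And>p c. (\<And>z. z \<in> F \<Longrightarrow> norm (aff p z) \<le> c) \<Longrightarrow> norm p \<le> S * c"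
    using aff_norm_bound by blast
  obtain R where R: "\<And>z. z \<in> F \<Longrightarrow> norm z \<le> R"
    using compact_imp_bounded[OF compact_F] unfolding bounded_iff by blast
  have "p \<in> cball 0 (S * R)" if "p \<in> ?S" for p
  proof -
    have "norm p \<le> S * R" using that R by (intro S(2)) auto
    then show ?thesis by simp
  qed
  then have "?S \<subseteq> cball 0 (S * R)" by blast
  then obtain p where p: "p islimpt ?S"
    using Heine_Borel_imp_Bolzano_Weierstrass[OF compact_cball inf] by blast
  obtain f where f: "\<And>n. f n \<in> ?S" "f \<longlonglongrightarrow> p"
    using p unfolding islimpt_sequential by blast
  have lim: "(\<lambda>n. aff (f n) z) \<longlonglongrightarrow> aff p z" for z
    using bounded_linear.tendsto[OF linear_conv_bounded_linear[THEN iffD1, OF linear_aff[of z]] f(2)] .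
  have pF: "aff p ` F \<subseteq> F"
  proof
    fix y assume "y \<in> aff p ` F"
    then obtain z where z: "z \<in> F" "y = aff p z" by blast
    show "y \<in> F" unfolding z(2)
      by (rule Lim_in_closed_set[OF compact_imp_closed[OF compact_F] _ _ lim])
        (use f(1) z in \<open>auto intro!: always_eventually\<close>)
  qed
  have ex: "expands c (aff p)"
    unfolding expands_def
  proof (intro allI)
    fix x y
    have "(\<lambda>k. dist (aff (f k) x) (aff (f k) y)) \<longlonglongrightarrow> dist (aff p x) (aff p y)"
      by (intro tendsto_dist lim)
    then show "c * dist x y \<le> dist (aff p x) (aff p y)"
      using f(1) expandsD by (intro LIMSEQ_le_const) auto
  qed
  obtain J where J: "J \<in> words" "cyl J \<subseteq> aff p ` F" using open_image[OF pF ex c] by blast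
  obtain e where e: "e > 0" "\<And>q. aff q ` F \<subseteq> F \<Longrightarrow> dist q p < e \<Longrightarrow> q = p"
    using isolated_of_open_image[OF pF ex c J] by blast
  obtain q where "q \<in> ?S" "q \<noteq> p" "dist q p < e" using p e(1) unfolding islimpt_approachable by blast
  then show False using e(2) by blast
qed

section \<open>Infinite rotation groups\<close>

text \<open>The image is enclosed in a cylinder of comparable size, which is then blown up to
  \<open>F\<close>. The resulting expansion constant depends only on the distortion
  \<open>m / M\<close> of the map and not on its size.\<close>

lemma normalize_embedding:
  assumes pF: "aff p ` F \<subseteq> F" and M: "M > 0" "\<And>x y. dist (aff p x) (aff p y) \<le> M * dist x y"
    and m: "m > 0" "expands m (aff p)"
  obtains J q where "J \<in> words" "aff q = phinv J \<circ> aff p" "aff q ` F \<subseteq> F"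
    "expands (m * gap / (M * diam)) (aff q)"
proof -
  have "dist x y \<le> M * diam" if xy: "x \<in> aff p ` F" "y \<in> aff p ` F" for x y
  proof -
    obtain a b where ab: "a \<in> F" "b \<in> F" "x = aff p a" "y = aff p b" using xy by blast
    have "dist x y \<le> M * dist a b" using M(2) ab by simp
    also have "\<dots> \<le> M * diam" using diam(2)[OF ab(1,2)] M(1) by simp
    finally show ?thesis .
  qed
  then obtain J where J: "J \<in> words" "aff p ` F \<subseteq> cyl J" "gap * ratio J \<le> M * diam"
    using cyl_cover[of "aff p ` F" "M * diam"] pF M(1) diam(1) by (metis mult_pos_pos)
  obtain q where q: "aff q = phinv J \<circ> aff p"
    using conj_aff[OF J(1), of p "[]"] by auto
  have "aff q ` F \<subseteq> F"
  proof
    fix y assume "y \<in> aff q ` F"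
    then obtain z where z: "z \<in> F" "y = phinv J (aff p z)" using q by auto
    then obtain w where w: "w \<in> F" "aff p z = \<phi> J w" using J(2) by (force simp: cyl_def)
    have "y = w" using z(2) w(2) J(1) by simp
    then show "y \<in> F" using w by simp
  qed
  moreover have "expands (m * gap / (M * diam)) (aff q)"
    unfolding expands_def
  proof (intro allI)
    fix x y :: pt
    have "m * gap / (M * diam) \<le> m / ratio J"
      using J(3) m(1) M(1) diam(1) ratio_pos[OF J(1)] by (simp add: field_simps)
    then have "m * gap / (M * diam) * dist x y \<le> m / ratio J * dist x y" by (intro mult_right_mono) auto
    also have "\<dots> \<le> dist (aff p x) (aff p y) / ratio J"
      using expandsD[OF m(2), of x y] ratio_pos[OF J(1)] by (simp add: divide_right_mono)
    also have "\<dots> = dist (aff q x) (aff q y)" using q J(1) by (simp add: dist_phinv)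
    finally show "m * gap / (M * diam) * dist x y \<le> dist (aff q x) (aff q y)" .
  qed
  ultimately show ?thesis using that J q by blast
qed

text \<open>Powers of uniformly bounded distortion normalize into the finite set of
  \<open>finite_embeddings\<close>. Two of them therefore agree: \<open>phinv (J n)\<close> after
  the \<open>n\<close>-th power equals \<open>phinv (J m)\<close> after the \<open>m\<close>-th
  power, and cancelling the common factor leaves the relation for the exponent
  \<open>m - n\<close>.\<close>

lemma conformal_power:
  assumes pF: "aff p ` F \<subseteq> F" and \<kappa>: "\<kappa> > 0"
    and conf: "\<And>n. \<exists>M>0. (\<forall>x y. dist ((aff p ^^ n) x) ((aff p ^^ n) y) \<le> M * dist x y) \<and> expands (\<kappa> * M) (aff p ^^ n)"
  shows "\<exists>k\<ge>1. \<exists>I\<in>words. \<exists>J\<in>words. (aff p ^^ k) \<circ> \<phi> I = \<phi> J"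
proof -
  have pn: "\<exists>q. aff p ^^ n = aff q" for n
  proof (induction n)
    case 0
    have "aff p ^^ 0 = aff (mat 1, 0)" by (auto simp: aff_def)
    then show ?case by blast
  next
    case (Suc n)
    then show ?case using aff_comp[of p] by (metis funpow.simps(2))
  qed
  have pnF: "(aff p ^^ n) ` F \<subseteq> F" for n
    using pF by (induction n) auto
  define c where "c = \<kappa> * gap / diam"
  have c: "c > 0" using \<kappa> gap(1) diam(1) by (simp add: c_def)
  have "\<exists>J q. J \<in> words \<and> aff p ^^ n = \<phi> J \<circ> aff q \<and> aff q ` F \<subseteq> F \<and> expands c (aff q)" for n
  proof -
    obtain M where M: "M > 0" "\<And>x y. dist ((aff p ^^ n) x) ((aff p ^^ n) y) \<le> M * dist x y"
      "expands (\<kappa> * M) (aff p ^^ n)" using conf by blast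
    obtain u where u: "aff p ^^ n = aff u" using pn by blast
    obtain J q where J: "J \<in> words" "aff q = phinv J \<circ> aff u" "aff q ` F \<subseteq> F"
        "expands (\<kappa> * M * gap / (M * diam)) (aff q)"
      using normalize_embedding[of u M "\<kappa> * M"] M \<kappa> pnF[of n] unfolding u by auto
    moreover have "\<kappa> * M * gap / (M * diam) = c" using M(1) by (simp add: c_def)
    moreover have "aff u = \<phi> J \<circ> aff q" using J(1,2) by (auto simp: fun_eq_iff)
    ultimately show ?thesis unfolding u by (intro exI[of _ J] exI[of _ q] conjI) simp_all
  qed
  then obtain J q where Jq: "\<And>n. J n \<in> words" "\<And>n. aff p ^^ n = \<phi> (J n) \<circ> aff (q n)"
    "\<And>n. aff (q n) ` F \<subseteq> F" "\<And>n. expands c (aff (q n))" by metis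
  have "range q \<subseteq> {p. aff p ` F \<subseteq> F \<and> expands c (aff p)}" using Jq(3,4) by blast
  then have "finite (range q)" using finite_embeddings[OF c] finite_subset by blast
  then have "\<not> inj q" using finite_imageD infinite_UNIV_nat by blast
  then obtain n m where nm: "n < m" "q n = q m"
    unfolding inj_def by (metis linorder_neqE_nat)
  obtain u where u: "aff (q n) \<circ> aff u = id" using aff_left_inverse[OF Jq(4) c] by metis
  have u': "aff (q n) (aff u z) = z" for z using fun_cong[OF u, of z] by simp
  have "(aff p ^^ (m - n)) (\<phi> (J n) z) = \<phi> (J m) z" for z
  proof -
    have "\<phi> (J n) z = (aff p ^^ n) (aff u z)" unfolding Jq(2) by (simp add: u')
    then have "(aff p ^^ (m - n)) (\<phi> (J n) z) = ((aff p ^^ (m - n)) \<circ> (aff p ^^ n)) (aff u z)" by simp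
    also have "(aff p ^^ (m - n)) \<circ> (aff p ^^ n) = aff p ^^ m"
      using nm by (simp add: funpow_add[symmetric])
    also have "(aff p ^^ m) (aff u z) = \<phi> (J m) z"
      unfolding Jq(2) nm(2)[symmetric] by (simp add: u')
    finally show ?thesis .
  qed
  then show ?thesis using nm Jq(1) by (intro exI[of _ "m - n"] conjI bexI[of _ "J n"] bexI[of _ "J m"]) auto
qed

section \<open>Orthogonal parts along words and the Gram matrix\<close>

text \<open>The linear part with the signed product of the \<open>r i\<close> removed; these numbers
  may be negative, so dividing \<open>lin J\<close> by \<open>ratio J\<close> could leave a matrix
  outside the generated group.\<close>

definition orth :: "nat list \<Rightarrow> real^2^2" where
  "orth J = foldr (\<lambda>i M. Q i ** M) J (mat 1)"

lemma orth_Nil [simp]: "orth [] = mat 1"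
  and orth_Cons: "orth (i # J) = Q i ** orth J"
  by (simp_all add: orth_def)

lemma orth_append: "orth (I @ J) = orth I ** orth J"
  by (induction I) (auto simp: orth_Cons matrix_mul_assoc)

lemma orthogonal_orth: "J \<in> words \<Longrightarrow> orthogonal_matrix (orth J)"
  by (induction J) (use contr in \<open>auto simp: orth_Cons orthogonal_matrix_id intro!: orthogonal_matrix_mul\<close>)

lemma orth_gen_group: "J \<in> words \<Longrightarrow> orth J \<in> gen_group (Q ` {1..l})"
  by (induction J) (auto simp: orth_Cons intro: gen_group.intros)

lemma lin_orth: "lin J = (\<Prod>i\<leftarrow>J. r i) *\<^sub>R orth J"
  by (induction J) (auto simp: orth_Cons lin_Cons scalar_matrix_assoc[symmetric] matrix_scalar_ac)

lemma prod_list_ratio: "\<bar>\<Prod>i\<leftarrow>J. r i\<bar> = ratio J"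
  by (induction J) (auto simp: ratio_Cons abs_mult)

lemma transpose_lin_lin: "J \<in> words \<Longrightarrow> transpose (lin J) ** lin J = mat ((ratio J)\<^sup>2)"
proof -
  assume "J \<in> words"
  then have "transpose (orth J) ** orth J = mat 1" using orthogonal_orth by (simp add: orthogonal_matrix)
  moreover have "(\<Prod>i\<leftarrow>J. r i)\<^sup>2 = (ratio J)\<^sup>2" by (simp add: prod_list_ratio[symmetric])
  ultimately show ?thesis
    by (simp add: lin_orth transpose_scalar scalar_matrix_assoc[symmetric] matrix_scalar_ac mat_def power2_eq_square
       vec_eq_iff)
qed

text \<open>The zoomed versions of \<open>aff p \<circ> \<phi> I\<close> form a finite set, and up
  to scalars their Gram matrices are the conjugates of \<open>P\<close> by the orthogonal parts.
  Hence \<open>P\<close> has a finite orbit under the generated group. If \<open>P\<close> were not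
  scalar, \<open>finite_orthogonal_stabilizer\<close> would make the group finite.\<close>

lemma conformal_if_infinite_group:
  assumes pF: "aff p ` F \<subseteq> F" and c: "c > 0" "expands c (aff p)"
    and inf: "infinite (gen_group (Q ` {1..l}))"
  shows "\<exists>a>0. transpose (fst p) ** fst p = mat a"
proof -
  define A where "A = fst p"
  define P where "P = transpose A ** A"
  define N where "N = norm A + 1"
  have N: "N > 0" by (simp add: N_def add_nonneg_pos)
  have NL: "dist (aff p x) (aff p y) \<le> N * dist x y" for x y
    unfolding N_def A_def by (rule aff_lipschitz_pos)
  \<comment> \<open>In the constant of \<open>normalize_embedding\<close> the factor
    \<open>ratio I\<close> cancels, so one finite set \<open>S\<close> serves all words
    \<open>I\<close>.\<close>
  define c1 where "c1 = c * gap / (N * diam)"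
  have c1: "c1 > 0" using c gap(1) N diam(1) by (simp add: c1_def)
  define S where "S = {q. aff q ` F \<subseteq> F \<and> expands c1 (aff q)}"
  have finS: "finite S" unfolding S_def by (rule finite_embeddings[OF c1])
  define X where "X q = transpose (fst q) ** fst q" for q :: "(real^2^2) \<times> pt"
  define orbit where "orbit = {transpose (orth I) ** P ** orth I | I. I \<in> words}"
  have trP: "trace P > 0"
  proof -
    have tr: "trace P = (\<Sum>i\<in>UNIV. \<Sum>k\<in>UNIV. (A $ k $ i)\<^sup>2)"
      by (simp add: P_def trace_def matrix_matrix_mult_def transpose_def power2_eq_square)
    have "A \<noteq> 0"
    proof
      assume "A = 0"
      then have "c * dist (0::pt) (vector [1, 0]) \<le> 0"
        using expandsD[OF c(2), of 0 "vector [1, 0]"] by (simp add: aff_def A_def)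
      then have "(0::pt) = vector [1, 0]" using c(1) by (simp add: mult_le_0_iff)
      from arg_cong[OF this, of "\<lambda>x. x $ 1"] show False by simp
    qed
    then obtain k i where "A $ k $ i \<noteq> 0" by (auto simp: vec_eq_iff)
    then have "0 < (\<Sum>k\<in>UNIV. (A $ k $ i)\<^sup>2)" by (intro sum_pos2[of _ k]) auto
    moreover have "(\<Sum>k\<in>UNIV. (A $ k $ i)\<^sup>2) \<le> (\<Sum>i\<in>UNIV. \<Sum>k\<in>UNIV. (A $ k $ i)\<^sup>2)"
      by (rule member_le_sum[of i UNIV "\<lambda>i. \<Sum>k\<in>UNIV. (A $ k $ i)\<^sup>2"]) (auto intro: sum_nonneg)
    ultimately have "0 < (\<Sum>i\<in>UNIV. \<Sum>k\<in>UNIV. (A $ k $ i)\<^sup>2)"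
      by (rule order_less_le_trans)
    then show ?thesis unfolding tr .
  qed
  \<comment> \<open>The Gram matrix of the zoomed map is a multiple of the conjugate of
    \<open>P\<close>. Conjugation preserves the trace, which determines the multiple.\<close>
  have "orbit \<subseteq> (\<lambda>q. (trace P / trace (X q)) *\<^sub>R X q) ` S"
  proof
    fix Y assume "Y \<in> orbit"
    then obtain I where I: "I \<in> words" "Y = transpose (orth I) ** P ** orth I" by (auto simp: orbit_def)
    obtain pI where pI: "aff pI = aff p \<circ> \<phi> I" "fst pI = A ** lin I"
      using aff_comp[of p "(lin I, \<phi> I 0)"] unfolding phi_aff[symmetric] A_def by auto
    have rI: "ratio I > 0" by (rule ratio_pos[OF I(1)])
    have e1: "aff pI ` F \<subseteq> F" using pF phi_in_F[OF I(1)] by (auto simp: pI)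
    have e2: "dist (aff pI x) (aff pI y) \<le> (N * ratio I) * dist x y" for x y
      using NL[of "\<phi> I x" "\<phi> I y"] by (simp add: pI dist_phi[OF I(1)])
    have e3: "expands (c * ratio I) (aff pI)"
      unfolding expands_def pI using expandsD[OF c(2)] by (simp add: mult.assoc dist_phi[OF I(1), symmetric])
    obtain J q where J: "J \<in> words" "aff q = phinv J \<circ> aff pI" "aff q ` F \<subseteq> F"
        "expands (c * ratio I * gap / (N * ratio I * diam)) (aff q)"
      by (rule normalize_embedding[OF e1 mult_pos_pos[OF N rI] e2 mult_pos_pos[OF c(1) rI] e3])
    moreover have "c * ratio I * gap / (N * ratio I * diam) = c1" using rI by (simp add: c1_def)
    ultimately have qS: "q \<in> S" by (simp add: S_def)
    have rJ: "ratio J > 0" by (rule ratio_pos[OF J(1)])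
    obtain w where w: "aff w = \<phi> J \<circ> aff q" "fst w = lin J ** fst q"
      using aff_comp[of "(lin J, \<phi> J 0)" q] unfolding phi_aff[symmetric] by auto
    have "aff w = aff pI" unfolding w J(2) using J(1) by (auto simp: fun_eq_iff)
    then have eq: "lin J ** fst q = A ** lin I" using aff_eq_iff w(2) pI(2) by metis
    have "transpose (lin J ** fst q) ** (lin J ** fst q) = transpose (fst q) ** (transpose (lin J) ** lin J) ** fst q"
      by (simp add: matrix_transpose_mul matrix_mul_assoc)
    also have "\<dots> = (ratio J)\<^sup>2 *\<^sub>R X q"
      unfolding transpose_lin_lin[OF J(1)] X_def
      by (simp add: vec_eq_iff matrix_matrix_mult_def mat_def transpose_def sum_2 forall_2 algebra_simps)
    finally have 1: "transpose (lin J ** fst q) ** (lin J ** fst q) = (ratio J)\<^sup>2 *\<^sub>R X q" .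
    have "transpose (A ** lin I) ** (A ** lin I) = transpose (lin I) ** P ** lin I"
      by (simp add: matrix_transpose_mul matrix_mul_assoc P_def)
    also have "\<dots> = (ratio I)\<^sup>2 *\<^sub>R Y"
      unfolding I(2) prod_list_ratio[symmetric] power2_abs
      by (simp add: lin_orth transpose_scalar scalar_matrix_assoc[symmetric] matrix_scalar_ac power2_eq_square)
    finally have "(ratio I)\<^sup>2 *\<^sub>R Y = (ratio J)\<^sup>2 *\<^sub>R X q" using 1 eq by simp
    then have "(1 / (ratio I)\<^sup>2) *\<^sub>R ((ratio I)\<^sup>2 *\<^sub>R Y) = (1 / (ratio I)\<^sup>2) *\<^sub>R ((ratio J)\<^sup>2 *\<^sub>R X q)" by simp
    then have Y: "Y = ((ratio J)\<^sup>2 / (ratio I)\<^sup>2) *\<^sub>R X q" using rI by simp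
    have "trace Y = trace P"
    proof -
      have "trace Y = trace (orth I ** (transpose (orth I) ** P))" unfolding I(2) by (rule trace_mul_sym)
      also have "orth I ** (transpose (orth I) ** P) = P"
        using orthogonal_orth[OF I(1)] by (simp add: matrix_mul_assoc orthogonal_matrix_def)
      finally show ?thesis .
    qed
    moreover have "trace Y = ((ratio J)\<^sup>2 / (ratio I)\<^sup>2) * trace (X q)"
      unfolding Y by (simp add: trace_def sum_distrib_left)
    ultimately have "(ratio J)\<^sup>2 / (ratio I)\<^sup>2 = trace P / trace (X q)" using trP
      by (metis less_irrefl mult_zero_right nonzero_mult_div_cancel_right)
    then show "Y \<in> (\<lambda>q. (trace P / trace (X q)) *\<^sub>R X q) ` S" using Y qS by auto
  qed
  then have fin: "finite orbit" using finS finite_subset by blast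
  define T where "T M Y = transpose M ** Y ** M" for M Y :: "real^2^2"
  have QO: "transpose (Q i) ** Q i = mat 1" "Q i ** transpose (Q i) = mat 1" if "i \<in> {1..l}" for i
    using contr that by (auto simp: orthogonal_matrix_def)
  have T_orbit: "T (Q i) ` orbit \<subseteq> orbit" if i: "i \<in> {1..l}" for i
  proof
    fix Z assume "Z \<in> T (Q i) ` orbit"
    then obtain I where I: "I \<in> words" "Z = T (Q i) (transpose (orth I) ** P ** orth I)" by (auto simp: orbit_def)
    have "Z = transpose (orth (I @ [i])) ** P ** orth (I @ [i])"
      by (simp add: I(2) T_def orth_append orth_Cons matrix_transpose_mul matrix_mul_assoc)
    then show "Z \<in> orbit" using I i unfolding orbit_def by (metis (mono_tags, lifting) mem_Collect_eq words_simps)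
  qed
  have T_back: "T (transpose (Q i)) (T (Q i) Y) = Y" if "i \<in> {1..l}" for i Y
  proof -
    have "T (transpose (Q i)) (T (Q i) Y) = (Q i ** transpose (Q i)) ** Y ** (Q i ** transpose (Q i))"
      by (simp add: T_def matrix_mul_assoc)
    then show ?thesis using QO[OF that] by simp
  qed
  \<comment> \<open>Words give only products of the generators. An injective self-map of a finite
    set is onto, so inverses of generators preserve the orbit as well.\<close>
  have T_surj: "T (Q i) ` orbit = orbit" if "i \<in> {1..l}" for i
    using T_orbit[OF that] fin by (intro endo_inj_surj) (auto intro!: inj_on_inverseI[of _ "T (transpose (Q i))"] T_back[OF that])
  have G: "orthogonal_matrix M \<and> (\<forall>Y\<in>orbit. T M Y \<in> orbit)" if "M \<in> gen_group (Q ` {1..l})" for M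
    using that
  proof induction
    case one
    then show ?case by (simp add: T_def orthogonal_matrix_id transpose_mat)
  next
    case (mult M X)
    then obtain i where i: "i \<in> {1..l}" "X = Q i" by blast
    have "T (X ** M) Y \<in> orbit" if "Y \<in> orbit" for Y
    proof -
      have "T (X ** M) Y = T M (T (Q i) Y)" by (simp add: T_def i matrix_transpose_mul matrix_mul_assoc)
      then show ?thesis using mult T_orbit[OF i(1)] that by auto
    qed
    then show ?case using mult contr i by (auto intro!: orthogonal_matrix_mul)
  next
    case (mult_inv M X)
    then obtain i where i: "i \<in> {1..l}" "X = Q i" by blast
    have inv: "matrix_inv X = transpose (Q i)" unfolding i(2) using QO[OF i(1)] by (intro matrix_inv_eq)
    have "T (matrix_inv X ** M) Y \<in> orbit" if Y: "Y \<in> orbit" for Y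
    proof -
      obtain Z where Z: "Z \<in> orbit" "Y = T (Q i) Z" using T_surj[OF i(1)] Y by blast
      have "T (matrix_inv X ** M) Y = T M (T (transpose (Q i)) Y)"
        by (simp add: T_def inv matrix_transpose_mul matrix_mul_assoc)
      also have "\<dots> = T M Z" unfolding Z(2) T_back[OF i(1)] ..
      finally show ?thesis using mult_inv Z by auto
    qed
    then show ?case using mult_inv contr i inv by (auto intro!: orthogonal_matrix_mul)
  qed
  have Porb: "P \<in> orbit"
    unfolding orbit_def by (rule CollectI, rule exI[of _ "[]"]) (simp add: transpose_mat)
  \<comment> \<open>Sorting group elements by the point of the orbit to which they move
    \<open>P\<close> covers the group by finitely many solution sets.\<close>
  have sub: "gen_group (Q ` {1..l}) \<subseteq> (\<Union>Y\<in>orbit. {M. orthogonal_matrix M \<and> transpose M ** P ** M = Y})"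
    using G Porb unfolding T_def by blast
  have "\<exists>a. P = mat a"
  proof (rule ccontr)
    assume "\<not> ?thesis"
    then have "finite (\<Union>Y\<in>orbit. {M. orthogonal_matrix M \<and> transpose M ** P ** M = Y})"
      using fin by (intro finite_UN_I finite_orthogonal_stabilizer) (auto simp: P_def matrix_transpose_mul)
    then show False using inf sub finite_subset by blast
  qed
  then obtain a where a: "P = mat a" by blast
  have "a > 0" using trP unfolding a by (simp add: trace_def mat_def sum_2)
  then show ?thesis using a by (auto simp: P_def A_def)
qed

text \<open>Dividing the linear part by the square root of \<open>a\<close> makes it orthogonal.
  Powers then scale distances exactly, so \<open>conformal_power\<close> applies without
  distortion.\<close>

lemma similarity_of_conformal:
  assumes pF: "aff p ` F \<subseteq> F" and a: "a > 0" "transpose (fst p) ** fst p = mat a"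
  shows "similarity (aff p)" "\<exists>k\<ge>1. \<exists>I\<in>words. \<exists>J\<in>words. (aff p ^^ k) \<circ> \<phi> I = \<phi> J"
proof -
  define b where "b = sqrt a"
  have b: "b > 0" "b * b = a" using a by (auto simp: b_def)
  define R where "R = (1 / b) *\<^sub>R fst p"
  have "transpose R ** R = (1 / (b * b)) *\<^sub>R mat a"
    by (simp add: R_def transpose_scalar scalar_matrix_assoc[symmetric] matrix_scalar_ac a(2))
  also have "\<dots> = mat 1" using a(1) by (simp add: b mat_def vec_eq_iff)
  finally have R: "orthogonal_matrix R" by (simp add: orthogonal_matrix)
  have pO: "fst p = b *\<^sub>R R" using b by (simp add: R_def)
  show "similarity (aff p)"
    unfolding similarity_def
    by (intro exI[of _ b] exI[of _ R] exI[of _ "snd p"])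
      (use b R in \<open>auto simp: aff_def pO scaleR_matrix_vector_assoc\<close>)
  have "dist (aff p x) (aff p y) = b * dist x y" for x y
    using R b by (simp add: dist_norm aff_diff pO scaleR_matrix_vector_assoc[symmetric])
  then have d: "dist ((aff p ^^ n) x) ((aff p ^^ n) y) = b ^ n * dist x y" for n x y
    by (induction n) auto
  show "\<exists>k\<ge>1. \<exists>I\<in>words. \<exists>J\<in>words. (aff p ^^ k) \<circ> \<phi> I = \<phi> J"
    by (rule conformal_power[OF pF, of 1]) (use b d in \<open>auto simp: expands_def intro!: exI[of _ "b ^ _"]\<close>)
qed

section \<open>Finite rotation groups\<close>

text \<open>Walking along the segment in steps shorter than the gap of a cylinder around
  \<open>y\<close> never leaves this cylinder, by \<open>near_cyl'\<close>. So the segment is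
  shorter than arbitrarily small cylinders.\<close>

lemma segment_not_in_F:
  assumes "\<And>t. 0 \<le> t \<Longrightarrow> t \<le> 1 \<Longrightarrow> y + t *\<^sub>R x \<in> F"
  shows "x = 0"
proof -
  have yF: "y \<in> F" using assms[of 0] by simp
  have "norm x < e" if e: "e > 0" for e
  proof -
    obtain J where J: "J \<in> words" "y \<in> cyl J" "ratio J * diam < e" using small_cyl[OF yF e] by blast
    have g: "0 < gap * ratio J" using gap(1) ratio_pos[OF J(1)] by simp
    obtain N :: nat where N: "norm x / (gap * ratio J) < real N" using reals_Archimedean2 by blast
    have N0: "N > 0"
    proof (rule ccontr)
      assume "\<not> N > 0"
      then have "norm x / (gap * ratio J) < 0" using N by simp
      then show False using g by (simp add: divide_less_0_iff)
    qed
    have "y + (real j / real N) *\<^sub>R x \<in> cyl J" if "j \<le> N" for j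
      using that
    proof (induction j)
      case (Suc j)
      have "dist (y + (real j / real N) *\<^sub>R x) (y + (real (Suc j) / real N) *\<^sub>R x)
          = norm ((real (Suc j) / real N) *\<^sub>R x - (real j / real N) *\<^sub>R x)"
        by (simp add: dist_norm norm_minus_commute)
      also have "\<dots> = norm x / real N"
        unfolding scaleR_diff_left[symmetric] by (simp add: diff_divide_distrib[symmetric])
      also have "\<dots> < gap * ratio J" using N N0 g by (simp add: field_simps)
      finally show ?case
        using near_cyl'[OF J(1) Suc.IH] Suc.prems assms[of "real (Suc j) / real N"] N0 by simp
    qed (use J in simp)
    from this[of N] have "y + x \<in> cyl J" using N0 by simp
    then show ?thesis using dist_cyl_less[OF J(1,2)] J(3) by (fastforce simp: dist_norm)
  qed
  then show ?thesis by (metis less_irrefl zero_less_norm_iff)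
qed

section \<open>Powers of words and periodic addresses\<close>

definition wpow :: "nat \<Rightarrow> nat list \<Rightarrow> nat list" where
  "wpow e J = concat (replicate e J)"

lemma wpow_0 [simp]: "wpow 0 J = []" and wpow_Suc: "wpow (Suc e) J = J @ wpow e J"
  by (simp_all add: wpow_def)

lemma wpow_add: "wpow (a + b) J = wpow a J @ wpow b J"
  by (simp add: wpow_def replicate_add)

lemma wpow_words: "J \<in> words \<Longrightarrow> wpow e J \<in> words"
  by (induction e) (auto simp: wpow_Suc)

lemma length_wpow: "length (wpow e J) = e * length J"
  by (induction e) (auto simp: wpow_Suc)

text \<open>By the pigeonhole principle some positive power of \<open>orth J\<close> is the
  identity, so the linear part of that power of the word is a scalar of unknown sign; squaring makes
  it positive.\<close>

lemma scalar_word_power: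
  assumes fin: "finite (gen_group (Q ` {1..l}))" and J: "J \<in> words"
  shows "\<exists>e\<ge>1. lin (wpow e J) = mat (ratio (wpow e J))"
proof -
  have "range (\<lambda>e. orth (wpow e J)) \<subseteq> gen_group (Q ` {1..l})"
    using orth_gen_group wpow_words[OF J] by blast
  then have "finite (range (\<lambda>e. orth (wpow e J)))" using fin finite_subset by blast
  then have "\<not> inj (\<lambda>e. orth (wpow e J))" using finite_imageD infinite_UNIV_nat by blast
  then obtain a b where ab: "a < b" "orth (wpow a J) = orth (wpow b J)"
    unfolding inj_def by (metis linorder_neqE_nat)
  define d where "d = b - a"
  define T where "T = orth (wpow a J)"
  have T: "transpose T ** T = mat 1"
    using orthogonal_orth[OF wpow_words[OF J]] by (simp add: T_def orthogonal_matrix)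
  have "b = a + d" using ab(1) by (simp add: d_def)
  then have "T = T ** orth (wpow d J)" using ab(2) by (simp add: T_def wpow_add orth_append)
  then have "transpose T ** T = (transpose T ** T) ** orth (wpow d J)" by (metis matrix_mul_assoc)
  then have o: "orth (wpow d J) = mat 1" using T by simp
  define s where "s = (\<Prod>i\<leftarrow>wpow d J. r i)"
  have "lin (wpow d J) = s *\<^sub>R mat 1" unfolding lin_orth o s_def ..
  then have "lin (wpow (d + d) J) = mat (s * s)"
    by (simp add: wpow_add lin_append vec_eq_iff matrix_matrix_mult_def mat_def sum_2 forall_2)
  also have "s * s = ratio (wpow (d + d) J)"
    by (simp add: wpow_add ratio_append prod_list_ratio[symmetric] s_def[symmetric])
  finally show ?thesis using ab(1) by (intro exI[of _ "d + d"]) (auto simp: d_def)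
qed

lemma address_exists:
  assumes x: "x \<in> F"
  obtains P \<omega> where "\<And>k. P k \<in> words" "\<And>k. length (P k) = k" "\<And>k. x \<in> cyl (P k)" "\<And>k. \<omega> k \<in> {1..l}"
    "\<And>k. P (Suc k) = P k @ [\<omega> k]"
proof -
  have "\<exists>P. \<forall>k. (P k \<in> words \<and> length (P k) = k \<and> x \<in> cyl (P k)) \<and> (\<exists>i\<in>{1..l}. P (Suc k) = P k @ [i])"
  proof (rule dependent_nat_choice)
    show "\<exists>J. J \<in> words \<and> length J = 0 \<and> x \<in> cyl J" using x by (intro exI[of _ "[]"]) simp
    show "\<exists>J'. (J' \<in> words \<and> length J' = Suc n \<and> x \<in> cyl J') \<and> (\<exists>i\<in>{1..l}. J' = J @ [i])"
      if J: "J \<in> words \<and> length J = n \<and> x \<in> cyl J" for J n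
    proof -
      obtain i where "i \<in> {1..l}" "x \<in> cyl (J @ [i])" using cyl_split[of J x] J by blast
      then show ?thesis using J by (intro exI[of _ "J @ [i]"] conjI bexI[of _ i]) auto
    qed
  qed
  then show ?thesis using that by metis
qed

text \<open>The state \<open>(h k, \<omega> k)\<close> determines the next state, so finitely many states force an eventually periodic address.\<close>

lemma periodic_fixed_point:
  assumes hom: "\<And>i. i \<in> {1..l} \<Longrightarrow> \<bar>r i\<bar> = lam" and lam: "0 < lam" "lam < 1"
    and pF: "aff p ` F \<subseteq> F" and c: "c > 0" "expands c (aff p)"
    and N: "0 \<le> N" "N < 1" "N * diam < gap" "\<And>x y. dist (aff p x) (aff p y) \<le> N * dist x y"
  obtains x0 y a u where "aff p x0 = x0" "y \<in> F" "a \<in> words" "u \<in> words" "u \<noteq> []" "x0 = \<phi> a y" "\<phi> u y = y"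
    "aff p ` cyl a \<subseteq> cyl a"
proof -
  have "\<exists>!x. x \<in> F \<and> aff p x = x"
    using Banach_fix[of F N "aff p"] compact_imp_complete[OF compact_F] F_nonempty N pF by auto
  then obtain x0 where x0: "x0 \<in> F" "aff p x0 = x0" by blast
  obtain P \<omega> where P: "\<And>k. P k \<in> words" "\<And>k. length (P k) = k" "\<And>k. x0 \<in> cyl (P k)" "\<And>k. \<omega> k \<in> {1..l}"
    "\<And>k. P (Suc k) = P k @ [\<omega> k]" using address_exists[OF x0(1)] by metis
  have \<omega>w: "[\<omega> k] \<in> words" for k using P(4) by simp
  define y where "y k = phinv (P k) x0" for k
  have y: "x0 = \<phi> (P k) (y k)" "y k \<in> F" for k
  proof -
    show x: "x0 = \<phi> (P k) (y k)" using P(1) by (simp add: y_def)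
    show "y k \<in> F" using P(1,3)[of k] phi_in_cyl_iff[of "P k" "y k"] by (simp add: x[symmetric])
  qed
  \<comment> \<open>Because \<open>N * diam < gap\<close>, the image of a cylinder around the fixed
    point lies within the gap on the scale of the next level, so it is contained in the next smaller
    cylinder of the address.\<close>
  have img: "aff p z \<in> cyl (P (Suc k))" if z: "z \<in> cyl (P k)" for z k
    unfolding P(5)
  proof (rule near_cyl[OF P(1,4)])
    show "x0 \<in> cyl (P k @ [\<omega> k])" using P(3)[of "Suc k"] by (simp add: P(5))
    show "aff p z \<in> F" using z cyl_subset_F[OF P(1)] pF by blast
    have "dist x0 (aff p z) \<le> N * dist x0 z" using N(4)[of x0 z] by (simp add: x0)
    also have "\<dots> \<le> N * (ratio (P k) * diam)"
      using dist_cyl_less[OF P(1) P(3) z] N by (intro mult_left_mono) auto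
    also have "\<dots> < gap * ratio (P k)"
      using mult_strict_right_mono[OF N(3) ratio_pos[OF P(1)]] by (simp add: mult_ac)
    finally show "dist x0 (aff p z) < gap * ratio (P k)" .
  qed
  \<comment> \<open>The map \<open>h k\<close> is the embedding as seen between levels
    \<open>k\<close> and \<open>k + 1\<close>. Ratios decrease with the level, so the bound
    \<open>c\<close> is kept and the \<open>h k\<close> range over a finite set.\<close>
  have "\<exists>u. phinv (P (Suc k)) \<circ> aff p \<circ> \<phi> (P k) = aff u" for k using conj_aff[OF P(1)] by blast
  then obtain h where h': "\<And>k. phinv (P (Suc k)) \<circ> aff p \<circ> \<phi> (P k) = aff (h k)" by metis
  have h: "\<phi> (P (Suc k)) (aff (h k) z) = aff p (\<phi> (P k) z)" for k z
    using fun_cong[OF h'[of k], of z] P(1)[of "Suc k"] by (metis o_apply phi_phinv)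
  define S where "S = {q. aff q ` F \<subseteq> F \<and> expands c (aff q)}"
  have hS: "h k \<in> S" for k
  proof -
    have "aff (h k) z \<in> F" if "z \<in> F" for z
    proof -
      have "\<phi> (P (Suc k)) (aff (h k) z) \<in> cyl (P (Suc k))"
        unfolding h using that by (intro img) (simp add: cyl_def)
      then show ?thesis using phi_in_cyl_iff P(1) by blast
    qed
    moreover have "c * dist x z \<le> dist (aff (h k) x) (aff (h k) z)" for x z
    proof -
      have rp: "0 < ratio (P k)" "0 < ratio (P (Suc k))" using ratio_pos P(1) by auto
      have le: "ratio (P (Suc k)) \<le> ratio (P k)"
        using rp hom[OF P(4)] lam by (simp add: P(5) ratio_append ratio_Cons mult_left_le)
      have "ratio (P (Suc k)) * dist (aff (h k) x) (aff (h k) z) = dist (aff p (\<phi> (P k) x)) (aff p (\<phi> (P k) z))"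
        by (simp add: dist_phi[OF P(1), symmetric] h)
      also have "\<dots> \<ge> c * (ratio (P k) * dist x z)"
        using expandsD[OF c(2), of "\<phi> (P k) x" "\<phi> (P k) z"] by (simp add: dist_phi[OF P(1)])
      finally have "c * (ratio (P k) * dist x z) \<le> ratio (P (Suc k)) * dist (aff (h k) x) (aff (h k) z)" .
      moreover have "ratio (P (Suc k)) * (c * dist x z) \<le> ratio (P k) * (c * dist x z)"
        using le c by (intro mult_right_mono) auto
      ultimately have "ratio (P (Suc k)) * (c * dist x z) \<le> ratio (P (Suc k)) * dist (aff (h k) x) (aff (h k) z)"
        by (simp add: mult_ac)
      then show ?thesis using rp by simp
    qed
    ultimately show ?thesis by (auto simp: S_def expands_def)
  qed
  have "finite (S \<times> {1..l})" unfolding S_def using finite_embeddings[OF c(1)] by simp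
  moreover have "range (\<lambda>k. (h k, \<omega> k)) \<subseteq> S \<times> {1..l}" using hS P(4) by blast
  ultimately have "finite (range (\<lambda>k. (h k, \<omega> k)))" using finite_subset by blast
  then have "\<not> inj (\<lambda>k. (h k, \<omega> k))" using finite_imageD infinite_UNIV_nat by blast
  then obtain a b where ab: "a < b" "h a = h b" "\<omega> a = \<omega> b"
    unfolding inj_def by (metis linorder_neqE_nat prod.inject)
  have step: "\<phi> [\<omega> (Suc k)] (aff (h (Suc k)) z) = aff (h k) (\<phi> [\<omega> k] z)" for k z
  proof -
    have "\<phi> (P (Suc k)) (\<phi> [\<omega> (Suc k)] (aff (h (Suc k)) z)) = \<phi> (P (Suc (Suc k))) (aff (h (Suc k)) z)"
      unfolding P(5)[of "Suc k"] phi_append by simp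
    also have "\<dots> = aff p (\<phi> (P (Suc k)) z)" by (rule h)
    also have "\<dots> = aff p (\<phi> (P k) (\<phi> [\<omega> k] z))" unfolding P(5)[of k] phi_append by simp
    also have "\<dots> = \<phi> (P (Suc k)) (aff (h k) (\<phi> [\<omega> k] z))" by (rule h[symmetric])
    finally show ?thesis using phinv_phi[OF P(1)] by metis
  qed
  \<comment> \<open>The right-hand side of \<open>step\<close> depends only on the current state.
    Its values on \<open>F\<close> lie in the first-level cylinder of the next letter, which
    determines that letter; cancelling its map determines the next \<open>h\<close>.\<close>
  have next': "h (Suc i) = h (Suc j) \<and> \<omega> (Suc i) = \<omega> (Suc j)" if "h i = h j" "\<omega> i = \<omega> j" for i j
  proof -
    have eq: "\<phi> [\<omega> (Suc i)] (aff (h (Suc i)) z) = \<phi> [\<omega> (Suc j)] (aff (h (Suc j)) z)" for z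
      unfolding step that ..
    have in_cyl: "\<phi> [\<omega> (Suc k)] (aff (h (Suc k)) (y 0)) \<in> cyl [\<omega> (Suc k)]" for k
      using hS[of "Suc k"] y(2)[of 0] by (auto simp: S_def cyl_def)
    have w: "\<omega> (Suc i) = \<omega> (Suc j)"
    proof (rule ccontr)
      assume "\<omega> (Suc i) \<noteq> \<omega> (Suc j)"
      from gap(2)[OF P(4) P(4) this in_cyl[of i] in_cyl[of j]] show False using gap(1) eq by simp
    qed
    have "aff (h (Suc i)) z = aff (h (Suc j)) z" for z
      using eq[of z] phinv_phi[OF \<omega>w[of "Suc j"]] unfolding w by metis
    then have "aff (h (Suc i)) = aff (h (Suc j))" by (rule ext)
    then show ?thesis using w by (simp add: aff_eq_iff)
  qed
  have per: "h (a + i) = h (b + i) \<and> \<omega> (a + i) = \<omega> (b + i)" for i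
  proof (induction i)
    case (Suc i)
    then show ?case using next'[of "a + i" "b + i"] by simp
  qed (use ab in simp)
  have common: "\<exists>v\<in>words. length v = n \<and> P (a + n) = P a @ v \<and> P (b + n) = P b @ v" for n
  proof (induction n)
    case (Suc n)
    then obtain v where "v \<in> words" "length v = n" "P (a + n) = P a @ v" "P (b + n) = P b @ v" by blast
    moreover have "P (a + Suc n) = P (a + n) @ [\<omega> (b + n)]" "P (b + Suc n) = P (b + n) @ [\<omega> (b + n)]"
      using P(5)[of "a + n"] P(5)[of "b + n"] per[of n] by simp_all
    ultimately show ?case using P(4) by (intro bexI[of _ "v @ [\<omega> (b + n)]"]) simp_all
  qed (auto intro: bexI[of _ "[]"])
  have in_v: "y k \<in> cyl v" if "P m = P k @ v" for k m v
  proof -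
    have "x0 \<in> \<phi> (P k) ` cyl v" using P(3)[of m] by (simp add: that cyl_append)
    then obtain w where "w \<in> cyl v" "x0 = \<phi> (P k) w" by blast
    then show ?thesis using P(1) by (simp add: y_def)
  qed
  \<comment> \<open>From positions \<open>a\<close> and \<open>b\<close> on the letters agree, so
    \<open>y a\<close> and \<open>y b\<close> share cylinders of every depth.\<close>
  have "dist (y a) (y b) < e" if e: "e > 0" for e
  proof -
    obtain M where M: "\<forall>n\<ge>M. \<forall>J\<in>words. length J = n \<longrightarrow> ratio J * diam < e" using small_ratio[OF e] by blast
    obtain v where v: "v \<in> words" "length v = M" "P (a + M) = P a @ v" "P (b + M) = P b @ v" using common by blast
    show ?thesis using dist_cyl_less[OF v(1) in_v[OF v(3)] in_v[OF v(4)]] M v by force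
  qed
  then have yab: "y a = y b" by (metis less_irrefl zero_less_dist_iff)
  have "\<exists>u\<in>words. length u = n \<and> P (a + n) = P a @ u" for n
    using common by blast
  \<comment> \<open>The letters between positions \<open>a\<close> and \<open>b\<close> form the
    period.\<close>
  then obtain u where u: "u \<in> words" "length u = b - a" "P b = P a @ u"
    using ab(1) by (metis le_add_diff_inverse less_imp_le)
  have "\<phi> (P a) (y a) = \<phi> (P a) (\<phi> u (y a))"
    using y(1)[of a] y(1)[of b] yab by (simp add: u(3) phi_append)
  then have "\<phi> u (y a) = y a" using phinv_phi[OF P(1)] by metis
  moreover have "aff p ` cyl (P a) \<subseteq> cyl (P a)"
    using img[of _ a] cyl_append_subset[OF P(1)[of a] \<omega>w[of a]] by (auto simp: P(5))
  ultimately show ?thesis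
    using that[of x0 "y a" "P a" u] x0 y P(1) u ab(1) by fastforce
qed

text \<open>After precomposition with \<open>\<phi> W\<close>, whose linear part is a small scalar,
  the embedding meets the hypotheses of \<open>periodic_fixed_point\<close>, and its eigenvalues are
  merely rescaled. A power of the period acts as a homothety around the fixed point, so the
  enclosing cylinder is a \<open>scaled_germ\<close> and \<open>dominant_eigenvalue\<close> applies.
  The scalars are powers of \<open>lam\<close>, so removing the rescaling shifts the exponent by an
  integer.\<close>

lemma real_eigenvalue:
  assumes hom: "\<And>i. i \<in> {1..l} \<Longrightarrow> \<bar>r i\<bar> = lam" and lam: "0 < lam" "lam < 1"
    and fin: "finite (gen_group (Q ` {1..l}))"
    and pF: "aff p ` F \<subseteq> F" and c: "c > 0" "expands c (aff p)"
    and roots: "\<And>v. fst p *v (fst p *v v) = (\<gamma> + \<gamma>') *\<^sub>R (fst p *v v) - (\<gamma> * \<gamma>') *\<^sub>R v"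
    and nz: "\<gamma> \<noteq> 0" and ns: "fst p \<noteq> mat \<gamma>'" and dom: "\<bar>\<gamma>'\<bar> < \<bar>\<gamma>\<bar> \<or> \<gamma>' = \<gamma>"
  shows "\<gamma>' \<noteq> \<gamma> \<and> (\<exists>n\<ge>1. \<exists>k. \<bar>\<gamma>\<bar> ^ n = lam powi k)"
proof -
  define A where "A = fst p"
  have ratio: "ratio J = lam ^ length J" if "J \<in> words" for J
    using that by (induction J) (auto simp: ratio_Cons hom)
  define N where "N = norm A + 1"
  have N: "N > 0" by (simp add: N_def add_nonneg_pos)
  have NL: "dist (aff p x) (aff p y) \<le> N * dist x y" for x y
    unfolding N_def A_def by (rule aff_lipschitz_pos)
  \<comment> \<open>The two bounds yield the two smallness conditions of
    \<open>periodic_fixed_point\<close>: the contraction constant is below one, and its product with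
    \<open>diam\<close> is below \<open>gap\<close>.\<close>
  define \<epsilon> where "\<epsilon> = min (1 / N) (gap / (N * diam))"
  have \<epsilon>: "\<epsilon> > 0" using N gap(1) diam(1) by (simp add: \<epsilon>_def)
  obtain m where m: "lam ^ m < \<epsilon>" using real_arch_pow_inv[OF \<epsilon> lam(2)] by blast
  have rw: "replicate m 1 \<in> words" using l2 by (induction m) auto
  obtain e where e: "e \<ge> 1" "lin (wpow e (replicate m 1)) = mat (ratio (wpow e (replicate m 1)))"
    using scalar_word_power[OF fin rw] by blast
  define W where "W = wpow e (replicate m 1)"
  define L where "L = length W"
  have W: "W \<in> words" "lin W = mat (lam ^ L)"
    using e wpow_words[OF rw] ratio by (simp_all add: W_def L_def)
  have "lam ^ L \<le> lam ^ m"
    using lam e(1) by (intro power_decreasing) (auto simp: L_def W_def length_wpow)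
  then have Le: "lam ^ L < \<epsilon>" using m by simp
  have L0: "lam ^ L > 0" using lam by simp
  obtain p1 where p1: "aff p1 = aff p \<circ> \<phi> W" "fst p1 = A ** lin W"
    using aff_comp[of p "(lin W, \<phi> W 0)"] unfolding phi_aff[symmetric] A_def by auto
  define A1 where "A1 = fst p1"
  have A1: "A1 *v v = (lam ^ L) *\<^sub>R (A *v v)" for v
    by (simp add: A1_def p1(2) W(2) matrix_vector_mul_assoc[symmetric] mat_mult_vector matrix_vector_mult_scaleR)
  have p1F: "aff p1 ` F \<subseteq> F" using pF phi_in_F[OF W(1)] by (auto simp: p1(1))
  have dW: "dist (\<phi> W x) (\<phi> W y) = lam ^ L * dist x y" for x y
    using dist_phi[OF W(1)] ratio[OF W(1)] by (simp add: L_def)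
  have p1L: "dist (aff p1 x) (aff p1 y) \<le> (N * lam ^ L) * dist x y" for x y
    using NL[of "\<phi> W x" "\<phi> W y"] by (simp add: p1(1) dW)
  have ex1: "expands (c * lam ^ L) (aff p1)"
    unfolding expands_def p1(1) using expandsD[OF c(2)] by (simp add: mult.assoc dW[symmetric])
  have c1: "c * lam ^ L > 0" using c(1) L0 by simp
  have N1: "0 \<le> N * lam ^ L" using N L0 by simp
  have N2: "N * lam ^ L < 1" "N * lam ^ L * diam < gap"
    using Le N diam(1) by (auto simp: \<epsilon>_def field_simps)
  obtain x0 y a u' where fix_: "aff p1 x0 = x0" "y \<in> F" "a \<in> words" "u' \<in> words" "u' \<noteq> []" "x0 = \<phi> a y" "\<phi> u' y = y"
    "aff p1 ` cyl a \<subseteq> cyl a"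
    using periodic_fixed_point[OF hom lam p1F c1 ex1 N1 N2 p1L] by blast
  obtain e' where e': "e' \<ge> 1" "lin (wpow e' u') = mat (ratio (wpow e' u'))"
    using scalar_word_power[OF fin fix_(4)] by blast
  define u where "u = wpow e' u'"
  define M where "M = length u"
  define \<Lambda> where "\<Lambda> = lam ^ M"
  have u: "u \<in> words" "lin u = mat \<Lambda>"
    using e' wpow_words[OF fix_(4)] ratio by (simp_all add: u_def \<Lambda>_def M_def)
  have uy: "\<phi> u y = y" unfolding u_def by (induction e') (simp_all add: wpow_Suc phi_append fix_(7))
  have "M > 0" using e'(1) fix_(5) by (simp add: M_def u_def length_wpow)
  then have \<Lambda>: "0 < \<Lambda>" "\<Lambda> < 1" using lam by (simp_all add: \<Lambda>_def power_less_one_iff)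
  have au: "a @ u \<in> words" using fix_ u by simp
  have dphi: "\<phi> K x - \<phi> K z = lin K *v (x - z)" for K x z
    using aff_diff[of "(lin K, \<phi> K 0)" x z] unfolding phi_aff[symmetric] by simp
  \<comment> \<open>Since \<open>\<phi> u\<close> is the homothety with centre \<open>y\<close>,
    transporting it by \<open>\<phi> a\<close> gives the homothety with centre \<open>x0\<close> on
    \<open>cyl a\<close>.\<close>
  have au_eq: "\<phi> (a @ u) w = x0 + \<Lambda> *\<^sub>R (\<phi> a w - x0)" for w
  proof -
    have "\<phi> u w = y + \<Lambda> *\<^sub>R (w - y)" using dphi[of u w y] uy u(2) by (simp add: mat_mult_vector algebra_simps)
    then have "\<phi> a (\<phi> u w) - \<phi> a y = \<Lambda> *\<^sub>R (\<phi> a w - \<phi> a y)"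
      using dphi[of a "y + \<Lambda> *\<^sub>R (w - y)" y] dphi[of a w y] by (simp add: matrix_vector_mult_scaleR)
    then show ?thesis unfolding phi_append fix_(6) by (simp add: algebra_simps)
  qed
  define X where "X = {z. x0 + z \<in> cyl a}"
  have x0au: "x0 \<in> cyl (a @ u)"
    unfolding cyl_append fix_(6) using uy fix_(2) by (metis cyl_def imageI)
  interpret scaled_germ X \<Lambda> "gap * ratio (a @ u)" "N * lam ^ L" A1
  proof
    have "X = (\<lambda>z. - x0 + z) ` cyl a"
    proof (intro set_eqI iffI)
      fix z assume "z \<in> X"
      then show "z \<in> (\<lambda>z. - x0 + z) ` cyl a" by (intro image_eqI[of _ _ "x0 + z"]) (auto simp: X_def)
    qed (auto simp: X_def)
    then show "compact X" using compact_translation[OF compact_cyl, of "- x0" a] by simp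
    show "0 < \<Lambda>" "\<Lambda> < 1" "0 < gap * ratio (a @ u)" using \<Lambda> gap(1) ratio_pos[OF au] by simp_all
    show "\<Lambda> *\<^sub>R z \<in> X" if z: "z \<in> X" for z
    proof -
      obtain w where w: "w \<in> F" "x0 + z = \<phi> a w" using z by (auto simp: X_def cyl_def)
      have "\<phi> (a @ u) w = x0 + \<Lambda> *\<^sub>R z" unfolding au_eq w(2)[symmetric] by simp
      moreover have "\<phi> (a @ u) w \<in> cyl a"
        using cyl_append_subset[OF fix_(3) u(1)] w(1) unfolding cyl_def by blast
      ultimately show ?thesis by (simp add: X_def)
    qed
    \<comment> \<open>Separation puts the points of \<open>cyl a\<close> near \<open>x0\<close> into
      \<open>cyl (a @ u)\<close>, which is the image of \<open>cyl a\<close> under the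
      homothety.\<close>
    show "(1 / \<Lambda>) *\<^sub>R z \<in> X" if z: "z \<in> X" "norm z < gap * ratio (a @ u)" for z
    proof -
      have "x0 + z \<in> cyl (a @ u)"
        by (rule near_cyl'[OF au x0au]) (use z cyl_subset_F[OF fix_(3)] in \<open>auto simp: X_def dist_norm\<close>)
      then obtain w where w: "w \<in> F" "x0 + z = \<phi> (a @ u) w" by (auto simp: cyl_def)
      then have "(1 / \<Lambda>) *\<^sub>R z = \<phi> a w - x0" using au_eq[of w] \<Lambda>(1) by simp
      then show ?thesis using w(1) by (simp add: X_def cyl_def)
    qed
    show "A1 *v z \<in> X" if z: "z \<in> X" for z
    proof -
      have "aff p1 (x0 + z) = x0 + A1 *v z"
        using aff_diff[of p1 "x0 + z" x0] fix_(1) by (simp add: A1_def algebra_simps)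
      then show ?thesis using z fix_(8) by (force simp: X_def)
    qed
    show "0 \<le> N * lam ^ L" "N * lam ^ L < 1" using N1 N2 by simp_all
    show "norm (A1 *v v) \<le> N * lam ^ L * norm v" for v
      using p1L[of v 0] aff_diff[of p1 v 0] by (simp add: A1_def dist_norm)
    show "x = 0" if "\<And>t. 0 \<le> t \<Longrightarrow> t \<le> 1 \<Longrightarrow> t *\<^sub>R x \<in> X" for x
      by (rule segment_not_in_F[of x0]) (use that cyl_subset_F[OF fix_(3)] in \<open>auto simp: X_def\<close>)
    show "K = 0" if K: "\<And>z. z \<in> X \<Longrightarrow> K *v z = 0" for K :: "real^2^2"
    proof -
      have "(K, - (K *v x0)) = 0"
      proof (rule aff_eq_on_cyl[OF fix_(3)])
        fix w assume "w \<in> cyl a"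
        then show "aff (K, - (K *v x0)) w = aff 0 w"
          using K[of "w - x0"] by (simp add: aff_def X_def matrix_vector_mult_diff_distrib)
      qed
      then show ?thesis by (simp add: zero_prod_def)
    qed
  qed
  have "lam ^ L * \<gamma>' \<noteq> lam ^ L * \<gamma> \<and> (\<exists>n\<ge>1. \<exists>k. \<bar>lam ^ L * \<gamma>\<bar> ^ n = \<Lambda> ^ k)"
  proof (rule dominant_eigenvalue)
    show "A1 *v (A1 *v v) = (lam ^ L * \<gamma> + lam ^ L * \<gamma>') *\<^sub>R (A1 *v v) - (lam ^ L * \<gamma> * (lam ^ L * \<gamma>')) *\<^sub>R v" for v
      by (simp add: A1 matrix_vector_mult_scaleR roots[folded A_def] algebra_simps)
    show "lam ^ L * \<gamma> \<noteq> 0" using lam nz by simp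
    show "A1 \<noteq> mat (lam ^ L * \<gamma>')"
    proof
      assume eq: "A1 = mat (lam ^ L * \<gamma>')"
      have "A *v v = mat \<gamma>' *v v" for v
      proof -
        have "(lam ^ L) *\<^sub>R (A *v v) = (lam ^ L) *\<^sub>R (\<gamma>' *\<^sub>R v)"
          using A1[of v] unfolding eq mat_mult_vector by simp
        then show ?thesis using L0 unfolding mat_mult_vector scaleR_cancel_left by (metis less_irrefl)
      qed
      then show False using ns by (simp add: A_def matrix_eq)
    qed
    show "\<bar>lam ^ L * \<gamma>'\<bar> < \<bar>lam ^ L * \<gamma>\<bar> \<or> lam ^ L * \<gamma>' = lam ^ L * \<gamma>"
      using dom L0 by (auto simp: abs_mult)
  qed
  then obtain n k where nk: "\<gamma>' \<noteq> \<gamma>" "n \<ge> 1" "\<bar>lam ^ L * \<gamma>\<bar> ^ n = \<Lambda> ^ k" by auto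
  have "lam ^ (L * n) * \<bar>\<gamma>\<bar> ^ n = lam ^ (M * k)"
    using nk(3) L0 by (simp add: abs_mult power_mult_distrib power_mult \<Lambda>_def)
  then have "\<bar>\<gamma>\<bar> ^ n = lam powi (int (M * k)) / lam powi (int (L * n))"
    using lam unfolding power_int_of_nat by (simp add: field_simps)
  also have "\<dots> = lam powi (int (M * k) - int (L * n))" using lam by (simp add: power_int_diff)
  finally show ?thesis using nk by blast
qed

section \<open>Inverse embeddings, determinants and the case distinction on eigenvalues\<close>

text \<open>The image of \<open>p\<close> contains a cylinder, hence also \<open>cyl W\<close> for a
  power \<open>W\<close> of its word with scalar linear part. The inverse of \<open>p\<close> after
  \<open>\<phi> W\<close> then maps \<open>F\<close> into itself, and its linear part is a multiple
  of the inverse of that of \<open>p\<close>.\<close>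

lemma inverse_embedding:
  assumes fin: "finite (gen_group (Q ` {1..l}))"
    and pF: "aff p ` F \<subseteq> F" and c: "c > 0" "expands c (aff p)"
  obtains W q where "W \<in> words" "aff q ` F \<subseteq> F" "\<exists>c>0. expands c (aff q)"
    "\<And>v. fst q *v (fst p *v v) = ratio W *\<^sub>R v"
proof -
  obtain J where J: "J \<in> words" "cyl J \<subseteq> aff p ` F" using open_image[OF pF c(2,1)] by blast
  obtain e where e: "e \<ge> 1" "lin (wpow e J) = mat (ratio (wpow e J))" using scalar_word_power[OF fin J(1)] by blast
  define W where "W = wpow e J"
  have W: "W \<in> words" "lin W = mat (ratio W)" using e wpow_words[OF J(1)] by (simp_all add: W_def)
  obtain e' where "e = Suc e'" using e(1) by (cases e) auto
  then have WJ: "cyl W \<subseteq> cyl J" using cyl_append_subset[OF J(1) wpow_words[OF J(1)]] by (simp add: W_def wpow_Suc)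
  obtain u where u: "aff u \<circ> aff p = id" "aff p \<circ> aff u = id" using aff_left_inverse[OF c(2,1)] by metis
  have up: "aff u (aff p z) = z" "aff p (aff u z) = z" for z
    using fun_cong[OF u(1), of z] fun_cong[OF u(2), of z] by simp_all
  obtain q where q: "aff q = aff u \<circ> \<phi> W" "fst q = fst u ** lin W"
    using aff_comp[of u "(lin W, \<phi> W 0)"] unfolding phi_aff[symmetric] by auto
  have "aff q ` F \<subseteq> F"
  proof
    fix y assume "y \<in> aff q ` F"
    then obtain z where z: "z \<in> F" "y = aff u (\<phi> W z)" by (auto simp: q(1))
    then have "\<phi> W z \<in> cyl J" using WJ by (auto simp: cyl_def[of W])
    then obtain x where x: "x \<in> F" "\<phi> W z = aff p x" using J(2) by (meson imageE subsetD)
    then show "y \<in> F" using z(2) up by (simp only: x(2))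
  qed
  moreover have "\<exists>c>0. expands c (aff q)"
  proof (intro exI conjI)
    define N where "N = norm (fst p) + 1"
    have N: "N > 0" by (simp add: N_def add_nonneg_pos)
    show "ratio W / N > 0" using N ratio_pos[OF W(1)] by simp
    show "expands (ratio W / N) (aff q)"
      unfolding expands_def
    proof (intro allI)
      fix x y
      have "ratio W * dist x y = dist (\<phi> W x) (\<phi> W y)" by (simp add: dist_phi[OF W(1)])
      also have "\<dots> = dist (aff p (aff q x)) (aff p (aff q y))" by (simp add: q(1) up)
      also have "\<dots> \<le> norm (fst p) * dist (aff q x) (aff q y)" by (rule aff_lipschitz)
      also have "\<dots> \<le> N * dist (aff q x) (aff q y)" unfolding N_def by (intro mult_right_mono) auto
      finally show "ratio W / N * dist x y \<le> dist (aff q x) (aff q y)" using N by (simp add: field_simps)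
    qed
  qed
  moreover have "fst q *v (fst p *v v) = ratio W *\<^sub>R v" for v
  proof -
    have "fst q *v (fst p *v v) = ratio W *\<^sub>R (fst u *v (fst p *v v))"
      by (simp add: q(2) W(2) matrix_vector_mul_assoc[symmetric] mat_mult_vector matrix_vector_mult_scaleR)
    also have "fst u *v (fst p *v v) = v"
      using aff_diff[of u "aff p v" "aff p 0"] aff_diff[of p v 0] by (simp add: up)
    finally show ?thesis .
  qed
  ultimately show ?thesis using that W(1) by blast
qed

lemma abs_det_lin: "J \<in> words \<Longrightarrow> \<bar>det (lin J)\<bar> = (ratio J)\<^sup>2"
proof -
  assume J: "J \<in> words"
  have "det (transpose (lin J) ** lin J) = ((ratio J)\<^sup>2)\<^sup>2"
    unfolding transpose_lin_lin[OF J] by (simp add: det_2 mat_def power2_eq_square)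
  then have "(det (lin J))\<^sup>2 = ((ratio J)\<^sup>2)\<^sup>2" by (simp add: det_mul det_transpose power2_eq_square)
  then show ?thesis unfolding power2_eq_iff by auto
qed

text \<open>The form from \<open>conformal_form\<close> is multiplied by a constant under the linear
  part, so all powers have distortion bounded in terms of \<alpha> and \<beta>. Comparing
  determinants in the relation from \<open>conformal_power\<close> gives the equation.\<close>

lemma conformal_det:
  assumes pF: "aff p ` F \<subseteq> F"
    and conf: "(trace (fst p))\<^sup>2 < 4 * det (fst p) \<or> (trace (fst p) = 0 \<and> det (fst p) < 0) \<or> (\<exists>c. c \<noteq> 0 \<and> fst p = mat c)"
  shows "\<exists>k\<ge>1. \<exists>I\<in>words. \<exists>J\<in>words. \<bar>det (fst p)\<bar> ^ k * (ratio I)\<^sup>2 = (ratio J)\<^sup>2"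
proof -
  define d where "d = \<bar>det (fst p)\<bar>"
  obtain q :: "pt \<Rightarrow> real" and \<alpha> \<beta> where q: "\<alpha> > 0" "\<beta> > 0" "\<And>v. q (fst p *v v) = d * q v"
    "\<And>v. \<alpha> * (norm v)\<^sup>2 \<le> q v" "\<And>v. q v \<le> \<beta> * (norm v)\<^sup>2"
    using conformal_form[OF conf] unfolding d_def by metis
  have d0: "d > 0"
  proof -
    have "det (fst p) \<noteq> 0"
      using conf
    proof (elim disjE)
      assume "(trace (fst p))\<^sup>2 < 4 * det (fst p)"
      then show ?thesis using zero_le_power2[of "trace (fst p)"] by linarith
    qed (auto simp: det_2 mat_def)
    then show ?thesis by (simp add: d_def)
  qed
  have qn: "q ((aff p ^^ n) x - (aff p ^^ n) y) = d ^ n * q (x - y)" for n x y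
    by (induction n) (auto simp: aff_diff q(3))
  have "\<exists>k\<ge>1. \<exists>I\<in>words. \<exists>J\<in>words. (aff p ^^ k) \<circ> \<phi> I = \<phi> J"
  proof (rule conformal_power[OF pF, of "\<alpha> / \<beta>"])
    show "\<alpha> / \<beta> > 0" using q by simp
    fix n
    \<comment> \<open>The \<open>n\<close>-th power multiplies the form \<open>q\<close> by
      \<open>d ^ n\<close>. Comparing \<open>q\<close> with the squared norm gives this upper bound,
      and likewise the lower bound \<open>\<alpha> / \<beta> * M\<close>.\<close>
    define M where "M = sqrt (d ^ n * \<beta> / \<alpha>)"
    have M: "M > 0" "M\<^sup>2 = d ^ n * \<beta> / \<alpha>" using d0 q by (simp_all add: M_def)
    show "\<exists>M>0. (\<forall>x y. dist ((aff p ^^ n) x) ((aff p ^^ n) y) \<le> M * dist x y) \<and> expands (\<alpha> / \<beta> * M) (aff p ^^ n)"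
    proof (intro exI conjI allI)
      show "M > 0" by (rule M(1))
      fix x y
      define v where "v = (aff p ^^ n) x - (aff p ^^ n) y"
      have "\<alpha> * (norm v)\<^sup>2 \<le> d ^ n * (\<beta> * (norm (x - y))\<^sup>2)"
        using q(4)[of v] q(5)[of "x - y"] d0 unfolding v_def qn by (meson mult_left_mono order_trans zero_le_power less_imp_le)
      then have "(norm v)\<^sup>2 \<le> (M * norm (x - y))\<^sup>2" using q(1) by (simp add: power_mult_distrib M(2) field_simps)
      then show "dist ((aff p ^^ n) x) ((aff p ^^ n) y) \<le> M * dist x y"
        unfolding dist_norm v_def[symmetric] by (rule power2_le_imp_le) (use M(1) in simp)
    next
      show "expands (\<alpha> / \<beta> * M) (aff p ^^ n)"
        unfolding expands_def
      proof (intro allI)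
        fix x y
        define v where "v = (aff p ^^ n) x - (aff p ^^ n) y"
        have *: "d ^ n * (\<alpha> * (norm (x - y))\<^sup>2) \<le> \<beta> * (norm v)\<^sup>2"
          using q(5)[of v] q(4)[of "x - y"] d0 unfolding v_def qn by (meson mult_left_mono order_trans zero_le_power less_imp_le)
        then have "(\<alpha> / \<beta> * M * norm (x - y))\<^sup>2 \<le> (norm v)\<^sup>2"
        proof -
          have "(\<alpha> / \<beta> * M * norm (x - y))\<^sup>2 = d ^ n * (\<alpha> * (norm (x - y))\<^sup>2) / \<beta>"
            using q(1,2) unfolding power_mult_distrib M(2) power_divide by (simp add: power2_eq_square)
          also have "\<dots> \<le> \<beta> * (norm v)\<^sup>2 / \<beta>" using * q(2) by (intro divide_right_mono) auto
          finally show ?thesis using q(2) by simp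
        qed
        then show "\<alpha> / \<beta> * M * dist x y \<le> dist ((aff p ^^ n) x) ((aff p ^^ n) y)"
          unfolding dist_norm v_def[symmetric] by (rule power2_le_imp_le) simp
      qed
    qed
  qed
  then obtain k I J where k: "k \<ge> 1" "I \<in> words" "J \<in> words" "(aff p ^^ k) \<circ> \<phi> I = \<phi> J" by blast
  have "\<exists>u. aff p ^^ n = aff u \<and> det (fst u) = det (fst p) ^ n" for n
  proof (induction n)
    case 0
    show ?case by (intro exI[of _ "(mat 1, 0)"]) (auto simp: aff_def)
  next
    case (Suc n)
    then obtain u where u: "aff p ^^ n = aff u" "det (fst u) = det (fst p) ^ n" by blast
    obtain w where w: "aff p \<circ> aff u = aff w" "fst w = fst p ** fst u" using aff_comp by blast
    have "aff p ^^ Suc n = aff w" using u(1) w(1) by simp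
    then show ?case using u(2) w(2) by (intro exI[of _ w]) (simp add: det_mul)
  qed
  then obtain u where u: "aff p ^^ k = aff u" "det (fst u) = det (fst p) ^ k" by blast
  obtain w where w: "aff u \<circ> \<phi> I = aff w" "fst w = fst u ** lin I"
    using aff_comp[of u "(lin I, \<phi> I 0)"] unfolding phi_aff[symmetric] by auto
  have "aff w = aff (lin J, \<phi> J 0)" using k(4) unfolding u(1) w(1) phi_aff[symmetric] by simp
  then have "fst w = lin J" unfolding aff_eq_iff by simp
  then have "det (fst p) ^ k * det (lin I) = det (lin J)" using w(2) u(2) by (metis det_mul)
  then have "\<bar>det (fst p)\<bar> ^ k * (ratio I)\<^sup>2 = (ratio J)\<^sup>2"
    by (simp only: abs_det_lin[OF k(2), symmetric] abs_det_lin[OF k(3), symmetric] abs_mult[symmetric] power_abs[symmetric])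
  then show ?thesis using k by blast
qed

text \<open>The cases follow the discriminant \<open>D\<close>. Non-real, opposite or equal scalar
  eigenvalues have squared modulus \<open>\<bar>det A\<bar>\<close>, so \<open>conformal_det\<close>
  suffices. For two real eigenvalues of different modulus, \<open>real_eigenvalue\<close> treats the
  larger one directly and the smaller one through the inverse embedding.\<close>

lemma eigenvalues_if_finite_group:
  assumes hom: "\<And>i. i \<in> {1..l} \<Longrightarrow> \<bar>r i\<bar> = lam" and lam: "0 < lam" "lam < 1"
    and fin: "finite (gen_group (Q ` {1..l}))"
    and pF: "aff p ` F \<subseteq> F" and c: "c > 0" "expands c (aff p)" and det0: "det (fst p) \<noteq> 0"
  shows "diagonalizable_C (fst p) \<and> (\<forall>\<gamma>. eigenvalue_C (fst p) \<gamma> \<longrightarrow> (\<exists>t::rat. cmod \<gamma> = lam powr (real_of_rat t)))"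
proof -
  define A where "A = fst p"
  define D where "D = (trace A)\<^sup>2 - 4 * det A"
  have ratio: "ratio J = lam ^ length J" if "J \<in> words" for J
    using that by (induction J) (auto simp: ratio_Cons hom)
  have root: "\<exists>t::rat. x = lam powr (real_of_rat t)" if "x \<ge> 0" "x ^ n = lam powi k" "n \<ge> 1" for x n k
  proof -
    have "x ^ n > 0" using that lam by (simp add: zero_less_power_int)
    then have "x > 0" using that by (metis less_eq_real_def not_one_le_zero power_0_left less_irrefl)
    then have "x = (x ^ n) powr (1 / real n)"
      using that(3) by (simp add: powr_realpow[symmetric] powr_powr)
    also have "\<dots> = lam powr (of_int k / real n)"
      using that(2) lam by (simp add: powr_real_of_int'[symmetric] powr_powr)
    also have "of_int k / real n = real_of_rat (of_int k / of_nat n)" by (simp add: of_rat_divide)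
    finally show ?thesis by blast
  qed
  have conf_case: "\<exists>t::rat. cmod \<gamma> = lam powr (real_of_rat t)"
    if conf: "(trace A)\<^sup>2 < 4 * det A \<or> (trace A = 0 \<and> det A < 0) \<or> (\<exists>c. c \<noteq> 0 \<and> A = mat c)"
      and \<gamma>: "(cmod \<gamma>)\<^sup>2 = \<bar>det A\<bar>" for \<gamma>
  proof -
    obtain k I J where k: "k \<ge> 1" "I \<in> words" "J \<in> words" "\<bar>det A\<bar> ^ k * (ratio I)\<^sup>2 = (ratio J)\<^sup>2"
      using conformal_det[OF pF conf[unfolded A_def]] unfolding A_def by blast
    have sq: "lam ^ (2 * length K) = (ratio K)\<^sup>2" if "K \<in> words" for K
      unfolding ratio[OF that] power_even_eq ..
    have "cmod \<gamma> ^ (2 * k) * lam ^ (2 * length I) = lam ^ (2 * length J)"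
      unfolding sq[OF k(2)] sq[OF k(3)] power_mult[of "cmod \<gamma>"] \<gamma> by (rule k(4))
    then have "cmod \<gamma> ^ (2 * k) = lam powi (int (2 * length J)) / lam powi (int (2 * length I))"
      using lam unfolding power_int_of_nat by (simp add: field_simps)
    also have "\<dots> = lam powi (int (2 * length J) - int (2 * length I))" using lam by (simp add: power_int_diff)
    finally show ?thesis using k(1) by (intro root[of _ "2 * k"]) auto
  qed
  have distinct: "diagonalizable_C A" if "D \<noteq> 0"
  proof (rule diagonalizable_C_if_distinct)
    define w where "w = csqrt (of_real D)"
    have w: "w\<^sup>2 = of_real D" "w \<noteq> 0" using that by (simp_all add: w_def)
    show "(of_real (trace A) + w) / 2 + (of_real (trace A) - w) / 2 = complex_of_real (trace A)" by (simp add: field_simps)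
    have "(of_real (trace A) + w) / 2 * ((of_real (trace A) - w) / 2) = (of_real (trace A) ^ 2 - w\<^sup>2) / 4"
      by (simp add: field_simps power2_eq_square)
    also have "\<dots> = of_real (det A)" unfolding w(1) by (simp add: D_def)
    finally show "(of_real (trace A) + w) / 2 * ((of_real (trace A) - w) / 2) = complex_of_real (det A)" .
    show "(of_real (trace A) + w) / 2 \<noteq> (of_real (trace A) - w) / 2" using w(2) by (simp add: field_simps)
  qed
  have char: "\<gamma>\<^sup>2 - of_real (trace A) * \<gamma> + of_real (det A) = 0" if "eigenvalue_C A \<gamma>" for \<gamma>
    using eigenvalue_C_char[OF that] .
  consider (complex) "D < 0" | (opposite) "D > 0" "trace A = 0" | (real) "D > 0" "trace A \<noteq> 0"
    | (scalar) x where "D = 0" "A = mat x" | (jordan) "D = 0" "\<nexists>x. A = mat x"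
    by (meson linorder_neqE_linordered_idom)
  then show ?thesis
  proof cases
    case complex
    have "\<exists>t::rat. cmod \<gamma> = lam powr (real_of_rat t)" if "eigenvalue_C A \<gamma>" for \<gamma>
    proof (rule conf_case)
      show "(trace A)\<^sup>2 < 4 * det A \<or> (trace A = 0 \<and> det A < 0) \<or> (\<exists>c. c \<noteq> 0 \<and> A = mat c)"
        using complex by (simp add: D_def)
      define x y where "x = Re \<gamma>" "y = Im \<gamma>"
      have re: "x\<^sup>2 - y\<^sup>2 - trace A * x + det A = 0" and im: "2 * x * y - trace A * y = 0"
        using arg_cong[OF char[OF that], of Re] arg_cong[OF char[OF that], of Im]
        by (simp_all add: x_y_def Re_power2 Im_power2)
      have "y \<noteq> 0"
      proof
        assume "y = 0"
        then have "D = (2 * x - trace A)\<^sup>2" using re unfolding D_def by algebra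
        then show False using complex by simp
      qed
      then have x2: "2 * x = trace A" using im by (metis mult.commute mult.assoc mult_right_cancel right_minus_eq)
      have "x\<^sup>2 + y\<^sup>2 = det A" using re by (simp add: power2_eq_square flip: x2)
      then show "(cmod \<gamma>)\<^sup>2 = \<bar>det A\<bar>" using sum_power2_ge_zero[of x y] by (simp add: cmod_power2 x_y_def)
    qed
    then show ?thesis using distinct complex unfolding A_def by simp
  next
    case opposite
    have "\<exists>t::rat. cmod \<gamma> = lam powr (real_of_rat t)" if "eigenvalue_C A \<gamma>" for \<gamma>
    proof (rule conf_case)
      show "(trace A)\<^sup>2 < 4 * det A \<or> (trace A = 0 \<and> det A < 0) \<or> (\<exists>c. c \<noteq> 0 \<and> A = mat c)"
        using opposite by (simp add: D_def)
      have "\<gamma>\<^sup>2 = of_real (- det A)" using char[OF that] opposite by (simp add: add_eq_0_iff2)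
      then have "cmod (\<gamma>\<^sup>2) = \<bar>- det A\<bar>" by (simp only: norm_of_real)
      then show "(cmod \<gamma>)\<^sup>2 = \<bar>det A\<bar>" by (simp add: norm_power)
    qed
    then show ?thesis using distinct opposite unfolding A_def by simp
  next
    case (scalar x)
    have x: "x \<noteq> 0" "det A = x\<^sup>2" "trace A = 2 * x"
      using scalar det0 unfolding A_def[symmetric] by (auto simp: det_2 mat_def trace_def sum_2 power2_eq_square)
    have "\<exists>t::rat. cmod \<gamma> = lam powr (real_of_rat t)" if "eigenvalue_C A \<gamma>" for \<gamma>
    proof (rule conf_case)
      show "(trace A)\<^sup>2 < 4 * det A \<or> (trace A = 0 \<and> det A < 0) \<or> (\<exists>c. c \<noteq> 0 \<and> A = mat c)"
        using scalar x by blast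
      have "(\<gamma> - of_real x)\<^sup>2 = 0" using char[OF that] x by (simp add: power2_eq_square algebra_simps)
      then have "\<gamma> = of_real x" by simp
      then show "(cmod \<gamma>)\<^sup>2 = \<bar>det A\<bar>" using x by simp
    qed
    then show ?thesis using diagonalizable_C_scalar[of x] scalar unfolding A_def by simp
  next
    case jordan
    define x where "x = trace A / 2"
    have x: "x + x = trace A" "x * x = det A" using jordan by (auto simp: x_def D_def power2_eq_square field_simps)
    have "x \<noteq> 0" using x(2) det0 by (auto simp: A_def)
    \<comment> \<open>Applied to a double root, \<open>real_eigenvalue\<close> asserts that the root
      differs from itself, which rules out the Jordan block.\<close>
    then have "x \<noteq> x \<and> (\<exists>n\<ge>1. \<exists>k. \<bar>x\<bar> ^ n = lam powi k)"
      using x jordan(2) cayley_hamilton_2[of A] unfolding A_def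
      by (intro real_eigenvalue[OF hom lam fin pF c]) auto
    then show ?thesis by simp
  next
    case real
    define s where "s = sqrt D"
    have s: "s > 0" "s\<^sup>2 = D" using real by (simp_all add: s_def)
    \<comment> \<open>The sign of the trace decides which root has the larger modulus; \<gamma>1 is
      that one.\<close>
    define \<gamma>1 where "\<gamma>1 = (if trace A > 0 then (trace A + s) / 2 else (trace A - s) / 2)"
    define \<gamma>2 where "\<gamma>2 = (if trace A > 0 then (trace A - s) / 2 else (trace A + s) / 2)"
    have g: "\<gamma>1 + \<gamma>2 = trace A" "\<bar>\<gamma>2\<bar> < \<bar>\<gamma>1\<bar>"
      using s(1) real(2) by (auto simp: \<gamma>1_def \<gamma>2_def abs_if field_simps)
    have "4 * (\<gamma>1 * \<gamma>2) = (trace A)\<^sup>2 - s\<^sup>2"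
      by (simp add: \<gamma>1_def \<gamma>2_def power2_eq_square field_simps)
    then have gp: "\<gamma>1 * \<gamma>2 = det A" by (simp add: s D_def)
    have nz: "\<gamma>1 \<noteq> 0" "\<gamma>2 \<noteq> 0" using gp det0 by (auto simp: A_def)
    have ns: "A \<noteq> mat x" for x
    proof
      assume "A = mat x"
      then have "D = 0" by (simp add: D_def trace_def sum_2 det_2 mat_def power2_eq_square)
      then show False using real by simp
    qed
    have CH: "A *v (A *v v) = (\<gamma>1 + \<gamma>2) *\<^sub>R (A *v v) - (\<gamma>1 * \<gamma>2) *\<^sub>R v" for v
      using cayley_hamilton_2[of A v] g gp by simp
    obtain n1 k1 where 1: "n1 \<ge> 1" "\<bar>\<gamma>1\<bar> ^ n1 = lam powi k1"
      using real_eigenvalue[OF hom lam fin pF c CH[unfolded A_def] nz(1)] ns g(2) unfolding A_def by blast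
    \<comment> \<open>The linear part \<open>B\<close> of \<open>q\<close> is \<mu> times the
      inverse of \<open>A\<close>. Its eigenvalues are \<open>\<mu> / \<gamma>2\<close> and
      \<open>\<mu> / \<gamma>1\<close>, of which the first now dominates; since \<mu> is a power of
      \<open>lam\<close>, the conclusion transfers back to \<gamma>2.\<close>
    obtain W q where q: "W \<in> words" "aff q ` F \<subseteq> F" "\<exists>c>0. expands c (aff q)"
      "\<And>v. fst q *v (A *v v) = ratio W *\<^sub>R v" using inverse_embedding[OF fin pF c, folded A_def] by metis
    obtain c' where c': "c' > 0" "expands c' (aff q)" using q(3) by blast
    define \<mu> where "\<mu> = ratio W"
    have \<mu>: "\<mu> > 0" using ratio_pos[OF q(1)] by (simp add: \<mu>_def)
    define B where "B = fst q"
    have BA: "B *v (A *v v) = \<mu> *\<^sub>R v" for v using q(4) by (simp add: B_def \<mu>_def)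
    have AB: "A *v (B *v v) = \<mu> *\<^sub>R v" for v
    proof -
      have "((1 / \<mu>) *\<^sub>R B) ** A = mat 1"
        using BA \<mu> by (simp add: matrix_eq matrix_vector_mul_assoc[symmetric] scaleR_matrix_vector_assoc[symmetric])
      then have "A ** ((1 / \<mu>) *\<^sub>R B) = mat 1" using matrix_left_right_inverse by blast
      then have "A *v (((1 / \<mu>) *\<^sub>R B) *v v) = v" by (simp add: matrix_vector_mul_assoc)
      then have "(1 / \<mu>) *\<^sub>R (A *v (B *v v)) = v" by (simp add: scaleR_matrix_vector_assoc[symmetric] matrix_vector_mult_scaleR)
      then show ?thesis using \<mu> by (metis divide_inverse mult_1 scaleR_scaleR right_inverse less_irrefl scaleR_one)
    qed
    have BCH: "B *v (B *v v) = (\<mu> / \<gamma>2 + \<mu> / \<gamma>1) *\<^sub>R (B *v v) - (\<mu> / \<gamma>2 * (\<mu> / \<gamma>1)) *\<^sub>R v" for v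
    proof -
      have "(\<gamma>1 * \<gamma>2) *\<^sub>R (B *v (B *v v)) = (\<gamma>1 + \<gamma>2) *\<^sub>R (A *v (B *v (B *v v))) - A *v (A *v (B *v (B *v v)))"
        using CH[of "B *v (B *v v)"] by simp
      also have "\<dots> = ((\<gamma>1 + \<gamma>2) * \<mu>) *\<^sub>R (B *v v) - (\<mu> * \<mu>) *\<^sub>R v"
        by (simp add: AB matrix_vector_mult_scaleR)
      finally have "(1 / (\<gamma>1 * \<gamma>2)) *\<^sub>R ((\<gamma>1 * \<gamma>2) *\<^sub>R (B *v (B *v v)))
          = (1 / (\<gamma>1 * \<gamma>2)) *\<^sub>R (((\<gamma>1 + \<gamma>2) * \<mu>) *\<^sub>R (B *v v) - (\<mu> * \<mu>) *\<^sub>R v)" by simp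
      moreover have "1 / (\<gamma>1 * \<gamma>2) * ((\<gamma>1 + \<gamma>2) * \<mu>) = \<mu> / \<gamma>2 + \<mu> / \<gamma>1"
        "1 / (\<gamma>1 * \<gamma>2) * (\<mu> * \<mu>) = \<mu> / \<gamma>2 * (\<mu> / \<gamma>1)" "1 / (\<gamma>1 * \<gamma>2) * (\<gamma>1 * \<gamma>2) = 1"
        using nz by (simp_all add: field_simps)
      ultimately show ?thesis by (simp only: scaleR_diff_right scaleR_scaleR scaleR_one)
    qed
    have "B \<noteq> mat (\<mu> / \<gamma>1)"
    proof
      assume eq: "B = mat (\<mu> / \<gamma>1)"
      have "A *v v = mat \<gamma>1 *v v" for v
      proof -
        have "(\<mu> / \<gamma>1) *\<^sub>R (A *v v) = (\<mu> / \<gamma>1) *\<^sub>R (\<gamma>1 *\<^sub>R v)"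
          using BA[of v] nz(1) unfolding eq mat_mult_vector by simp
        moreover have "\<mu> / \<gamma>1 \<noteq> 0" using \<mu> nz(1) by simp
        ultimately show ?thesis unfolding mat_mult_vector scaleR_cancel_left by blast
      qed
      then show False using ns[of \<gamma>1] by (simp add: matrix_eq)
    qed
    moreover have "\<bar>\<mu> / \<gamma>1\<bar> < \<bar>\<mu> / \<gamma>2\<bar>"
      using \<mu> g(2) nz by (simp add: abs_divide divide_strict_left_mono)
    moreover have "\<mu> / \<gamma>2 \<noteq> 0" using \<mu> nz by simp
    ultimately obtain n2 k2 where 2: "n2 \<ge> 1" "\<bar>\<mu> / \<gamma>2\<bar> ^ n2 = lam powi k2"
      using real_eigenvalue[OF hom lam fin q(2) c' BCH[unfolded B_def]] unfolding B_def by blast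
    have 3: "\<bar>\<gamma>2\<bar> ^ n2 = lam powi (int (length W * n2) - k2)"
    proof -
      have "\<mu> ^ n2 = lam powi (int (length W * n2))"
        unfolding power_int_of_nat using ratio[OF q(1)] by (simp add: \<mu>_def power_mult)
      moreover have "\<bar>\<gamma>2\<bar> ^ n2 * \<bar>\<mu> / \<gamma>2\<bar> ^ n2 = \<mu> ^ n2"
        using nz \<mu> by (simp add: power_mult_distrib[symmetric] abs_divide)
      ultimately have "\<bar>\<gamma>2\<bar> ^ n2 * lam powi k2 = lam powi (int (length W * n2))" using 2 by simp
      then show ?thesis using lam by (simp add: power_int_diff field_simps)
    qed
    have "\<exists>t::rat. cmod \<gamma> = lam powr (real_of_rat t)" if "eigenvalue_C A \<gamma>" for \<gamma>
    proof -
      have "(\<gamma> - of_real \<gamma>1) * (\<gamma> - of_real \<gamma>2) = 0"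
        using char[OF that] unfolding g(1)[symmetric] gp[symmetric] by (simp add: power2_eq_square algebra_simps)
      then have "cmod \<gamma> = \<bar>\<gamma>1\<bar> \<or> cmod \<gamma> = \<bar>\<gamma>2\<bar>" by auto
      then show ?thesis using root[OF _ 1(2,1)] root[OF _ 3 2(1)] by auto
    qed
    then show ?thesis using distinct real unfolding A_def by simp
  qed
qed

end

theorem theorem1p1:
  fixes l :: nat and r :: "nat \<Rightarrow> real" and Q :: "nat \<Rightarrow> real^2^2" and \<tau> :: "nat \<Rightarrow> real^2"
    and F :: "(real^2) set" and A :: "real^2^2" and t :: "real^2"
  assumes l2: "l \<ge> 2"
    and contr: "\<forall>i\<in>{1..l}. r i \<noteq> 0 \<and> \<bar>r i\<bar> < 1 \<and> orthogonal_matrix (Q i)"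
    and attr: "compact F" "F \<noteq> {}" "F = (\<Union>i\<in>{1..l}. ifs_map r Q \<tau> i ` F)"
    and SSC: "\<forall>i\<in>{1..l}. \<forall>j\<in>{1..l}. i \<noteq> j \<longrightarrow> ifs_map r Q \<tau> i ` F \<inter> ifs_map r Q \<tau> j ` F = {}"
    and not_line: "\<not> collinear F"
    and dim: "0 < hausdorff_dim F" "hausdorff_dim F < 2"
    and GL: "invertible A"
    and inv: "(\<lambda>z. A *v z + t) ` F \<subseteq> F"
  shows
    "(infinite (gen_group (Q ` {1..l})) \<longrightarrow>
        similarity (\<lambda>z. A *v z + t) \<and>
        (\<exists>k::nat. \<exists>I J. k \<ge> 1 \<and> set I \<subseteq> {1..l} \<and> set J \<subseteq> {1..l} \<and>
           ((\<lambda>z. A *v z + t) ^^ k) \<circ> word_map (ifs_map r Q \<tau>) I = word_map (ifs_map r Q \<tau>) J))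
   \<and> (\<forall>lam::real. finite (gen_group (Q ` {1..l})) \<and> 0 < lam \<and> lam < 1 \<and> (\<forall>i\<in>{1..l}. \<bar>r i\<bar> = lam) \<longrightarrow>
        diagonalizable_C A \<and>
        (\<forall>\<gamma>. eigenvalue_C A \<gamma> \<longrightarrow> (\<exists>p::rat. cmod \<gamma> = lam powr (real_of_rat p))))"
proof -
  interpret ssc_ifs l r Q \<tau> F
    by unfold_locales (rule l2 contr attr SSC not_line)+
  define p where "p = (A, t)"
  have p: "(\<lambda>z. A *v z + t) = aff p" "fst p = A" by (auto simp: p_def aff_def)
  have pF: "aff p ` F \<subseteq> F" using inv unfolding p(1) .
  have det0: "det A \<noteq> 0" using GL by (simp add: invertible_det_nz)
  have "inj ((*v) A)" using GL by (simp add: invertible_left_inverse matrix_left_invertible_injective)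
  then obtain c where c: "c > 0" "\<And>v. c * norm v \<le> norm (A *v v)"
    using linear_inj_bounded_below_pos[OF matrix_vector_mul_linear] by metis
  have ex: "expands c (aff p)"
    unfolding expands_def dist_norm aff_diff p(2) using c(2) by blast
  have w: "I \<in> words \<longleftrightarrow> set I \<subseteq> {1..l}" for I by (auto simp: words_def)
  show ?thesis
  proof (intro conjI impI allI)
    assume "infinite (gen_group (Q ` {1..l}))"
    then obtain a where a: "a > 0" "transpose (fst p) ** fst p = mat a"
      using conformal_if_infinite_group[OF pF c(1) ex] by blast
    show "similarity (\<lambda>z. A *v z + t)" unfolding p(1) by (rule similarity_of_conformal(1)[OF pF a])
    show "\<exists>k::nat. \<exists>I J. k \<ge> 1 \<and> set I \<subseteq> {1..l} \<and> set J \<subseteq> {1..l} \<and>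
       ((\<lambda>z. A *v z + t) ^^ k) \<circ> word_map (ifs_map r Q \<tau>) I = word_map (ifs_map r Q \<tau>) J"
      using similarity_of_conformal(2)[OF pF a] unfolding p(1) w[symmetric] by blast
  next
    fix lam :: real
    assume "finite (gen_group (Q ` {1..l})) \<and> 0 < lam \<and> lam < 1 \<and> (\<forall>i\<in>{1..l}. \<bar>r i\<bar> = lam)"
    then have *: "diagonalizable_C A \<and> (\<forall>\<gamma>. eigenvalue_C A \<gamma> \<longrightarrow> (\<exists>p::rat. cmod \<gamma> = lam powr (real_of_rat p)))"
      using eigenvalues_if_finite_group[OF _ _ _ _ pF c(1) ex, of lam] det0 unfolding p(2) by blast
    show "diagonalizable_C A" using * by blast
    show "\<exists>p::rat. cmod \<gamma> = lam powr (real_of_rat p)" if "eigenvalue_C A \<gamma>" for \<gamma>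
      using * that by blast
  qed
qed

end
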